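(* Let $\mathcal{A}$ be an irreducible simplicial hyperplane arrangement in $\mathbb{P}^3(\mathbb{R})$. If $m(\mathcal{A})=6$, then $\mathcal{A}$ is isomorphic to $\mathcal{A}(A_4)$ or to $\mathcal{A}(D_4)$. In particular, $\mathcal{A}$ is a simply laced Grünbaum–Shephard arrangement whose characteristic polynomial splits over $\mathbb{R}$.
   Context: An arrangement in $\mathbb{P}^3(\mathbb{R})$ is a finite set of projective hyperplanes (images of linear hyperplanes of $\mathbb{R}^4$) with empty common intersection; it induces a cell decomposition of $\mathbb{P}^3$, and two arrangements are isomorphic if their cell decompositions are isomorphic. The 3-cells are chambers; each is bounded by at least $4$ hyperplanes (walls); $\mathcal{A}$ is simplicial if every chamber has exactly $4$ walls. $\mathcal{A}$ is reducible if, after a linear change of coordinates, $\mathbb{R}^4=V_1\oplus V_2$ with $V_1,V_2\neq 0$ and every linear hyperplane corresponding to $\mathcal{A}$ is of the form $H_1\oplus V_2$ with $H_1$ a hyperplane of $V_1$ or $V_1\oplus H_2$ with $H_2$ a hyperplane of $V_2$ (i.e. $\mathcal{A}$ is a product of two arrangements); otherwise it is irreducible. Vertices are the points of $\mathbb{P}^3$ that are intersections of hyperplanes of $\mathcal{A}$ (1-dimensional intersections in $\mathbb{R}^4$), lines the 2-dimensional intersections in $\mathbb{R}^4$; weights count the hyperplanes containing them; $h^\mathcal{A}_i$ is the number of lines of weight $i$, and $m(\mathcal{A})$ is the maximal weight of a vertex. $\mathcal{A}(A_4)$ is the reflection arrangement of the Coxeter group $A_4$ (the $10$ hyperplanes $x_i=x_j$,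 $1\le i<j\le5$, in $\{x\in\mathbb{R}^5:\sum x_i=0\}\cong\mathbb{R}^4$), and $\mathcal{A}(D_4)$ is the reflection arrangement of $D_4$ (the $12$ hyperplanes $x_i=\pm x_j$, $1\le i<j\le 4$, in $\mathbb{R}^4$), viewed projectively. $\mathcal{A}$ is simply laced if for every chamber $C$ and every pair of distinct walls $H,H'$ of $C$, at most three hyperplanes contain $H\cap H'$. $\mathcal{A}$ is a Grünbaum–Shephard arrangement if $h^\mathcal{A}_2>\sum_{i\ge3}h^\mathcal{A}_i$. The characteristic polynomial is $\chi(\mathcal{A},t)=\sum_{X\in L}\mu(\mathbb{R}^4,X)t^{\dim X}$ with $L$ the intersection lattice (reverse inclusion) and $\mu$ its Möbius function. *)

theory Defs
  imports "HOL-Analysis.Analysis" "HOL-Computational_Algebra.Polynomial"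
begin

type_synonym vec4 = "real^4"

text \<open>A projective arrangement in P^3(R) is given by the corresponding finite set of
  linear hyperplanes of R^4 (as subsets of R^4) with trivial common intersection.\<close>
definition lin_hyperplane :: "vec4 set \<Rightarrow> bool" where
  "lin_hyperplane H \<longleftrightarrow> (\<exists>a. a \<noteq> 0 \<and> H = {x. a \<bullet> x = 0})"

definition arrangement :: "vec4 set set \<Rightarrow> bool" where
  "arrangement A \<longleftrightarrow> finite A \<and> (\<forall>H\<in>A. lin_hyperplane H) \<and> \<Inter>A = {0}"

definition sameside :: "vec4 set \<Rightarrow> vec4 \<Rightarrow> vec4 \<Rightarrow> bool" where
  "sameside H x y \<longleftrightarrow> (x \<in> H \<and> y \<in> H) \<or> (x \<notin> H \<and> y \<notin> H \<and> closed_segment x y \<inter> H = {})"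

text \<open>Nonzero vectors x, y represent points in the same cell of the projective cell
  decomposition iff y or -y lies in the same face of the central arrangement as x.\<close>
definition samecell :: "vec4 set set \<Rightarrow> vec4 \<Rightarrow> vec4 \<Rightarrow> bool" where
  "samecell A x y \<longleftrightarrow> (\<forall>H\<in>A. sameside H x y) \<or> (\<forall>H\<in>A. sameside H x (- y))"

text \<open>Cells of P^3, each represented by its (cone) preimage in R^4 minus 0.\<close>
definition cells :: "vec4 set set \<Rightarrow> vec4 set set" where
  "cells A = {{y. y \<noteq> 0 \<and> samecell A x y} | x. x \<noteq> (0::vec4)}"

definition arr_iso :: "vec4 set set \<Rightarrow> vec4 set set \<Rightarrow> bool" where
  "arr_iso A B \<longleftrightarrow> (\<exists>f. bij_betw f (cells A) (cells B) \<and>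
     (\<forall>C\<in>cells A. \<forall>D\<in>cells A. C \<subseteq> closure D \<longleftrightarrow> f C \<subseteq> closure (f D)))"

definition chambers :: "vec4 set set \<Rightarrow> vec4 set set" where
  "chambers A = {C \<in> cells A. \<forall>H\<in>A. C \<inter> H = {}}"

definition walls :: "vec4 set set \<Rightarrow> vec4 set \<Rightarrow> vec4 set set" where
  "walls A C = {H \<in> A. dim (H \<inter> closure C) = 3}"

definition simplicial :: "vec4 set set \<Rightarrow> bool" where
  "simplicial A \<longleftrightarrow> (\<forall>C\<in>chambers A. card (walls A C) = 4)"

definition reducible :: "vec4 set set \<Rightarrow> bool" where
  "reducible A \<longleftrightarrow> (\<exists>V1 V2. subspace V1 \<and> subspace V2 \<and> V1 \<noteq> {0} \<and> V2 \<noteq> {0} \<and>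
      V1 \<inter> V2 = {0} \<and> (\<forall>z. \<exists>x\<in>V1. \<exists>y\<in>V2. z = x + y) \<and>
      (\<forall>H\<in>A. V2 \<subseteq> H \<or> V1 \<subseteq> H))"

definition int_lattice :: "vec4 set set \<Rightarrow> vec4 set set" where
  "int_lattice A = {\<Inter>B | B. B \<subseteq> A}"

definition weight :: "vec4 set set \<Rightarrow> vec4 set \<Rightarrow> nat" where
  "weight A X = card {H \<in> A. X \<subseteq> H}"

definition vertices :: "vec4 set set \<Rightarrow> vec4 set set" where
  "vertices A = {X \<in> int_lattice A. dim X = 1}"

definition lines :: "vec4 set set \<Rightarrow> vec4 set set" where
  "lines A = {X \<in> int_lattice A. dim X = 2}"

definition h_num :: "vec4 set set \<Rightarrow> nat \<Rightarrow> nat" where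
  "h_num A i = card {X \<in> lines A. weight A X = i}"

definition max_vertex_weight :: "vec4 set set \<Rightarrow> nat" where
  "max_vertex_weight A = Max (weight A ` vertices A)"

definition simply_laced :: "vec4 set set \<Rightarrow> bool" where
  "simply_laced A \<longleftrightarrow> (\<forall>C\<in>chambers A. \<forall>H\<in>walls A C. \<forall>H'\<in>walls A C.
      H \<noteq> H' \<longrightarrow> card {K \<in> A. H \<inter> H' \<subseteq> K} \<le> 3)"

text \<open>Weights of lines are at most card A, so the sum over i \<ge> 3 is finite.\<close>
definition grunbaum_shephard :: "vec4 set set \<Rightarrow> bool" where
  "grunbaum_shephard A \<longleftrightarrow> h_num A 2 > (\<Sum>i\<in>{3..card A}. h_num A i)"

text \<open>Moebius function mu(R^4, X) on the intersection lattice (reverse inclusion),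
  computed by the defining recursion mu(R^4,R^4)=1,
  mu(R^4,X) = - sum over Y with X strictly contained in Y of mu(R^4,Y).
  The first argument is recursion fuel; chains in the lattice have length at most 4,
  so fuel 4 suffices.\<close>
fun mob_aux :: "nat \<Rightarrow> vec4 set set \<Rightarrow> vec4 set \<Rightarrow> real" where
  "mob_aux 0 A X = (if X = UNIV then 1 else 0)"
| "mob_aux (Suc n) A X = (if X = UNIV then 1 else
      - (\<Sum>Y\<in>{Y \<in> int_lattice A. X \<subset> Y}. mob_aux n A Y))"

definition mobius :: "vec4 set set \<Rightarrow> vec4 set \<Rightarrow> real" where
  "mobius A X = mob_aux 4 A X"

definition char_poly :: "vec4 set set \<Rightarrow> real poly" where
  "char_poly A = (\<Sum>X\<in>int_lattice A. monom (mobius A X) (dim X))"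

definition splits_over_R :: "real poly \<Rightarrow> bool" where
  "splits_over_R p \<longleftrightarrow> (\<exists>c rs. p = smult c (\<Prod>r\<leftarrow>rs. [:- r, 1:]))"

text \<open>Reflection arrangement A_4, transported to R^4 via the linear isomorphism
  R^4 -> {x in R^5. sum x_i = 0}, (x1,..,x4) |-> (x1,..,x4, -(x1+..+x4)).
  Then x_i = x_j (i,j \<le> 4) and x_i = x_5, i.e. x_i + (x1+x2+x3+x4) = 0.\<close>
definition arr_A4 :: "vec4 set set" where
  "arr_A4 = {{x. a \<bullet> x = 0} | a. (\<exists>i j. i \<noteq> j \<and> a = axis i 1 - axis j 1)
                                  \<or> (\<exists>i. a = axis i 1 + (\<chi> k. 1))}"

definition arr_D4 :: "vec4 set set" where
  "arr_D4 = {{x. a \<bullet> x = 0} | a. \<exists>i j. i \<noteq> j \<and>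
                                  (a = axis i 1 - axis j 1 \<or> a = axis i 1 + axis j 1)}"

end

theory Submission
  imports Defs
begin

text \<open>Call a normal vector of a hyperplane of the arrangement a root. A simplicial chamber gives a
  base \<open>\<alpha>\<close> of four roots such that every root has coordinates of one sign. Passing to the chamber
  behind the wall \<open>i\<close> replaces \<open>\<alpha> i\<close> by \<open>- \<alpha> i\<close> and \<open>\<alpha> j\<close> by \<open>\<alpha> j + c j i \<alpha> i\<close> with \<open>c j i \<ge> 0\<close>, and
  \<open>c j i > 0\<close> iff more than two hyperplanes contain the intersection of the walls \<open>i\<close> and \<open>j\<close>. This
  defines a diagram on the four walls. Since at most six hyperplanes meet in a vertex, two incident
  edges of the diagram force the roots spanned by their three nodes to be those of type $A_3$: the
  diagram has no triangles, and all edges have weight three as soon as it is connected, which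
  is what irreducibility means. It follows that the numbers \<open>c j i\<close> are the same for all chambers, so
  that the chambers are permuted by a reflection group given by the diagram. The diagram is
  a path, a star or a 4-cycle; the cycle would give infinitely many hyperplanes, while the trees give
  $A_4$ and $D_4$ up to a linear change of coordinates. The remaining claims are invariant
  under such a change and are computed for the two models.\<close>

section \<open>Chambers and their bases\<close>

text \<open>At the start there are no reflections and no invariant inner product; the standard
  product of R^4 only pairs normals with points. Chambers are therefore compared by linear algebra
  alone: bases of normals, dual bases of rays, and the fact that no root has coordinates of mixed
  sign. The bound six works by counting supports. For three nodes with two incident edges, the three
  wall normals, the two edge roots and one further root have six different supports, so they exhaust
  the hyperplanes through a vertex of the chamber, and every root vanishing there is parallel to one
  of them. Comparing coordinates yields \<open>c i j * c j i = 1\<close> and the ratios of all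
  coordinates. Only this product is determined, since rescaling the normals changes its factors: on
  a tree all factors can be made 1, whereas around a cycle an invariant may survive, which the
  weights that exclude the 4-cycle must absorb. For the trees, a walk to the opposite chamber takes
  the place of the group: it has to cross every hyperplane, so the normals crossed list the
  arrangement.\<close>

definition hyp :: "vec4 \<Rightarrow> vec4 set" where
  "hyp a = {x. a \<bullet> x = 0}"

text \<open>The arrangement singles out no length or sign, so all nonzero multiples count;
  \<open>base\<close> fixes signs, and lengths stay free until the final rescaling.\<close>

definition roots :: "vec4 set set \<Rightarrow> vec4 set" where
  "roots A = {a. a \<noteq> 0 \<and> hyp a \<in> A}"

lemma hyp_scale: "s \<noteq> 0 \<Longrightarrow> hyp (s *\<^sub>R a) = hyp a"
  by (auto simp: hyp_def)

lemma hyp_minus: "hyp (- a) = hyp a"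
  by (auto simp: hyp_def)

lemma hyp_eqD:
  assumes "hyp a = hyp b" "a \<noteq> 0" "b \<noteq> 0"
  obtains s where "s \<noteq> 0" "b = s *\<^sub>R a"
proof -
  define k where "k = (a \<bullet> b) / (a \<bullet> a)"
  \<comment> \<open>The component of \<open>b\<close> orthogonal to \<open>a\<close> lies in both
    hyperplanes, hence is orthogonal to itself.\<close>
  define w where "w = b - k *\<^sub>R a"
  have "a \<bullet> w = 0"
    using assms(2) by (simp add: w_def k_def inner_diff_right)
  moreover from this have "b \<bullet> w = 0"
    using assms(1) by (auto simp: hyp_def)
  ultimately have "w \<bullet> w = 0"
    by (simp add: w_def inner_diff_left inner_diff_right algebra_simps)
  then have "b = k *\<^sub>R a"
    by (simp add: w_def)
  with assms(3) that[of k] show ?thesis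
    by auto
qed

lemma roots_nonzero: "a \<in> roots A \<Longrightarrow> a \<noteq> 0"
  by (simp add: roots_def)

lemma roots_scale: "a \<in> roots A \<Longrightarrow> s \<noteq> 0 \<Longrightarrow> s *\<^sub>R a \<in> roots A"
  by (simp add: roots_def hyp_scale)

lemma roots_minus: "a \<in> roots A \<Longrightarrow> - a \<in> roots A"
  by (simp add: roots_def hyp_minus)

lemma arrangement_hypE:
  assumes "arrangement A" "H \<in> A"
  obtains a where "a \<in> roots A" "H = hyp a"
  using assms by (auto simp: arrangement_def lin_hyperplane_def roots_def hyp_def)

lemma finite_hyp_roots: "arrangement A \<Longrightarrow> finite (hyp ` roots A)"
  by (rule finite_subset[of _ A]) (auto simp: arrangement_def roots_def)

text \<open>Replaces the segment condition by equality of signs, the form in which cells are used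
  from here on.\<close>

lemma sameside_hyp: "sameside (hyp a) x y \<longleftrightarrow> sgn (a \<bullet> x) = sgn (a \<bullet> y)"
proof (cases "a \<bullet> x = 0 \<or> a \<bullet> y = 0")
  case True
  then show ?thesis
    by (auto simp: sameside_def hyp_def sgn_if)
next
  case False
  have "closed_segment x y \<inter> hyp a = {} \<longleftrightarrow> sgn (a \<bullet> x) = sgn (a \<bullet> y)"
  proof
    assume L: "closed_segment x y \<inter> hyp a = {}"
    show "sgn (a \<bullet> x) = sgn (a \<bullet> y)"
    proof (rule ccontr)
      assume "sgn (a \<bullet> x) \<noteq> sgn (a \<bullet> y)"
      then have n: "(a \<bullet> x > 0 \<and> a \<bullet> y < 0) \<or> (a \<bullet> x < 0 \<and> a \<bullet> y > 0)"
        using False by (auto simp: sgn_if split: if_splits)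
      \<comment> \<open>The parameter at which the affine function \<open>a \<bullet> _\<close>
        vanishes on the segment.\<close>
      define u where "u = (a \<bullet> x) / (a \<bullet> x - a \<bullet> y)"
      have u: "0 \<le> u" "u \<le> 1"
        using n by (auto simp: u_def field_simps)
      have "a \<bullet> ((1 - u) *\<^sub>R x + u *\<^sub>R y) = a \<bullet> x - u * (a \<bullet> x - a \<bullet> y)"
        by (simp add: inner_add_right algebra_simps)
      also have "\<dots> = 0"
        using n by (auto simp: u_def)
      finally have "(1 - u) *\<^sub>R x + u *\<^sub>R y \<in> closed_segment x y \<inter> hyp a"
        using u by (auto simp: hyp_def in_segment)
      with L show False
        by blast
    qed
  next
    assume R: "sgn (a \<bullet> x) = sgn (a \<bullet> y)"
    show "closed_segment x y \<inter> hyp a = {}"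
    proof (rule ccontr)
      assume "closed_segment x y \<inter> hyp a \<noteq> {}"
      then obtain u where u: "0 \<le> u" "u \<le> 1"
        and z: "(1 - u) * (a \<bullet> x) + u * (a \<bullet> y) = 0"
        by (auto simp: in_segment hyp_def inner_add_right)
      have "(a \<bullet> x > 0 \<and> a \<bullet> y > 0) \<or> (a \<bullet> x < 0 \<and> a \<bullet> y < 0)"
        using R False by (auto simp: sgn_if split: if_splits)
      then show False
      proof
        assume p: "a \<bullet> x > 0 \<and> a \<bullet> y > 0"
        then have "(1 - u) * (a \<bullet> x) \<ge> 0" "u * (a \<bullet> y) \<ge> 0"
          using u by auto
        with z have "(1 - u) * (a \<bullet> x) = 0" "u * (a \<bullet> y) = 0"
          by linarith+
        with p show False by auto
      next
        assume p: "a \<bullet> x < 0 \<and> a \<bullet> y < 0"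
        then have "(1 - u) * (a \<bullet> x) \<le> 0" "u * (a \<bullet> y) \<le> 0"
          using u by (auto simp: mult_le_0_iff)
        with z have "(1 - u) * (a \<bullet> x) = 0" "u * (a \<bullet> y) = 0"
          by linarith+
        with p show False by auto
      qed
    qed
  qed
  with False show ?thesis
    by (auto simp: sameside_def hyp_def)
qed

section \<open>Generic points and the facets of a chamber\<close>

text \<open>Removing one hyperplane from a nonempty open set leaves a nonempty open set: a point on
  the hyperplane can be moved off it along the normal.\<close>

lemma avoid_hyperplanes:
  fixes N :: "'a::euclidean_space set"
  assumes "finite N" "0 \<notin> N" "open U" "U \<noteq> {}"
  shows "\<exists>x\<in>U. \<forall>n\<in>N. n \<bullet> x \<noteq> 0"
  using assms
proof (induction N arbitrary: U rule: finite_induct)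
  case empty
  then show ?case by auto
next
  case (insert n N)
  let ?V = "U \<inter> {x. n \<bullet> x \<noteq> 0}"
  have n0: "n \<noteq> 0"
    using insert.prems by auto
  have "closed {x. n \<bullet> x = 0}"
    by (rule closed_hyperplane)
  then have "open (- {x. n \<bullet> x = 0})"
    by (simp add: open_Compl)
  moreover have "- {x. n \<bullet> x = 0} = {x. n \<bullet> x \<noteq> 0}"
    by auto
  ultimately have op: "open ?V"
    using insert.prems by auto
  obtain x where x: "x \<in> U"
    using insert.prems by auto
  have "?V \<noteq> {}"
  proof (cases "n \<bullet> x = 0")
    case True
    obtain d where d: "d > 0" "ball x d \<subseteq> U"
      using x insert.prems by (meson openE)
    define t where "t = d / (2 * norm n)"
    have t: "t > 0"
      using d n0 by (simp add: t_def)
    have "dist x (x + t *\<^sub>R n) = d / 2"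
      using d n0 by (simp add: dist_norm t_def)
    then have "x + t *\<^sub>R n \<in> U"
      using d by auto
    moreover have "n \<bullet> (x + t *\<^sub>R n) \<noteq> 0"
      using True t n0 by (simp add: inner_add_right)
    ultimately show ?thesis by blast
  qed (use x in auto)
  from insert.IH[OF _ op this] insert.prems show ?case
    by auto
qed

text \<open>Near \<open>z\<close> only \<open>K\<close> matters, so a small piece of
  \<open>K\<close> around \<open>z\<close> lies in the closure of the chamber; such a piece spans
  \<open>K\<close>.\<close>

lemma wall_if_relatively_interior:
  assumes arr: "arrangement A" and x0: "\<And>H. H \<in> A \<Longrightarrow> n H \<bullet> x0 > 0"
    and n: "\<And>H. H \<in> A \<Longrightarrow> hyp (n H) = H"
    and K: "K \<in> A" "n K \<bullet> z = 0" "\<And>H. H \<in> A \<Longrightarrow> H \<noteq> K \<Longrightarrow> n H \<bullet> z > 0"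
  shows "K \<in> walls A {y. y \<noteq> 0 \<and> samecell A x0 y}"
proof -
  let ?C = "{y. y \<noteq> 0 \<and> samecell A x0 y}"
  have finA: "finite A"
    using arr by (simp add: arrangement_def)
  have nK: "n K \<noteq> 0"
    using x0[OF K(1)] by auto
  have C: "y \<in> ?C" if "\<And>H. H \<in> A \<Longrightarrow> n H \<bullet> y > 0" for y
  proof -
    have "y \<noteq> 0"
      using that[OF K(1)] by auto
    moreover have "sameside H x0 y" if "H \<in> A" for H
      using sameside_hyp[of "n H" x0 y] n[OF that] x0[OF that] \<open>\<And>H. H \<in> A \<Longrightarrow> n H \<bullet> y > 0\<close>[OF that]
      by simp
    ultimately show ?thesis
      by (auto simp: samecell_def)
  qed
  have "open (\<Inter>H\<in>A - {K}. {w. n H \<bullet> w > 0})"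
    using finA by (intro open_INT) (auto simp: open_halfspace_gt)
  moreover have "z \<in> (\<Inter>H\<in>A - {K}. {w. n H \<bullet> w > 0})"
    using K by auto
  ultimately obtain d where d: "d > 0" "ball z d \<subseteq> (\<Inter>H\<in>A - {K}. {w. n H \<bullet> w > 0})"
    by (rule openE)
  have cl: "w \<in> closure ?C" if w: "w \<in> K" "w \<in> ball z d" for w
    unfolding closure_approachable
  proof (intro allI impI)
    fix r :: real
    assume r: "r > 0"
    \<comment> \<open>The shift along \<open>n K\<close> is half of the smaller of \<open>r\<close>
      and the room left in the ball, so it stays close to \<open>w\<close> and inside the
      ball.\<close>
    define s where "s = min r (d - dist z w) / (2 * norm (n K))"
    have m: "min r (d - dist z w) > 0"
      using r w by simp
    then have s: "s > 0"
      using nK by (simp add: s_def)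
    have ds: "dist (w + s *\<^sub>R n K) w = min r (d - dist z w) / 2"
      using m nK by (simp add: dist_norm s_def)
    have "dist z (w + s *\<^sub>R n K) \<le> dist z w + dist w (w + s *\<^sub>R n K)"
      by (rule dist_triangle)
    also have "\<dots> < d"
      using ds w r by (simp add: dist_commute min_def split: if_splits)
    finally have "w + s *\<^sub>R n K \<in> ball z d"
      by simp
    then have "n H \<bullet> (w + s *\<^sub>R n K) > 0" if "H \<in> A" "H \<noteq> K" for H
      using d that by blast
    moreover have "n K \<bullet> w = 0"
      using w n[OF K(1)] by (auto simp: hyp_def)
    then have "n K \<bullet> (w + s *\<^sub>R n K) > 0"
      using s nK by (simp add: inner_add_right)
    ultimately have "w + s *\<^sub>R n K \<in> ?C"
      by (intro C) blast
    moreover have "dist (w + s *\<^sub>R n K) w < r"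
      using ds r w by (simp add: min_def split: if_splits)
    ultimately show "\<exists>y\<in>?C. dist y w < r"
      by blast
  qed
  have zK: "z \<in> K"
    using n[OF K(1)] K(2) by (auto simp: hyp_def)
  have subK: "subspace K"
    using n[OF K(1)] unfolding hyp_def by (metis subspace_hyperplane)
  have "K \<subseteq> span (K \<inter> closure ?C)"
  proof
    fix k
    assume k: "k \<in> K"
    show "k \<in> span (K \<inter> closure ?C)"
    proof (cases "k = 0")
      case False
      define s where "s = d / (2 * norm k)"
      have s: "s > 0"
        using d False by (simp add: s_def)
      have "dist z (z + s *\<^sub>R k) = d / 2"
        using False d by (simp add: dist_norm s_def)
      then have "z + s *\<^sub>R k \<in> ball z d"
        using d by simp
      moreover have "z + s *\<^sub>R k \<in> K"
        using subK zK k by (simp add: subspace_add subspace_scale)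
      ultimately have a: "z + s *\<^sub>R k \<in> span (K \<inter> closure ?C)"
        using cl by (intro span_base) blast
      have b: "z \<in> span (K \<inter> closure ?C)"
        using cl[OF zK] zK d by (intro span_base) auto
      have "k = (1 / s) *\<^sub>R ((z + s *\<^sub>R k) - z)"
        using s by simp
      also have "\<dots> \<in> span (K \<inter> closure ?C)"
        using a b by (intro span_scale span_diff)
      finally show ?thesis .
    qed (simp add: span_zero)
  qed
  then have "dim K \<le> dim (K \<inter> closure ?C)"
    by (rule dim_subset[THEN order_trans]) (simp add: dim_span)
  moreover have "dim (K \<inter> closure ?C) \<le> dim K"
    by (rule dim_subset) auto
  moreover have "dim K = 3"
    using dim_hyperplane[OF nK] n[OF K(1)] by (simp add: hyp_def)
  ultimately show ?thesis
    using K(1) by (simp add: walls_def)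
qed

text \<open>A chamber is cut out by its walls. A violating \<open>y\<close> is perturbed to a
  generic \<open>w\<close>; the segment from \<open>x0\<close> to \<open>w\<close> first leaves the
  chamber through exactly one hyperplane, which is a wall by
  \<open>wall_if_relatively_interior\<close>, although \<open>w\<close> lies on the positive side of
  all walls.\<close>

lemma nonneg_on_walls_imp_nonneg:
  assumes arr: "arrangement A" and x0: "\<And>H. H \<in> A \<Longrightarrow> n H \<bullet> x0 > 0"
    and n: "\<And>H. H \<in> A \<Longrightarrow> hyp (n H) = H"
    and y: "\<And>H. H \<in> walls A {y. y \<noteq> 0 \<and> samecell A x0 y} \<Longrightarrow> n H \<bullet> y \<ge> 0"
    and K0: "K0 \<in> A"
  shows "n K0 \<bullet> y \<ge> 0"
proof (rule ccontr)
  assume "\<not> n K0 \<bullet> y \<ge> 0"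
  then have neg: "n K0 \<bullet> y < 0" by simp
  let ?W = "walls A {y. y \<noteq> 0 \<and> samecell A x0 y}"
  have finA: "finite A"
    using arr by (simp add: arrangement_def)
  have WA: "?W \<subseteq> A"
    by (auto simp: walls_def)
  define U where "U = (\<Inter>H\<in>?W. {w. n H \<bullet> w > 0}) \<inter> {w. n K0 \<bullet> w < 0}"
  have "finite ?W"
    by (rule finite_subset[OF WA finA])
  then have opU: "open U"
    unfolding U_def
    by (intro open_Int open_INT) (auto simp: open_halfspace_gt open_halfspace_lt)
  \<comment> \<open>Adding \<open>d\<close> times \<open>x0\<close> makes the wall inequalities
    strict while only halving the negative value at \<open>K0\<close>.\<close>
  define d where "d = - (n K0 \<bullet> y) / (2 * (n K0 \<bullet> x0))"
  have d: "d > 0"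
    using neg x0[OF K0] by (simp add: d_def divide_neg_pos)
  have "d * (n K0 \<bullet> x0) = - (n K0 \<bullet> y) / 2"
    using x0[OF K0] by (simp add: d_def)
  then have "n K0 \<bullet> (y + d *\<^sub>R x0) = (n K0 \<bullet> y) / 2"
    by (simp add: inner_add_right)
  then have "n K0 \<bullet> (y + d *\<^sub>R x0) < 0"
    using neg by simp
  moreover have "n H \<bullet> (y + d *\<^sub>R x0) > 0" if "H \<in> ?W" for H
  proof -
    have "n H \<bullet> x0 > 0"
      using that WA x0 by blast
    then have "d * (n H \<bullet> x0) > 0"
      using d by simp
    then show ?thesis
      using y[OF that] by (simp add: inner_add_right)
  qed
  ultimately have "y + d *\<^sub>R x0 \<in> U"
    by (simp add: U_def)
  then have neU: "U \<noteq> {}" by blast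
  \<comment> \<open>If the segment from \<open>x0\<close> to \<open>w\<close> meets \<open>H\<close>
    and \<open>K\<close> at the same parameter, then \<open>g H K \<bullet> w = 0\<close>; avoiding
    these normals makes the crossing times distinct.\<close>
  define g where "g H K = (n K \<bullet> x0) *\<^sub>R n H - (n H \<bullet> x0) *\<^sub>R n K" for H K
  define N where "N = (\<lambda>(H, K). g H K) ` (A \<times> A - Id)"
  have finN: "finite N"
    unfolding N_def using finA by simp
  have N0: "0 \<notin> N"
  proof
    assume "0 \<in> N"
    then obtain p where p: "0 = (case p of (H, K) \<Rightarrow> g H K)" "p \<in> A \<times> A - Id"
      unfolding N_def by (rule imageE)
    obtain H K where "p = (H, K)"
      by (rule prod.exhaust)
    with p have HK: "H \<in> A" "K \<in> A" "H \<noteq> K" and g: "g H K = 0"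
      by simp_all
    have "(n K \<bullet> x0) *\<^sub>R n H = (n H \<bullet> x0) *\<^sub>R n K"
      using g by (simp add: g_def)
    then have "hyp ((n K \<bullet> x0) *\<^sub>R n H) = hyp ((n H \<bullet> x0) *\<^sub>R n K)"
      by simp
    then have "hyp (n H) = hyp (n K)"
      using x0[OF HK(1)] x0[OF HK(2)] by (simp add: hyp_scale)
    then show False
      using n HK by simp
  qed
  from avoid_hyperplanes[OF finN N0 opU neU] obtain w
    where w: "w \<in> U" and gen: "\<forall>v\<in>N. v \<bullet> w \<noteq> 0"
    by (rule bexE)
  define S where "S = {K \<in> A. n K \<bullet> w \<le> 0}"
  \<comment> \<open>The time at which the segment from \<open>x0\<close> to \<open>w\<close> meets
    \<open>K\<close>; the minimiser over \<open>S\<close> is the hyperplane met first.\<close>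
  define \<tau> where "\<tau> K = (n K \<bullet> x0) / (n K \<bullet> x0 - n K \<bullet> w)" for K
  have "K0 \<in> S"
    using w K0 by (auto simp: S_def U_def)
  have finS: "finite S"
    using finA by (simp add: S_def)
  define K where "K = arg_min_on \<tau> S"
  have K: "K \<in> S"
    unfolding K_def using finS \<open>K0 \<in> S\<close> by (intro arg_min_if_finite(1)) auto
  have min: "\<tau> K \<le> \<tau> H" if "H \<in> S" for H
    unfolding K_def using finS that by (intro arg_min_least) auto
  have KA: "K \<in> A"
    using K by (simp add: S_def)
  have Kw: "n K \<bullet> x0 > 0" "n K \<bullet> w \<le> 0"
    using K x0[OF KA] by (auto simp: S_def)
  then have \<tau>: "0 < \<tau> K" "\<tau> K \<le> 1"
    by (auto simp: \<tau>_def divide_le_eq_1)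
  define z where "z = (1 - \<tau> K) *\<^sub>R x0 + \<tau> K *\<^sub>R w"
  have nz: "n H \<bullet> z = n H \<bullet> x0 - \<tau> K * (n H \<bullet> x0 - n H \<bullet> w)" for H
    by (simp add: z_def inner_add_right algebra_simps)
  have \<tau>_eq: "\<tau> H * (n H \<bullet> x0 - n H \<bullet> w) = n H \<bullet> x0" if "n H \<bullet> x0 - n H \<bullet> w > 0" for H
    using that by (simp add: \<tau>_def)
  have zK: "n K \<bullet> z = 0"
    using \<tau>_eq[of K] Kw by (simp add: nz)
  have zH: "n H \<bullet> z > 0" if H: "H \<in> A" "H \<noteq> K" for H
  proof (cases "H \<in> S")
    case True
    have pos: "n H \<bullet> x0 - n H \<bullet> w > 0" "n K \<bullet> x0 - n K \<bullet> w > 0"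
      using True K x0[OF KA] x0[OF H(1)] by (auto simp: S_def)
    have "\<tau> K \<noteq> \<tau> H"
    proof
      assume "\<tau> K = \<tau> H"
      then have "(n K \<bullet> x0) * (n H \<bullet> x0 - n H \<bullet> w) = (n H \<bullet> x0) * (n K \<bullet> x0 - n K \<bullet> w)"
        using \<tau>_eq[OF pos(1)] \<tau>_eq[OF pos(2)] by (metis mult.assoc mult.commute)
      then have "g H K \<bullet> w = 0"
        by (simp add: g_def inner_diff_left algebra_simps)
      moreover have "g H K \<in> N"
        using H KA by (force simp: N_def)
      ultimately show False
        using gen by blast
    qed
    with min[OF True] have "\<tau> K < \<tau> H" by simp
    then have "\<tau> K * (n H \<bullet> x0 - n H \<bullet> w) < \<tau> H * (n H \<bullet> x0 - n H \<bullet> w)"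
      using pos by simp
    also have "\<dots> = n H \<bullet> x0"
      by (rule \<tau>_eq[OF pos(1)])
    finally show ?thesis
      by (simp add: nz)
  next
    case False
    then have p: "n H \<bullet> w > 0"
      using H by (auto simp: S_def)
    have "n H \<bullet> z = (1 - \<tau> K) * (n H \<bullet> x0) + \<tau> K * (n H \<bullet> w)"
      by (simp add: z_def inner_add_right)
    also have "\<dots> > 0"
      using \<tau> p x0[OF H(1)] by (simp add: add_nonneg_pos)
    finally show ?thesis .
  qed
  have "K \<in> ?W"
    by (rule wall_if_relatively_interior[OF arr x0 n KA zK zH])
  then have "n K \<bullet> w > 0"
    using w by (auto simp: U_def)
  with K show False
    by (simp add: S_def)
qed

text \<open>A base consists of the normals of the four walls of a chamber, pointing inwards, and
  the dual basis, which spans the rays of the chamber. The numbers \<open>b \<bullet> e i\<close> are thus the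
  coordinates of \<open>b\<close> with respect to \<open>\<alpha>\<close>.\<close>

definition base :: "vec4 set set \<Rightarrow> (4 \<Rightarrow> vec4) \<Rightarrow> (4 \<Rightarrow> vec4) \<Rightarrow> bool" where
  "base A \<alpha> e \<longleftrightarrow> (\<forall>i. \<alpha> i \<in> roots A) \<and> (\<forall>i j. \<alpha> i \<bullet> e j = (if i = j then 1 else 0)) \<and>
     (\<forall>b\<in>roots A. (\<forall>i. b \<bullet> e i \<ge> 0) \<or> (\<forall>i. b \<bullet> e i \<le> 0))"

lemma dual_basis_exists:
  fixes \<alpha> :: "4 \<Rightarrow> vec4"
  assumes "\<And>y. (\<And>i. \<alpha> i \<bullet> y = 0) \<Longrightarrow> y = 0"
  shows "\<exists>e. \<forall>i j. \<alpha> i \<bullet> e j = (if i = j then 1 else 0)"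
proof -
  define f :: "vec4 \<Rightarrow> vec4" where "f x = (\<chi> i. \<alpha> i \<bullet> x)" for x
  have lin: "linear f"
    by (rule linearI) (auto simp: f_def vec_eq_iff inner_add_right)
  have "inj f"
    unfolding linear_injective_0[OF lin]
    using assms by (auto simp: f_def vec_eq_iff)
  then have "surj f"
    using lin by (metis linear_injective_imp_surjective)
  then have "\<forall>j. \<exists>x. f x = axis j 1"
    by (metis surjD)
  then obtain e where "\<And>j. f (e j) = axis j 1"
    by metis
  then have "\<alpha> i \<bullet> e j = (if i = j then 1 else 0)" for i j
    by (auto simp: f_def vec_eq_iff axis_def)
  then show ?thesis by blast
qed

text \<open>The only place where simpliciality is unfolded. The four wall normals are independent
  because a vector orthogonal to all of them satisfies, together with its negative, every inequality
  of the chamber, hence lies in all hyperplanes.\<close>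

theorem chamber_base:
  assumes arr: "arrangement A" and simp: "simplicial A"
    and x0: "\<And>a. a \<in> roots A \<Longrightarrow> a \<bullet> x0 \<noteq> 0"
  shows "\<exists>\<alpha> e. base A \<alpha> e \<and> (\<forall>i. \<alpha> i \<bullet> x0 > 0) \<and>
    (\<forall>b\<in>roots A. b \<bullet> x0 > 0 \<longrightarrow> (\<forall>i. b \<bullet> e i \<ge> 0))"
proof -
  have ex: "\<exists>a. a \<in> roots A \<and> hyp a = H \<and> a \<bullet> x0 > 0" if H: "H \<in> A" for H
  proof -
    obtain a where a: "a \<in> roots A" "H = hyp a"
      using arrangement_hypE[OF arr H] .
    show ?thesis
    proof (cases "a \<bullet> x0 > 0")
      case False
      then have "(- a) \<bullet> x0 > 0"
        using x0[OF a(1)] by simp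
      then show ?thesis
        using a roots_minus hyp_minus by blast
    qed (use a in blast)
  qed
  define n where "n H = (SOME a. a \<in> roots A \<and> hyp a = H \<and> a \<bullet> x0 > 0)" for H
  have n: "n H \<in> roots A" "hyp (n H) = H" "n H \<bullet> x0 > 0" if "H \<in> A" for H
    using someI_ex[OF ex[OF that]] by (auto simp: n_def)
  let ?C = "{y. y \<noteq> 0 \<and> samecell A x0 y}"
  have AneE: "A \<noteq> {}"
    using arr by (auto simp: arrangement_def)
  then have x00: "x0 \<noteq> 0"
    using n(3) by fastforce
  have "?C \<inter> H = {}" if H: "H \<in> A" for H
  proof -
    have "n H \<bullet> y \<noteq> 0" if "samecell A x0 y" for y
      using that H sameside_hyp[of "n H" x0 y] sameside_hyp[of "n H" x0 "- y"] n[OF H]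
      by (force simp: samecell_def)
    then show ?thesis
      using n(2)[OF H] by (auto simp: hyp_def)
  qed
  then have "?C \<in> chambers A"
    using x00 by (auto simp: chambers_def cells_def)
  then have c4: "card (walls A ?C) = 4"
    using simp by (auto simp: simplicial_def)
  then have "finite (walls A ?C)"
    by (simp add: card_ge_0_finite)
  moreover have "card (UNIV :: 4 set) = 4"
    by simp
  ultimately obtain h :: "4 \<Rightarrow> vec4 set" where h: "bij_betw h UNIV (walls A ?C)"
    using c4 finite_same_card_bij[of "UNIV :: 4 set" "walls A ?C"] by auto
  have hA: "h i \<in> A" for i
    using h by (auto simp: bij_betw_def walls_def)
  define \<alpha> where "\<alpha> i = n (h i)" for i
  have nonneg: "n K \<bullet> y \<ge> 0" if "K \<in> A" "\<And>i. \<alpha> i \<bullet> y \<ge> 0" for K y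
  proof (rule nonneg_on_walls_imp_nonneg[OF arr n(3) n(2) _ that(1)])
    fix H
    assume "H \<in> walls A ?C"
    then obtain i where "H = h i"
      using h by (auto simp: bij_betw_def)
    then show "n H \<bullet> y \<ge> 0"
      using that(2)[of i] by (simp add: \<alpha>_def)
  qed
  have "y = 0" if y: "\<And>i. \<alpha> i \<bullet> y = 0" for y
  proof -
    have "y \<in> K" if K: "K \<in> A" for K
    proof -
      have "n K \<bullet> y \<ge> 0" "n K \<bullet> (- y) \<ge> 0"
        using nonneg[OF K, of y] nonneg[OF K, of "- y"] y by simp_all
      then have "y \<in> hyp (n K)"
        by (simp add: hyp_def)
      then show ?thesis
        using n(2)[OF K] by simp
    qed
    then show ?thesis
      using arr by (auto simp: arrangement_def)
  qed
  then obtain e where e: "\<And>i j. \<alpha> i \<bullet> e j = (if i = j then 1 else 0)"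
    using dual_basis_exists by blast
  have pos: "b \<bullet> e i \<ge> 0" if b: "b \<in> roots A" "b \<bullet> x0 > 0" for b i
  proof -
    have K: "hyp b \<in> A"
      using b by (simp add: roots_def)
    obtain s where s: "s \<noteq> 0" "b = s *\<^sub>R n (hyp b)"
      using hyp_eqD[of "n (hyp b)" b] n(2)[OF K] n(1)[OF K] b(1) roots_nonzero by metis
    then have "s * (n (hyp b) \<bullet> x0) > 0"
      using b(2) by (metis inner_scaleR_left)
    then have "s > 0"
      using n(3)[OF K] by (simp add: zero_less_mult_iff)
    moreover have "n (hyp b) \<bullet> e i \<ge> 0"
      by (rule nonneg[OF K]) (simp add: e)
    ultimately show ?thesis
      using s(2) by (metis inner_scaleR_left less_imp_le mult_nonneg_nonneg)
  qed
  have "base A \<alpha> e"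
    unfolding base_def
  proof (intro conjI allI ballI)
    show "\<alpha> i \<in> roots A" for i
      using n(1) hA by (simp add: \<alpha>_def)
    show "\<alpha> i \<bullet> e j = (if i = j then 1 else 0)" for i j
      by (rule e)
    fix b
    assume b: "b \<in> roots A"
    show "(\<forall>i. b \<bullet> e i \<ge> 0) \<or> (\<forall>i. b \<bullet> e i \<le> 0)"
    proof (cases "b \<bullet> x0 > 0")
      case False
      then have "(- b) \<bullet> x0 > 0"
        using x0[OF b] by simp
      then show ?thesis
        using pos[OF roots_minus[OF b]] by simp
    qed (use pos b in blast)
  qed
  moreover have "\<alpha> i \<bullet> x0 > 0" for i
    using n(3) hA by (simp add: \<alpha>_def)
  ultimately show ?thesis
    using pos by blast
qed

section \<open>Crossing a wall\<close>

text \<open>There are infinitely many roots but finitely many hyperplanes, so scale-invariant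
  quantities take finitely many values. This is what makes maxima over roots exist.\<close>

lemma finite_image_roots:
  assumes "finite A" "\<And>s b. s \<noteq> 0 \<Longrightarrow> F (s *\<^sub>R b) = F b"
  shows "finite (F ` roots A)"
proof (rule finite_subset)
  show "F ` roots A \<subseteq> (\<lambda>H. F (SOME a. a \<in> roots A \<and> hyp a = H)) ` A"
  proof
    fix y
    assume "y \<in> F ` roots A"
    then obtain b where b: "b \<in> roots A" "y = F b" by blast
    define a where "a = (SOME a. a \<in> roots A \<and> hyp a = hyp b)"
    have "a \<in> roots A \<and> hyp a = hyp b"
      unfolding a_def by (rule someI[of _ b]) (use b in simp)
    then obtain s where "s \<noteq> 0" "b = s *\<^sub>R a"
      using hyp_eqD[of a b] b roots_nonzero by metis
    then have "F b = F a"
      using assms(2) by simp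
    moreover have "hyp b \<in> A"
      using b by (simp add: roots_def)
    ultimately show "y \<in> (\<lambda>H. F (SOME a. a \<in> roots A \<and> hyp a = H)) ` A"
      using b(2) by (auto simp: a_def)
  qed
  show "finite ((\<lambda>H. F (SOME a. a \<in> roots A \<and> hyp a = H)) ` A)"
    using assms(1) by simp
qed

text \<open>The number \<open>c j i\<close> of the overview is
  \<open>cr A (\<alpha> j) (\<alpha> i)\<close>. For distinct normals of a base the set is finite
  and contains 0, so that \<open>Max\<close> is meaningful.\<close>

definition cr :: "vec4 set set \<Rightarrow> vec4 \<Rightarrow> vec4 \<Rightarrow> real" where
  "cr A a b = Max {t. a + t *\<^sub>R b \<in> roots A}"

text \<open>The normals \<open>cross A i \<alpha>\<close> belong to the walls of the chamber behind the wall \<open>i\<close>: the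
  normal of a wall \<open>j\<close> moves to the last root of the pencil spanned by \<open>\<alpha> j\<close> and \<open>\<alpha> i\<close>.\<close>

definition cross :: "vec4 set set \<Rightarrow> 4 \<Rightarrow> (4 \<Rightarrow> vec4) \<Rightarrow> 4 \<Rightarrow> vec4" where
  "cross A i \<alpha> = (\<lambda>j. if j = i then - \<alpha> i else \<alpha> j + cr A (\<alpha> j) (\<alpha> i) *\<^sub>R \<alpha> i)"

text \<open>The basis dual to \<open>cross A i \<alpha>\<close>. Three rays are shared by the two
  chambers; the one opposite to the wall \<open>i\<close> is determined by duality.\<close>

definition cross_dual :: "vec4 set set \<Rightarrow> 4 \<Rightarrow> (4 \<Rightarrow> vec4) \<Rightarrow> (4 \<Rightarrow> vec4) \<Rightarrow> 4 \<Rightarrow> vec4" where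
  "cross_dual A i \<alpha> e =
     (\<lambda>j. if j = i then (\<Sum>m\<in>UNIV - {i}. cr A (\<alpha> m) (\<alpha> i) *\<^sub>R e m) - e i else e j)"

locale simplicial_base =
  fixes A \<alpha> e
  assumes arr: "arrangement A" and simplicial: "simplicial A" and base: "base A \<alpha> e"
begin

lemma finA: "finite A"
  using arr by (simp add: arrangement_def)

lemma base_root: "\<alpha> i \<in> roots A"
  using base by (simp add: base_def)

lemma base_dual: "\<alpha> i \<bullet> e j = (if i = j then 1 else 0)"
  using base by (simp add: base_def)

lemma base_sign: "b \<in> roots A \<Longrightarrow> (\<forall>i. b \<bullet> e i \<ge> 0) \<or> (\<forall>i. b \<bullet> e i \<le> 0)"
  using base by (simp add: base_def)

lemma base_sum_inner: "(\<Sum>i\<in>I. c i *\<^sub>R \<alpha> i) \<bullet> e j = (if j \<in> I then c j else 0)"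
  by (auto simp: inner_sum_left base_dual if_distrib sum.delta' cong: if_cong)

lemma base_eqI:
  assumes "\<And>j. u \<bullet> e j = v \<bullet> e j"
  shows "u = v"
proof -
  define f :: "vec4 \<Rightarrow> vec4" where "f x = (\<chi> j. x \<bullet> e j)" for x
  have lin: "linear f"
    by (rule linearI) (auto simp: f_def vec_eq_iff inner_add_left)
  have "y = f (\<Sum>i\<in>UNIV. y $ i *\<^sub>R \<alpha> i)" for y
    by (simp add: f_def vec_eq_iff base_sum_inner)
  then have "surj f"
    by (rule surjI[OF sym])
  then have "inj f"
    using lin by (metis linear_surjective_imp_injective)
  then show ?thesis
    using assms by (auto simp: f_def inj_def vec_eq_iff)
qed

lemma base_expand: "v = (\<Sum>i\<in>UNIV. (v \<bullet> e i) *\<^sub>R \<alpha> i)"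
  by (rule base_eqI) (simp add: base_sum_inner)

lemma base_inner_expand: "v \<bullet> x = (\<Sum>i\<in>UNIV. (v \<bullet> e i) * (\<alpha> i \<bullet> x))"
  by (subst base_expand[of v]) (simp add: inner_sum_left)

lemma base_parallelI:
  assumes "\<And>j. j \<noteq> i \<Longrightarrow> b \<bullet> e j = 0"
  shows "b = (b \<bullet> e i) *\<^sub>R \<alpha> i"
proof (rule base_eqI)
  fix j
  show "b \<bullet> e j = (b \<bullet> e i) *\<^sub>R \<alpha> i \<bullet> e j"
    using assms[of j] by (simp add: base_dual)
qed

lemma base_nonneg:
  assumes "b \<in> roots A" "b \<bullet> e j > 0"
  shows "b \<bullet> e i \<ge> 0"
  using base_sign[OF assms(1)] assms(2) by (meson not_le)

lemma edge_coeff_nonneg: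
  assumes "i \<noteq> j" "\<alpha> j + t *\<^sub>R \<alpha> i \<in> roots A"
  shows "t \<ge> 0"
  using base_nonneg[OF assms(2), of j i] assms(1) by (simp add: inner_add_left base_dual)

lemma finite_edge_coeffs:
  assumes "i \<noteq> j"
  shows "finite {t. \<alpha> j + t *\<^sub>R \<alpha> i \<in> roots A}"
proof -
  let ?S = "{t. \<alpha> j + t *\<^sub>R \<alpha> i \<in> roots A}"
  define F where "F b = (b \<bullet> e i) / (b \<bullet> e j)" for b
  have "finite (F ` roots A)"
    by (rule finite_image_roots[OF finA]) (simp add: F_def)
  moreover have "?S \<subseteq> F ` roots A"
  proof
    fix t
    assume t: "t \<in> ?S"
    have "F (\<alpha> j + t *\<^sub>R \<alpha> i) = t"
      using assms by (simp add: F_def inner_add_left base_dual)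
    with t show "t \<in> F ` roots A"
      by force
  qed
  ultimately show ?thesis
    by (rule rev_finite_subset)
qed

context
  fixes i j :: 4
  assumes ij: "i \<noteq> j"
begin

lemma cr_root: "\<alpha> j + cr A (\<alpha> j) (\<alpha> i) *\<^sub>R \<alpha> i \<in> roots A"
proof -
  have "{t. \<alpha> j + t *\<^sub>R \<alpha> i \<in> roots A} \<noteq> {}"
    using base_root[of j] by (auto intro: exI[of _ 0])
  then show ?thesis
    using Max_in[OF finite_edge_coeffs[OF ij]] unfolding cr_def by blast
qed

lemma cr_max: "\<alpha> j + t *\<^sub>R \<alpha> i \<in> roots A \<Longrightarrow> t \<le> cr A (\<alpha> j) (\<alpha> i)"
  unfolding cr_def using Max_ge[OF finite_edge_coeffs[OF ij]] by blast

lemma cr_nonneg: "cr A (\<alpha> j) (\<alpha> i) \<ge> 0"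
  using cr_root edge_coeff_nonneg[OF ij] by blast

lemma cr_eqI:
  assumes "\<alpha> j + c *\<^sub>R \<alpha> i \<in> roots A"
    and "\<And>t. t > 0 \<Longrightarrow> \<alpha> j + t *\<^sub>R \<alpha> i \<in> roots A \<Longrightarrow> t \<le> c"
  shows "cr A (\<alpha> j) (\<alpha> i) = c"
  using cr_max[OF assms(1)] assms(2)[OF _ cr_root] edge_coeff_nonneg[OF ij assms(1)]
  by linarith

end

lemma cross_dual_simps:
  "cross_dual A i \<alpha> e i = (\<Sum>m\<in>UNIV - {i}. cr A (\<alpha> m) (\<alpha> i) *\<^sub>R e m) - e i"
  "j \<noteq> i \<Longrightarrow> cross_dual A i \<alpha> e j = e j"
  by (auto simp: cross_dual_def)

lemma inner_cross_dual:
  "b \<bullet> cross_dual A i \<alpha> e i = (\<Sum>m\<in>UNIV - {i}. cr A (\<alpha> m) (\<alpha> i) * (b \<bullet> e m)) - b \<bullet> e i"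
  by (simp add: cross_dual_simps inner_diff_right inner_sum_right)

lemma base_inner_cross_dual:
  "\<alpha> j \<bullet> cross_dual A i \<alpha> e i = (if j = i then - 1 else cr A (\<alpha> j) (\<alpha> i))"
proof (cases "j = i")
  case True
  then show ?thesis
    by (simp add: inner_cross_dual base_dual)
next
  case False
  have "(\<Sum>m\<in>UNIV - {i}. cr A (\<alpha> m) (\<alpha> i) * (\<alpha> j \<bullet> e m)) =
      (\<Sum>m\<in>UNIV - {i}. if m = j then cr A (\<alpha> j) (\<alpha> i) else 0)"
    by (rule sum.cong) (auto simp: base_dual)
  also have "\<dots> = cr A (\<alpha> j) (\<alpha> i)"
    using False by simp
  finally show ?thesis
    using False by (simp add: inner_cross_dual base_dual)
qed

text \<open>A point \<open>x\<close> just behind the wall \<open>i\<close> lies in a chamber whose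
  base \<beta> exists by \<open>chamber_base\<close>. One \<beta> is a negative multiple of
  \<open>\<alpha> i\<close>, every other lies in a pencil of \<open>\<alpha> i\<close> and some
  \<open>\<alpha> j\<close>, so maximality of \<open>cr\<close> makes all of them nonnegative on the
  new ray. Since \<open>b\<close> is positive at \<open>x\<close>, it is a nonnegative combination
  of the \<beta>.\<close>

lemma cross_dual_nonneg:
  assumes b: "b \<in> roots A" "j \<noteq> i" "b \<bullet> e j > 0"
  shows "b \<bullet> cross_dual A i \<alpha> e i \<ge> 0"
proof -
  let ?s = "\<lambda>b. \<Sum>j\<in>UNIV - {i}. b \<bullet> e j"
  \<comment> \<open>For multiples of \<open>\<alpha> i\<close> the denominator vanishes and
    \<open>F\<close> takes the default value 0, which does not disturb the bound.\<close>
  define F where "F b = (b \<bullet> e i) / ?s b" for b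
  have "finite (F ` roots A)"
  proof (rule finite_image_roots[OF finA])
    fix s :: real and b :: vec4
    assume "s \<noteq> 0"
    then show "F (s *\<^sub>R b) = F b"
      unfolding F_def by (simp flip: sum_distrib_left)
  qed
  then have "bdd_above (F ` roots A)"
    by simp
  then obtain M0 where M0: "\<And>b. b \<in> roots A \<Longrightarrow> F b \<le> M0"
    unfolding bdd_above_def by blast
  define M where "M = max M0 0 + 1"
  have M: "M > 0" "\<And>b. b \<in> roots A \<Longrightarrow> F b < M"
    using M0 by (force simp: M_def)+
  \<comment> \<open>So close behind the wall that only \<open>\<alpha> i\<close> and its multiples
    change sign: \<open>M\<close> exceeds every ratio of the coordinate at \<open>i\<close> to the
    sum of the others.\<close>
  define x where "x = (\<Sum>j\<in>UNIV - {i}. e j) - (1 / M) *\<^sub>R e i"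
  have bx: "b \<bullet> x = ?s b - (b \<bullet> e i) / M" for b
    by (simp add: x_def inner_diff_right inner_sum_right)
  have pos: "b \<bullet> x > 0" if b: "b \<in> roots A" "j \<noteq> i" "b \<bullet> e j > 0" for b j
  proof -
    have "?s b > 0"
      using b base_nonneg[OF b(1,3)] by (intro sum_pos2[of _ j]) auto
    then have "b \<bullet> e i < M * ?s b"
      using M(2)[OF b(1)] by (simp add: F_def field_simps)
    then show ?thesis
      using M(1) by (simp add: bx field_simps)
  qed
  have par: "b \<bullet> x = - (b \<bullet> e i) / M" if "\<And>j. j \<noteq> i \<Longrightarrow> b \<bullet> e j = 0" for b
    using that by (simp add: bx)
  have gen: "b \<bullet> x \<noteq> 0" if b: "b \<in> roots A" for b
  proof (cases "\<forall>j. j \<noteq> i \<longrightarrow> b \<bullet> e j = 0")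
    case True
    then have "b = (b \<bullet> e i) *\<^sub>R \<alpha> i"
      by (intro base_parallelI) auto
    then have "b \<bullet> e i \<noteq> 0"
      using roots_nonzero[OF b] by auto
    then show ?thesis
      using par True M(1) by simp
  next
    case False
    then obtain j where j: "j \<noteq> i" "b \<bullet> e j \<noteq> 0" by blast
    show ?thesis
    proof (cases "b \<bullet> e j > 0")
      case False
      then have "(- b) \<bullet> e j > 0"
        using j by simp
      then have "(- b) \<bullet> x > 0"
        by (rule pos[OF roots_minus[OF b] j(1)])
      then show ?thesis by simp
    qed (use pos[OF b j(1)] in force)
  qed
  have ge: "b \<bullet> e j \<ge> 0" if b: "b \<in> roots A" "b \<bullet> x > 0" "j \<noteq> i" for b j
  proof (rule ccontr)
    assume "\<not> b \<bullet> e j \<ge> 0"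
    then have "(- b) \<bullet> x > 0"
      by (intro pos[OF roots_minus[OF b(1)] b(3)]) simp
    with b(2) show False by simp
  qed
  obtain \<beta> f where bs: "base A \<beta> f" and \<beta>x: "\<And>k. \<beta> k \<bullet> x > 0"
    and fx: "\<And>b k. b \<in> roots A \<Longrightarrow> b \<bullet> x > 0 \<Longrightarrow> b \<bullet> f k \<ge> 0"
    using chamber_base[OF arr simplicial gen] by blast
  interpret B: simplicial_base A \<beta> f
    by unfold_locales (rule arr simplicial bs)+
  have \<beta>: "\<beta> k \<in> roots A" "\<beta> k \<bullet> f l = (if k = l then 1 else 0)" for k l
    using bs by (auto simp: base_def)
  have expand: "v \<bullet> y = (\<Sum>k\<in>UNIV. (v \<bullet> f k) * (\<beta> k \<bullet> y))" for v y
    by (rule B.base_inner_expand)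
  have \<alpha>if: "- \<alpha> i \<bullet> f l \<ge> 0" for l
    using par[of "\<alpha> i"] M(1) by (intro fx roots_minus base_root) (simp_all add: base_dual)
  obtain m where m: "- \<alpha> i \<bullet> f m > 0"
  proof (rule ccontr)
    assume "\<not> thesis"
    then have "- \<alpha> i \<bullet> f l = 0" for l
      using \<alpha>if[of l] that[of l] by linarith
    then have "- \<alpha> i \<bullet> e i = 0"
      using expand[of "- \<alpha> i" "e i"] by simp
    then show False
      by (simp add: base_dual)
  qed
  \<comment> \<open>Expanding \<open>- \<alpha> i\<close> in \<beta> and evaluating at
    \<open>e j\<close> gives a sum of nonnegative terms equal to 0; the term of \<open>m\<close> has
    a positive first factor.\<close>
  have "\<beta> m \<bullet> e j = 0" if j: "j \<noteq> i" for j
  proof -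
    have "(\<Sum>k\<in>UNIV. (- \<alpha> i \<bullet> f k) * (\<beta> k \<bullet> e j)) = 0"
      using expand[of "- \<alpha> i" "e j"] j by (simp add: base_dual)
    then have "(- \<alpha> i \<bullet> f m) * (\<beta> m \<bullet> e j) = 0"
      using \<alpha>if ge[OF \<beta>(1) \<beta>x j]
      by (subst (asm) sum_nonneg_eq_0_iff) (auto simp: mult_nonneg_nonneg mult_nonpos_nonneg)
    then show ?thesis
      using m by simp
  qed
  note \<beta>m0 = this
  define \<kappa> where "\<kappa> = \<beta> m \<bullet> e i"
  have \<beta>m: "\<beta> m = \<kappa> *\<^sub>R \<alpha> i"
    unfolding \<kappa>_def by (rule base_parallelI[OF \<beta>m0])
  have \<kappa>: "\<kappa> < 0"
    using \<beta>x[of m] par[OF \<beta>m0] M(1) by (simp add: \<kappa>_def field_simps)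
  let ?e = "cross_dual A i \<alpha> e i"
  have \<beta>e: "\<beta> k \<bullet> ?e \<ge> 0" for k
  proof (cases "k = m")
    case True
    then show ?thesis
      using \<beta>m \<kappa> by (simp add: base_inner_cross_dual)
  next
    case False
    have \<alpha>if0: "\<alpha> i \<bullet> f l = 0" if "l \<noteq> m" for l
    proof -
      have "\<kappa> * (\<alpha> i \<bullet> f l) = \<beta> m \<bullet> f l"
        using \<beta>m by simp
      also have "\<dots> = 0"
        using that by (simp add: \<beta>)
      finally show ?thesis
        using \<kappa> by simp
    qed
    have "\<exists>j. j \<noteq> i \<and> \<beta> k \<bullet> e j \<noteq> 0"
    proof (rule ccontr)
      assume "\<not> ?thesis"
      then have "\<beta> k = (\<beta> k \<bullet> e i) *\<^sub>R \<alpha> i"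
        by (intro base_parallelI) blast
      then have "\<beta> k \<bullet> f k = (\<beta> k \<bullet> e i) * (\<alpha> i \<bullet> f k)"
        by (metis inner_scaleR_left)
      then show False
        using \<alpha>if0[OF False] by (simp add: \<beta>)
    qed
    then obtain j where j: "j \<noteq> i" "\<beta> k \<bullet> e j > 0"
      using ge[OF \<beta>(1) \<beta>x] by (metis order_less_le)
    have \<alpha>f: "\<alpha> r \<bullet> f l \<ge> 0" if "r \<noteq> i" for r l
      using that pos[of "\<alpha> r" r] by (intro fx base_root) (simp add: base_root base_dual)
    \<comment> \<open>The same device with the roles exchanged: expand \<open>\<beta> k\<close> in
      \<alpha> and evaluate at \<open>f l\<close>. The term of \<open>i\<close> drops out because
      \<open>l\<close> differs from \<open>m\<close>.\<close>
    have z: "\<alpha> j \<bullet> f l = 0" if l: "l \<noteq> k" "l \<noteq> m" for l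
    proof -
      have "(\<Sum>r\<in>UNIV. (\<beta> k \<bullet> e r) * (\<alpha> r \<bullet> f l)) = 0"
        using base_inner_expand[of "\<beta> k" "f l"] l by (simp add: \<beta>)
      moreover have "(\<beta> k \<bullet> e r) * (\<alpha> r \<bullet> f l) \<ge> 0" for r
        using \<alpha>if0[OF l(2)] \<alpha>f ge[OF \<beta>(1) \<beta>x] by (cases "r = i") auto
      ultimately have "(\<beta> k \<bullet> e j) * (\<alpha> j \<bullet> f l) = 0"
        by (subst (asm) sum_nonneg_eq_0_iff) auto
      then show ?thesis
        using j by simp
    qed
    define u v where "u = \<alpha> j \<bullet> f k" and "v = \<alpha> j \<bullet> f m"
    have \<alpha>j: "\<alpha> j \<bullet> y = u * (\<beta> k \<bullet> y) + v * (\<beta> m \<bullet> y)" for y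
    proof -
      have "\<alpha> j \<bullet> y = (\<Sum>l\<in>{k, m}. (\<alpha> j \<bullet> f l) * (\<beta> l \<bullet> y))"
        unfolding expand[of "\<alpha> j" y] by (rule sum.mono_neutral_right) (auto simp: z)
      then show ?thesis
        using False by (simp add: u_def v_def)
    qed
    have uv: "u \<ge> 0" "v \<ge> 0"
      using \<alpha>f[OF j(1)] by (auto simp: u_def v_def)
    have "u * (\<beta> k \<bullet> e j) = 1"
      using \<alpha>j[of "e j"] \<beta>m0[OF j(1)] by (simp add: base_dual)
    then have u: "u > 0"
      using uv by (metis less_eq_real_def mult_zero_left zero_neq_one)
    \<comment> \<open>Up to a positive factor \<open>\<beta> k\<close> is a root of the pencil, so
      its coefficient is at most \<open>cr A (\<alpha> j) (\<alpha> i)\<close>.\<close>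
    have "u *\<^sub>R \<beta> k = \<alpha> j + (- v * \<kappa>) *\<^sub>R \<alpha> i"
    proof (rule base_eqI)
      fix r
      show "u *\<^sub>R \<beta> k \<bullet> e r = (\<alpha> j + (- v * \<kappa>) *\<^sub>R \<alpha> i) \<bullet> e r"
        using \<alpha>j[of "e r"] \<beta>m by (simp add: inner_add_left inner_diff_left)
    qed
    moreover from this have "\<alpha> j + (- v * \<kappa>) *\<^sub>R \<alpha> i \<in> roots A"
      using roots_scale[OF \<beta>(1)[of k], of u] u by simp
    then have "- v * \<kappa> \<le> cr A (\<alpha> j) (\<alpha> i)"
      using j(1) by (intro cr_max) auto
    then have "(\<alpha> j + (- v * \<kappa>) *\<^sub>R \<alpha> i) \<bullet> ?e \<ge> 0"
      using j(1) by (simp only: inner_add_left inner_scaleR_left base_inner_cross_dual) simp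
    ultimately have "u * (\<beta> k \<bullet> ?e) \<ge> 0"
      by (metis inner_scaleR_left)
    then show ?thesis
      using u by (simp add: zero_le_mult_iff)
  qed
  have "b \<bullet> f k \<ge> 0" for k
    using b pos by (intro fx) auto
  then show ?thesis
    using \<beta>e by (subst expand) (auto intro!: sum_nonneg mult_nonneg_nonneg)
qed

text \<open>Multiples of \<open>\<alpha> i\<close> change sign; every other root keeps its sign by
  \<open>cross_dual_nonneg\<close>.\<close>

lemma cross_base: "base A (cross A i \<alpha>) (cross_dual A i \<alpha> e)"
  unfolding base_def
proof (intro conjI allI ballI)
  show "cross A i \<alpha> j \<in> roots A" for j
    using cr_root roots_minus base_root by (auto simp: cross_def)
  show "cross A i \<alpha> j \<bullet> cross_dual A i \<alpha> e k = (if j = k then 1 else 0)" for j k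
    using base_inner_cross_dual[of j i] base_inner_cross_dual[of i i]
    by (cases "k = i"; cases "j = i")
      (auto simp: cross_def cross_dual_simps inner_add_left base_dual)
  fix b
  assume b: "b \<in> roots A"
  have *: "(\<forall>j. c \<bullet> cross_dual A i \<alpha> e j \<ge> 0) \<or> (\<forall>j. c \<bullet> cross_dual A i \<alpha> e j \<le> 0)"
    if c: "c \<in> roots A" "\<forall>j. c \<bullet> e j \<ge> 0" for c
  proof (cases "\<forall>j. j \<noteq> i \<longrightarrow> c \<bullet> e j = 0")
    case True
    then have "c \<bullet> cross_dual A i \<alpha> e i = - (c \<bullet> e i)"
      by (simp add: inner_cross_dual)
    then have "c \<bullet> cross_dual A i \<alpha> e j \<le> 0" for j
      using True c(2) by (cases "j = i") (auto simp: cross_dual_simps(2))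
    then show ?thesis by blast
  next
    case False
    then obtain j where j: "j \<noteq> i" "c \<bullet> e j > 0"
      using c(2) by (metis order_less_le)
    have "c \<bullet> cross_dual A i \<alpha> e k \<ge> 0" for k
      using cross_dual_nonneg[OF c(1) j] c(2)
      by (cases "k = i") (auto simp: cross_dual_simps(2))
    then show ?thesis by blast
  qed
  show "(\<forall>j. b \<bullet> cross_dual A i \<alpha> e j \<ge> 0) \<or> (\<forall>j. b \<bullet> cross_dual A i \<alpha> e j \<le> 0)"
    using base_sign[OF b] *[OF b] *[OF roots_minus[OF b]] by auto
qed

text \<open>If no neighbour of \<open>k\<close> were in the support, crossing the wall
  \<open>k\<close> would turn the coordinate at \<open>k\<close> into its negative while the one at
  \<open>m\<close> stays positive.\<close>

lemma exists_neighbour_in_support: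
  assumes b: "b \<in> roots A" "b \<bullet> e k > 0" "m \<noteq> k" "b \<bullet> e m > 0"
  shows "\<exists>m. m \<noteq> k \<and> b \<bullet> e m > 0 \<and> cr A (\<alpha> m) (\<alpha> k) > 0"
proof (rule ccontr)
  assume n: "\<not> ?thesis"
  have "cr A (\<alpha> m) (\<alpha> k) * (b \<bullet> e m) = 0" if "m \<noteq> k" for m
    using n that base_nonneg[OF b(1,2)] cr_nonneg[of k m]
    by (metis less_eq_real_def mult_eq_0_iff)
  then have "(\<Sum>m\<in>UNIV - {k}. cr A (\<alpha> m) (\<alpha> k) * (b \<bullet> e m)) = 0"
    by (intro sum.neutral) blast
  then have "b \<bullet> cross_dual A k \<alpha> e k < 0"
    using b by (simp add: inner_cross_dual)
  with cross_dual_nonneg[OF b(1,3,4)] show False by simp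
qed

lemma cross_simplicial_base: "simplicial_base A (cross A i \<alpha>) (cross_dual A i \<alpha> e)"
  by unfold_locales (rule arr simplicial cross_base)+

end

section \<open>Vertices of weight at most six\<close>

lemma distinct_fourD:
  assumes "distinct [i, j, k, l]"
  shows "i \<noteq> j" "i \<noteq> k" "i \<noteq> l" "j \<noteq> k" "j \<noteq> l" "k \<noteq> l"
    "j \<noteq> i" "k \<noteq> i" "l \<noteq> i" "k \<noteq> j" "l \<noteq> j" "l \<noteq> k"
  using assms by auto

lemma distinct_four_exhaust:
  assumes "distinct [i, j, k, l :: 4]"
  shows "x = i \<or> x = j \<or> x = k \<or> x = l"
proof -
  have "card {i, j, k, l} = 4"
    using assms by simp
  then have "{i, j, k, l} = UNIV"
    by (intro card_eq_UNIV_imp_eq_UNIV) auto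
  then show ?thesis by blast
qed

lemma finite_int_lattice: "finite A \<Longrightarrow> finite (int_lattice A)"
proof -
  assume "finite A"
  moreover have "int_lattice A = Inter ` Pow A"
    by (auto simp: int_lattice_def)
  ultimately show ?thesis by simp
qed

context simplicial_base
begin

abbreviation c :: "4 \<Rightarrow> 4 \<Rightarrow> real" where
  "c i j \<equiv> cr A (\<alpha> i) (\<alpha> j)"

lemma base_expand_dual: "x = (\<Sum>i\<in>UNIV. (\<alpha> i \<bullet> x) *\<^sub>R e i)"
proof (subst vector_eq_ldot[symmetric], intro allI)
  fix v
  show "v \<bullet> x = v \<bullet> (\<Sum>i\<in>UNIV. (\<alpha> i \<bullet> x) *\<^sub>R e i)"
    by (simp add: base_inner_expand[of v x] inner_sum_right mult.commute)
qed

text \<open>Dividing the last root \<open>\<alpha> i + c i j \<alpha> j\<close> by its second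
  coefficient shows that \<open>c j i\<close> is at least \<open>1 / c i j\<close>.\<close>

lemma c_pos_sym: "i \<noteq> j \<Longrightarrow> c i j > 0 \<Longrightarrow> c j i > 0"
proof -
  assume ij: "i \<noteq> j" and p: "c i j > 0"
  have "(1 / c i j) *\<^sub>R (\<alpha> i + c i j *\<^sub>R \<alpha> j) \<in> roots A"
    using p cr_root[of j i] ij by (intro roots_scale) auto
  then have "\<alpha> j + (1 / c i j) *\<^sub>R \<alpha> i \<in> roots A"
    using p by (simp add: scaleR_add_right add.commute)
  then have "1 / c i j \<le> c j i"
    using cr_max[OF ij] by blast
  then show ?thesis
    using p by (meson less_le_trans zero_less_divide_1_iff)
qed

lemma c_zero_sym: "i \<noteq> j \<Longrightarrow> c i j = 0 \<longleftrightarrow> c j i = 0"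
  using c_pos_sym[of i j] c_pos_sym[of j i] cr_nonneg[of i j] cr_nonneg[of j i] by force

text \<open>The ray \<open>e l\<close> is the corner of the chamber opposite to the wall
  \<open>l\<close>. The weight bound thus concerns the roots whose coordinate at \<open>l\<close> is
  zero.\<close>

lemma ray_in_vertices: "\<Inter>{hyp (\<alpha> j) | j. j \<noteq> l} \<in> vertices A"
    and ray_eq_span: "\<Inter>{hyp (\<alpha> j) | j. j \<noteq> l} = span {e l}"
proof -
  let ?X = "\<Inter>{hyp (\<alpha> j) | j. j \<noteq> l}"
  have mem: "x \<in> ?X \<longleftrightarrow> (\<forall>j. j \<noteq> l \<longrightarrow> \<alpha> j \<bullet> x = 0)" for x
    by (auto simp: hyp_def)
  show eq: "?X = span {e l}"
  proof (intro set_eqI iffI)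
    fix x
    assume "x \<in> ?X"
    then have "\<forall>j. j \<noteq> l \<longrightarrow> \<alpha> j \<bullet> x = 0"
      unfolding mem .
    then have "(\<Sum>i\<in>UNIV. (\<alpha> i \<bullet> x) *\<^sub>R e i) = (\<Sum>i\<in>UNIV. if i = l then (\<alpha> l \<bullet> x) *\<^sub>R e l else 0)"
      by (intro sum.cong) auto
    then have "x = (\<alpha> l \<bullet> x) *\<^sub>R e l"
      using base_expand_dual[of x] by simp
    then show "x \<in> span {e l}"
      by (auto simp: span_singleton)
  next
    fix x
    assume "x \<in> span {e l}"
    then obtain t where "x = t *\<^sub>R e l"
      by (auto simp: span_singleton)
    then have "\<forall>j. j \<noteq> l \<longrightarrow> \<alpha> j \<bullet> x = 0"
      by (simp add: base_dual)
    then show "x \<in> ?X"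
      unfolding mem .
  qed
  have "e l \<noteq> 0"
    using base_dual[of l l] by auto
  then have "dim ?X = 1"
    by (simp add: eq dim_span)
  moreover have "?X \<in> int_lattice A"
    unfolding int_lattice_def
    by (rule CollectI, rule exI[of _ "{hyp (\<alpha> j) | j. j \<noteq> l}"])
      (use base_root in \<open>auto simp: roots_def\<close>)
  ultimately show "?X \<in> vertices A"
    by (simp add: vertices_def)
qed

lemma card_through_ray_le: "card {H \<in> A. e l \<in> H} \<le> max_vertex_weight A"
proof -
  let ?X = "\<Inter>{hyp (\<alpha> j) | j. j \<noteq> l}"
  have "?X \<subseteq> H \<longleftrightarrow> e l \<in> H" if "H \<in> A" for H
  proof -
    obtain a where "H = hyp a"
      using arrangement_hypE[OF arr \<open>H \<in> A\<close>] by blast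
    then have "subspace H"
      by (simp add: hyp_def subspace_hyperplane)
    then show ?thesis
      unfolding ray_eq_span
      using span_minimal[of "{e l}" H] span_base[of "e l" "{e l}"] by auto
  qed
  then have "{H \<in> A. e l \<in> H} = {H \<in> A. ?X \<subseteq> H}"
    by auto
  then have "card {H \<in> A. e l \<in> H} = weight A ?X"
    by (simp add: weight_def)
  moreover have "finite (vertices A)"
    using finite_int_lattice[OF finA] by (simp add: vertices_def)
  ultimately show ?thesis
    unfolding max_vertex_weight_def using ray_in_vertices[of l] by (simp add: Max_ge)
qed

end

section \<open>Subdiagrams on three nodes\<close>

locale light_base = simplicial_base +
  assumes light: "max_vertex_weight A \<le> 6"
begin

text \<open>Unchanged by scaling, hence an invariant of the hyperplane that separates hyperplanes
  without comparing coefficients.\<close>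

definition supp :: "vec4 \<Rightarrow> 4 set" where
  "supp b = {x. b \<bullet> e x \<noteq> 0}"

text \<open>Over a concrete list the simplifier can evaluate supports.\<close>

lemma supp_filter:
  assumes "distinct [i, j, k, l]"
  shows "supp b = set (filter (\<lambda>x. b \<bullet> e x \<noteq> 0) [i, j, k, l])"
proof -
  have "x \<in> set [i, j, k, l]" for x
    using distinct_four_exhaust[OF assms, of x] by simp
  then show ?thesis
    unfolding supp_def set_filter by blast
qed

lemma cross_light_base: "light_base A (cross A i \<alpha>) (cross_dual A i \<alpha> e)"
  using cross_simplicial_base light by (simp add: light_base_def light_base_axioms_def)

text \<open>The one place where the weight bound is exploited: six different supports are six
  hyperplanes through the vertex, so there is no room for a seventh.\<close>

lemma six_distinct_supports:
  assumes rs: "set rs \<subseteq> roots A" "\<And>r. r \<in> set rs \<Longrightarrow> r \<bullet> e l = 0"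
    and six: "length rs = 6" "distinct (map supp rs)"
    and b: "b \<in> roots A" "b \<bullet> e l = 0"
  shows "\<exists>s r. s \<noteq> 0 \<and> r \<in> set rs \<and> b = s *\<^sub>R r"
proof -
  have supp: "supp a = supp a'" if h: "hyp a = hyp a'" "a \<noteq> 0" "a' \<noteq> 0" for a a'
  proof -
    obtain s where "s \<noteq> 0" "a' = s *\<^sub>R a"
      using hyp_eqD[OF h] .
    then show ?thesis
      by (simp add: supp_def)
  qed
  have "distinct rs" and inj: "inj_on supp (set rs)"
    using six by (auto simp: distinct_map)
  have "inj_on hyp (set rs)"
  proof (rule inj_onI)
    fix a a'
    assume aa: "a \<in> set rs" "a' \<in> set rs" "hyp a = hyp a'"
    then have "supp a = supp a'"
      using rs(1) roots_nonzero by (intro supp) blast+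
    then show "a = a'"
      using inj aa by (auto dest: inj_onD)
  qed
  then have "card (hyp ` set rs) = 6"
    using six(1) \<open>distinct rs\<close> by (simp add: card_image distinct_card)
  moreover have "hyp ` set rs \<subseteq> {H \<in> A. e l \<in> H}"
    using rs by (auto simp: roots_def hyp_def)
  moreover have "finite {H \<in> A. e l \<in> H}"
    using finA by simp
  moreover have "card {H \<in> A. e l \<in> H} \<le> 6"
    using card_through_ray_le[of l] light by simp
  ultimately have "hyp ` set rs = {H \<in> A. e l \<in> H}"
    by (intro card_seteq) auto
  moreover have "hyp b \<in> {H \<in> A. e l \<in> H}"
    using b by (auto simp: roots_def hyp_def)
  ultimately have "hyp b \<in> hyp ` set rs"
    by simp
  then obtain r where r: "r \<in> set rs" "hyp r = hyp b"
    by (metis imageE)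
  have "r \<noteq> 0" "b \<noteq> 0"
    using r(1) rs(1) b(1) roots_nonzero by blast+
  then obtain s where "s \<noteq> 0" "b = s *\<^sub>R r"
    using hyp_eqD[OF r(2)] by metis
  with r show ?thesis by blast
qed

text \<open>Behind the wall \<open>i\<close> the root \<open>\<alpha> k + c k j \<alpha> j\<close>
  still has positive coordinates at \<open>j\<close> and \<open>k\<close>, so \<open>k\<close> has a
  neighbour in its support there. It cannot be \<open>i\<close>, as this would give a root of mixed
  sign, nor \<open>l\<close>; hence it is \<open>j\<close>, and the edge root in the new base has
  full support in the old one.\<close>

lemma path_full_root:
  assumes d: "distinct [i, j, k, l]"
    and adj: "c i j > 0" "c j k > 0" "c i k = 0"
  shows "\<exists>t>0. \<alpha> j + c j i *\<^sub>R \<alpha> i + t *\<^sub>R \<alpha> k \<in> roots A"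
proof -
  interpret X: simplicial_base A "cross A i \<alpha>" "cross_dual A i \<alpha> e"
    by (rule cross_simplicial_base)
  have ki: "c k i = 0"
    using adj(3) c_zero_sym[of i k] d by auto
  have kj: "c k j > 0"
    using adj(2) c_pos_sym[of j k] d by auto
  have cross: "cross A i \<alpha> i = - \<alpha> i" "cross A i \<alpha> j = \<alpha> j + c j i *\<^sub>R \<alpha> i" "cross A i \<alpha> k = \<alpha> k"
    using d ki by (auto simp: cross_def)
  let ?r = "\<alpha> k + c k j *\<^sub>R \<alpha> j"
  have r: "?r \<in> roots A"
    using cr_root[of j k] d by auto
  have co: "?r \<bullet> cross_dual A i \<alpha> e k = 1" "?r \<bullet> cross_dual A i \<alpha> e j = c k j"
      "?r \<bullet> cross_dual A i \<alpha> e l = 0"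
    using d by (auto simp: cross_dual_simps(2) inner_add_left base_dual)
  obtain m where m: "m \<noteq> k" "?r \<bullet> cross_dual A i \<alpha> e m > 0"
      "cr A (cross A i \<alpha> m) (cross A i \<alpha> k) > 0"
    using X.exists_neighbour_in_support[OF r, of k j] co kj d by auto
  define t where "t = cr A (cross A i \<alpha> m) (cross A i \<alpha> k)"
  have root: "cross A i \<alpha> m + t *\<^sub>R cross A i \<alpha> k \<in> roots A"
    unfolding t_def using m(1) by (intro X.cr_root) auto
  have "m \<noteq> i"
  proof
    assume "m = i"
    then have "- \<alpha> i + t *\<^sub>R \<alpha> k \<in> roots A"
      using root by (simp add: cross)
    from base_nonneg[OF this, of k i] show False
      using m(3) d by (auto simp: t_def inner_diff_left base_dual)
  qed
  moreover have "m \<noteq> l"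
    using m(2) co(3) by auto
  ultimately have "m = j"
    using m(1) distinct_four_exhaust[OF d, of m] by blast
  then show ?thesis
    using root m(3) by (auto simp: cross t_def intro!: exI[of _ t])
qed

text \<open>The six listed roots have different supports. So the two edge roots on \<open>i\<close>
  and \<open>j\<close>, built from either end, are parallel, which gives the product 1; and the full
  roots built from the two ends of the path are parallel, which determines the last
  coefficient.\<close>

lemma path:
  assumes d: "distinct [i, j, k, l]"
    and adj: "c i j > 0" "c j k > 0" "c i k = 0"
  shows path_edge: "c i j * c j i = 1"
    and path_root: "\<alpha> j + c j i *\<^sub>R \<alpha> i + c j k *\<^sub>R \<alpha> k \<in> roots A"
    and path_all_roots: "b \<in> roots A \<Longrightarrow> b \<bullet> e l = 0 \<Longrightarrow>
      \<exists>s r. s \<noteq> 0 \<and> b = s *\<^sub>R r \<and> r \<in> set [\<alpha> i, \<alpha> j, \<alpha> k, \<alpha> i + c i j *\<^sub>R \<alpha> j, \<alpha> k + c k j *\<^sub>R \<alpha> j,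
        \<alpha> j + c j i *\<^sub>R \<alpha> i + c j k *\<^sub>R \<alpha> k]"
proof -
  note d' = distinct_fourD[OF d]
  have kj: "c k j > 0" and ji: "c j i > 0" and ki: "c k i = 0"
    using c_pos_sym[OF d'(4) adj(2)] c_pos_sym[OF d'(1) adj(1)] c_zero_sym[OF d'(2)] adj(3)
    by simp_all
  obtain t where t: "t > 0" "\<alpha> j + c j i *\<^sub>R \<alpha> i + t *\<^sub>R \<alpha> k \<in> roots A" (is "?f \<in> _")
    using path_full_root[OF d adj] by blast
  \<comment> \<open>The same lemma for the reversed path; so far \<open>t\<close> and
    \<open>c j k\<close> are unrelated.\<close>
  obtain u where u: "u > 0" "\<alpha> j + c j k *\<^sub>R \<alpha> k + u *\<^sub>R \<alpha> i \<in> roots A" (is "?g \<in> _")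
    using path_full_root[of k j i l] d' kj ji ki by (metis distinct_length_2_or_more distinct_singleton)
  define rs where "rs = [\<alpha> i, \<alpha> j, \<alpha> k, \<alpha> i + c i j *\<^sub>R \<alpha> j, \<alpha> k + c k j *\<^sub>R \<alpha> j, ?f]"
  have co: "\<alpha> x \<bullet> e y = (if x = y then 1 else 0)" for x y
    by (rule base_dual)
  note ev = inner_add_left co d'
  have nz: "c i j \<noteq> 0" "c j k \<noteq> 0" "c k j \<noteq> 0" "c j i \<noteq> 0" "t \<noteq> 0"
    using adj kj ji t by simp_all
  have sup: "map supp rs = [{i}, {j}, {k}, {i, j}, {j, k}, {i, j, k}]"
    by (simp add: rs_def supp_filter[OF d] ev nz)
  have six: "\<exists>s r. s \<noteq> 0 \<and> r \<in> set rs \<and> b = s *\<^sub>R r" if "b \<in> roots A" "b \<bullet> e l = 0" for b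
  proof (rule six_distinct_supports[OF _ _ _ _ that])
    show "set rs \<subseteq> roots A"
      using base_root t(2) cr_root[of j i] cr_root[of j k] d' by (simp add: rs_def)
    show "r \<bullet> e l = 0" if "r \<in> set rs" for r
      using that by (auto simp: rs_def ev)
    show "length rs = 6"
      by (simp add: rs_def)
    show "distinct (map supp rs)"
      unfolding sup using d' by (simp add: doubleton_eq_iff insert_eq_iff)
  qed
  have coord: "\<exists>s r. r \<in> set rs \<and> b \<bullet> e i = s * (r \<bullet> e i) \<and> b \<bullet> e j = s * (r \<bullet> e j) \<and>
      b \<bullet> e k = s * (r \<bullet> e k)" if "b \<in> roots A" "b \<bullet> e l = 0" for b
    using six[OF that] by (metis inner_scaleR_left)
  have mem: "r = \<alpha> i \<or> r = \<alpha> j \<or> r = \<alpha> k \<or> r = \<alpha> i + c i j *\<^sub>R \<alpha> j \<or> r = \<alpha> k + c k j *\<^sub>R \<alpha> j \<or> r = ?f"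
    if "r \<in> set rs" for r
    using that by (simp add: rs_def)
  let ?h = "\<alpha> j + c j i *\<^sub>R \<alpha> i"
  have "?h \<in> roots A"
    by (rule cr_root[OF d'(1)])
  moreover have "?h \<bullet> e l = 0"
    by (simp add: ev)
  ultimately obtain s r where "r \<in> set rs" and sr: "?h \<bullet> e i = s * (r \<bullet> e i)"
      "?h \<bullet> e j = s * (r \<bullet> e j)" "?h \<bullet> e k = s * (r \<bullet> e k)"
    using coord[of ?h] by blast
  then show e1: "c i j * c j i = 1"
    using mem[OF \<open>r \<in> set rs\<close>] nz by (elim disjE) (simp_all add: ev mult.commute)
  have "?g \<bullet> e l = 0"
    by (simp add: ev)
  then obtain s r where "r \<in> set rs" and sr: "?g \<bullet> e i = s * (r \<bullet> e i)"
      "?g \<bullet> e j = s * (r \<bullet> e j)" "?g \<bullet> e k = s * (r \<bullet> e k)"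
    using coord[OF u(2)] by blast
  then have "c j k = t"
    using mem[OF \<open>r \<in> set rs\<close>] nz u(1) by (elim disjE) (simp_all add: ev)
  then show "\<alpha> j + c j i *\<^sub>R \<alpha> i + c j k *\<^sub>R \<alpha> k \<in> roots A"
    using t by simp
  show "\<exists>s r. s \<noteq> 0 \<and> b = s *\<^sub>R r \<and> r \<in> set [\<alpha> i, \<alpha> j, \<alpha> k, \<alpha> i + c i j *\<^sub>R \<alpha> j, \<alpha> k + c k j *\<^sub>R \<alpha> j,
        \<alpha> j + c j i *\<^sub>R \<alpha> i + c j k *\<^sub>R \<alpha> k]" if "b \<in> roots A" "b \<bullet> e l = 0"
    using six[OF that] \<open>c j k = t\<close> unfolding rs_def by blast
qed

text \<open>In a triangle the simple roots and the edge roots already exhaust the six supports, so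
  no root has full support. Behind the wall \<open>i\<close> the diagram must then be a path with
  middle node \<open>i\<close>, and the full root of that path has full support in the old base as
  well.\<close>

lemma no_triangle:
  assumes d: "distinct [i, j, k, l]"
    and adj: "c i j > 0" "c j k > 0" "c i k > 0"
  shows False
proof -
  note d' = distinct_fourD[OF d]
  have kj: "c k j > 0" and ji: "c j i > 0" and ki: "c k i > 0"
    using c_pos_sym[OF d'(4) adj(2)] c_pos_sym[OF d'(1) adj(1)] c_pos_sym[OF d'(2) adj(3)]
    by simp_all
  have co: "\<alpha> x \<bullet> e y = (if x = y then 1 else 0)" for x y
    by (rule base_dual)
  note ev = inner_add_left co d'
  define rs where "rs = [\<alpha> i, \<alpha> j, \<alpha> k, \<alpha> i + c i j *\<^sub>R \<alpha> j, \<alpha> k + c k j *\<^sub>R \<alpha> j, \<alpha> k + c k i *\<^sub>R \<alpha> i]"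
  have nz: "c i j \<noteq> 0" "c j k \<noteq> 0" "c k j \<noteq> 0" "c j i \<noteq> 0" "c k i \<noteq> 0"
    using adj kj ji ki by simp_all
  have sup: "map supp rs = [{i}, {j}, {k}, {i, j}, {j, k}, {i, k}]"
    by (simp add: rs_def supp_filter[OF d] ev nz)
  have six: "\<exists>s r. s \<noteq> 0 \<and> r \<in> set rs \<and> b = s *\<^sub>R r" if "b \<in> roots A" "b \<bullet> e l = 0" for b
  proof (rule six_distinct_supports[OF _ _ _ _ that])
    show "set rs \<subseteq> roots A"
      using base_root cr_root[of j i] cr_root[of j k] cr_root[of i k] d' by (simp add: rs_def)
    show "r \<bullet> e l = 0" if "r \<in> set rs" for r
      using that by (auto simp: rs_def ev)
    show "length rs = 6"
      by (simp add: rs_def)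
    show "distinct (map supp rs)"
      unfolding sup using d' by (simp add: doubleton_eq_iff insert_eq_iff)
  qed
  have nofull: "b \<bullet> e i = 0 \<or> b \<bullet> e j = 0 \<or> b \<bullet> e k = 0" if b: "b \<in> roots A" "b \<bullet> e l = 0" for b
  proof -
    obtain s r where "r \<in> set rs" "b = s *\<^sub>R r"
      using six[OF b] by blast
    then have "r = \<alpha> i \<or> r = \<alpha> j \<or> r = \<alpha> k \<or> r = \<alpha> i + c i j *\<^sub>R \<alpha> j \<or>
        r = \<alpha> k + c k j *\<^sub>R \<alpha> j \<or> r = \<alpha> k + c k i *\<^sub>R \<alpha> i"
      by (simp add: rs_def)
    with \<open>b = s *\<^sub>R r\<close> show ?thesis
      by (elim disjE) (simp_all add: ev)
  qed
  define \<beta> f where "\<beta> = cross A i \<alpha>" and "f = cross_dual A i \<alpha> e"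
  interpret X: light_base A \<beta> f
    unfolding \<beta>_def f_def by (rule cross_light_base)
  have \<beta>: "\<beta> i = - \<alpha> i" "\<beta> j = \<alpha> j + c j i *\<^sub>R \<alpha> i" "\<beta> k = \<alpha> k + c k i *\<^sub>R \<alpha> i"
    using d' by (auto simp: cross_def \<beta>_def)
  have fl: "f l = e l"
    using d' by (simp add: f_def cross_dual_simps(2))
  have jk: "X.c j k = 0"
  proof (rule ccontr)
    assume "X.c j k \<noteq> 0"
    then have p: "X.c j k > 0"
      using X.cr_nonneg[of k j] d' by simp
    have "\<beta> j + X.c j k *\<^sub>R \<beta> k \<in> roots A"
      by (rule X.cr_root[OF d'(10)])
    moreover have "(\<beta> j + X.c j k *\<^sub>R \<beta> k) \<bullet> e i = c j i + X.c j k * c k i"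
      "(\<beta> j + X.c j k *\<^sub>R \<beta> k) \<bullet> e j = 1" "(\<beta> j + X.c j k *\<^sub>R \<beta> k) \<bullet> e k = X.c j k"
      "(\<beta> j + X.c j k *\<^sub>R \<beta> k) \<bullet> e l = 0"
      by (simp_all add: \<beta> ev)
    moreover have "c j i + X.c j k * c k i > 0"
      using p ji ki by (simp add: add_pos_pos)
    ultimately show False
      using nofull[of "\<beta> j + X.c j k *\<^sub>R \<beta> k"] p by simp
  qed
  have "\<beta> j + c j i *\<^sub>R \<beta> i \<in> roots A"
    using base_root by (simp add: \<beta>)
  then have ji': "X.c j i > 0"
    using X.cr_max[of i j "c j i"] ji d' by auto
  have "\<beta> k + c k i *\<^sub>R \<beta> i \<in> roots A"
    using base_root by (simp add: \<beta>)
  then have ki': "X.c k i > 0"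
    using X.cr_max[of i k "c k i"] ki d' by auto
  have ik': "X.c i k > 0"
    by (rule X.c_pos_sym[OF d'(8) ki'])
  have dX: "distinct [j, i, k, l]"
    using d by auto
  note P = X.path[OF dX ji' ik' jk]
  have co': "\<beta> x \<bullet> f y = (if x = y then 1 else 0)" for x y
    by (rule X.base_dual)
  note ev' = inner_add_left co' d'
  have ij': "X.c i j > 0"
    by (rule X.c_pos_sym[OF d'(7) ji'])
  have "distinct [k, i, j, l]"
    using d by auto
  moreover have "X.c k j = 0"
    using X.c_zero_sym[OF d'(4)] jk by simp
  ultimately have kik: "X.c k i * X.c i k = 1"
    using X.path_edge[of k i j l] ki' ij' by blast
  \<comment> \<open>The old \<open>\<alpha> x\<close> is a root on the nodes \<open>x\<close> and
    \<open>i\<close> of the new base; the list of roots of the new path admits only one coefficient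
    for it.\<close>
  have eq: "X.c x i = c x i" if x: "x = j \<or> x = k" for x
  proof -
    let ?h = "\<beta> x + c x i *\<^sub>R \<beta> i"
    have h: "?h = \<alpha> x"
      using x by (auto simp: \<beta>)
    have "?h \<in> roots A"
      unfolding h by (rule base_root)
    moreover have "?h \<bullet> f l = 0"
      unfolding h fl using x by (auto simp: ev)
    ultimately obtain s r where sr: "?h = s *\<^sub>R r"
      and "r \<in> set [\<beta> j, \<beta> i, \<beta> k, \<beta> j + X.c j i *\<^sub>R \<beta> i, \<beta> k + X.c k i *\<^sub>R \<beta> i,
        \<beta> i + X.c i j *\<^sub>R \<beta> j + X.c i k *\<^sub>R \<beta> k]"
      using P(3)[of ?h] by blast
    then have r: "r = \<beta> j \<or> r = \<beta> i \<or> r = \<beta> k \<or> r = \<beta> j + X.c j i *\<^sub>R \<beta> i \<or>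
        r = \<beta> k + X.c k i *\<^sub>R \<beta> i \<or> r = \<beta> i + X.c i j *\<^sub>R \<beta> j + X.c i k *\<^sub>R \<beta> k"
      by simp
    have co: "?h \<bullet> f y = s * (r \<bullet> f y)" for y
      by (simp add: sr)
    have nz': "X.c i j \<noteq> 0" "X.c i k \<noteq> 0"
      using ij' ik' by simp_all
    from x show ?thesis
    proof
      assume "x = j"
      then show ?thesis
        using r co[of i] co[of j] co[of k] nz nz' by (elim disjE) (simp_all add: ev')
    next
      assume "x = k"
      then show ?thesis
        using r co[of i] co[of j] co[of k] nz nz' by (elim disjE) (simp_all add: ev')
    qed
  qed
  let ?g = "\<beta> i + X.c i j *\<^sub>R \<beta> j + X.c i k *\<^sub>R \<beta> k"
  \<comment> \<open>The two edge products contribute 1 each and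
    \<open>\<beta> i = - \<alpha> i\<close> subtracts 1.\<close>
  have "?g \<bullet> e i = X.c i j * c j i + X.c i k * c k i - 1"
    by (simp add: \<beta> ev inner_diff_left)
  also have "\<dots> = 1"
    using P(1) kik eq[of j] eq[of k] by (simp add: mult.commute)
  finally have "?g \<bullet> e i = 1" .
  moreover have "?g \<bullet> e j = X.c i j" "?g \<bullet> e k = X.c i k" "?g \<bullet> e l = 0"
    by (simp_all add: \<beta> ev inner_diff_left)
  ultimately show False
    using nofull[OF P(2)] ij' ik' by simp
qed

end

section \<open>Galleries and reducibility\<close>

text \<open>Walking only through walls that separate the current chamber from \<open>- x\<close>, one reaches the
  chamber of \<open>- x\<close>: each such step removes exactly one separating hyperplane.\<close>

lemma gallery:
  assumes arr: "arrangement A" and simp: "simplicial A"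
    and gen: "\<And>b. b \<in> roots A \<Longrightarrow> b \<bullet> x \<noteq> 0"
    and step: "\<And>\<alpha> e i. base A \<alpha> e \<Longrightarrow> Q \<alpha> e \<Longrightarrow> \<alpha> i \<bullet> x > 0 \<Longrightarrow>
      Q (cross A i \<alpha>) (cross_dual A i \<alpha> e)"
  shows "base A \<alpha> e \<Longrightarrow> Q \<alpha> e \<Longrightarrow> \<exists>\<beta> f. base A \<beta> f \<and> Q \<beta> f \<and> (\<forall>i. \<beta> i \<bullet> x < 0)"
proof (induction "card (hyp ` {b \<in> roots A. b \<bullet> x > 0 \<and> (\<forall>i. b \<bullet> e i \<ge> 0)})"
    arbitrary: \<alpha> e rule: less_induct)
  case (less e \<alpha>)
  interpret simplicial_base A \<alpha> e
    by unfold_locales (rule arr simp less.prems)+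
  let ?N = "\<lambda>e. hyp ` {b \<in> roots A. b \<bullet> x > 0 \<and> (\<forall>i. b \<bullet> e i \<ge> 0)}"
  show ?case
  proof (cases "\<forall>i. \<alpha> i \<bullet> x < 0")
    case True
    then show ?thesis
      using less.prems by blast
  next
    case False
    then obtain i where i: "\<alpha> i \<bullet> x > 0"
      using gen[OF base_root] by (meson linorder_neqE)
    let ?f = "cross_dual A i \<alpha> e"
    \<comment> \<open>No new hyperplane enters the count: a root that becomes nonnegative only by
      this crossing is a nonpositive multiple of \<open>\<alpha> i\<close>, hence not positive at
      \<open>x\<close>.\<close>
    have sub: "\<forall>j. b \<bullet> e j \<ge> 0" if b: "b \<in> roots A" "b \<bullet> x > 0" "\<forall>j. b \<bullet> ?f j \<ge> 0" for b
    proof (rule ccontr)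
      assume "\<not> ?thesis"
      then have neg: "\<forall>j. b \<bullet> e j \<le> 0"
        using base_sign[OF b(1)] by blast
      have "b = (b \<bullet> e i) *\<^sub>R \<alpha> i"
      proof (rule base_parallelI)
        fix j
        assume "j \<noteq> i"
        then show "b \<bullet> e j = 0"
          using b(3)[rule_format, of j] neg[rule_format, of j] by (simp add: cross_dual_simps(2))
      qed
      then have "b \<bullet> x = (b \<bullet> e i) * (\<alpha> i \<bullet> x)"
        by (metis inner_scaleR_left)
      also have "\<dots> \<le> 0"
        using neg i by (simp add: mult_nonpos_nonneg)
      finally show False
        using b(2) by simp
    qed
    have "hyp (\<alpha> i) \<in> ?N e"
      using base_root[of i] i base_dual by (intro imageI) simp
    moreover have "hyp (\<alpha> i) \<notin> ?N ?f"
    proof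
      assume "hyp (\<alpha> i) \<in> ?N ?f"
      then obtain b where "hyp (\<alpha> i) = hyp b" and b: "b \<in> roots A" "b \<bullet> x > 0" "\<forall>j. b \<bullet> ?f j \<ge> 0"
        by blast
      then obtain s where s: "b = s *\<^sub>R \<alpha> i"
        using hyp_eqD[of "\<alpha> i" b] roots_nonzero[OF base_root] roots_nonzero[OF b(1)] by metis
      then have "s > 0"
        using b(2) i by (simp add: zero_less_mult_iff)
      moreover have "b \<bullet> ?f i = - s"
        by (simp add: s base_inner_cross_dual)
      ultimately show False
        using b(3)[rule_format, of i] by simp
    qed
    moreover have "?N ?f \<subseteq> ?N e"
      using sub by blast
    ultimately have "?N ?f \<subset> ?N e"
      by blast
    moreover have "finite (?N e)"
      using finite_hyp_roots[OF arr] by (rule rev_finite_subset) blast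
    ultimately have "card (?N ?f) < card (?N e)"
      by (rule psubset_card_mono[rotated])
    from less.hyps[OF this cross_base step[OF less.prems i]] show ?thesis .
  qed
qed

section \<open>Roots as walls of chambers, and splitting of the diagram\<close>

text \<open>The sum of the rays is an interior point of the chamber; it supplies the generic point
  for galleries.\<close>

lemma (in simplicial_base) sum_rays_pos:
  assumes "b \<in> roots A" "\<forall>j. b \<bullet> e j \<ge> 0"
  shows "b \<bullet> (\<Sum>j\<in>UNIV. e j) > 0"
proof -
  have "b \<noteq> 0"
    using assms(1) by (rule roots_nonzero)
  then obtain j where "b \<bullet> e j \<noteq> 0"
    using base_eqI[of b 0] by auto
  then show ?thesis
    using assms(2) unfolding inner_sum_right by (intro sum_pos2[of _ j]) (auto simp: order_less_le)
qed

lemma (in simplicial_base) sum_rays_generic: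
  assumes "b \<in> roots A"
  shows "b \<bullet> (\<Sum>j\<in>UNIV. e j) \<noteq> 0"
  using sum_rays_pos[OF assms] sum_rays_pos[OF roots_minus[OF assms]] base_sign[OF assms] by force

text \<open>If \<open>b\<close> were never parallel to a wall normal on the way to the opposite
  chamber, its sign could never change along the gallery, yet it is opposite at the two ends. The
  invariant \<open>Q\<close> is carried along to the chamber found.\<close>

lemma (in simplicial_base) every_root_is_wall:
  assumes Q: "Q \<alpha> e"
    and step: "\<And>\<beta> f i. base A \<beta> f \<Longrightarrow> Q \<beta> f \<Longrightarrow> Q (cross A i \<beta>) (cross_dual A i \<beta> f)"
    and b: "b \<in> roots A"
  shows "\<exists>\<beta> f i s. base A \<beta> f \<and> Q \<beta> f \<and> b = s *\<^sub>R \<beta> i"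
proof -
  define x where "x = (\<Sum>j\<in>UNIV. e j)"
  note pos = sum_rays_pos[folded x_def] and gen = sum_rays_generic[folded x_def]
  have main: "\<exists>\<beta> f i s. base A \<beta> f \<and> Q \<beta> f \<and> b = s *\<^sub>R \<beta> i"
    if b: "b \<in> roots A" "\<forall>j. b \<bullet> e j \<ge> 0" for b
  proof (rule ccontr)
    assume n: "\<not> ?thesis"
    define Q' where "Q' = (\<lambda>\<beta> f. Q \<beta> f \<and> (\<forall>j::4. b \<bullet> f j \<ge> 0))"
    have "\<exists>\<beta> f. base A \<beta> f \<and> Q' \<beta> f \<and> (\<forall>i. \<beta> i \<bullet> x < 0)"
    proof (rule gallery[OF arr simplicial gen _ base])
      show "Q' \<alpha> e"
        using Q b(2) by (simp add: Q'_def)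
      fix \<beta> f i
      assume \<beta>: "base A \<beta> f" "Q' \<beta> f"
      interpret B: simplicial_base A \<beta> f
        by unfold_locales (rule arr simplicial \<beta>)+
      have nn: "\<forall>j. b \<bullet> f j \<ge> 0"
        using \<beta>(2) by (simp add: Q'_def)
      have "\<exists>j. j \<noteq> i \<and> b \<bullet> f j \<noteq> 0"
      proof (rule ccontr)
        assume "\<not> ?thesis"
        then have "b = (b \<bullet> f i) *\<^sub>R \<beta> i"
          by (intro B.base_parallelI) blast
        then show False
          using n \<beta> unfolding Q'_def by blast
      qed
      then obtain j where "j \<noteq> i" "b \<bullet> f j > 0"
        using nn by (metis order_less_le)
      then have "b \<bullet> cross_dual A i \<beta> f i \<ge> 0"
        by (rule B.cross_dual_nonneg[OF b(1)])
      then have "b \<bullet> cross_dual A i \<beta> f k \<ge> 0" for k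
        using nn by (cases "k = i") (auto simp: B.cross_dual_simps(2))
      then show "Q' (cross A i \<beta>) (cross_dual A i \<beta> f)"
        using step[OF \<beta>(1)] \<beta>(2) by (simp add: Q'_def)
    qed auto
    then obtain \<beta> f where \<beta>: "base A \<beta> f" "Q' \<beta> f" "\<forall>i. \<beta> i \<bullet> x < 0"
      by blast
    interpret B: simplicial_base A \<beta> f
      by unfold_locales (rule arr simplicial \<beta>)+
    have "b \<bullet> x = (\<Sum>i\<in>UNIV. (b \<bullet> f i) * (\<beta> i \<bullet> x))"
      by (rule B.base_inner_expand)
    also have "\<dots> \<le> 0"
      using \<beta>(2,3) by (intro sum_nonpos) (auto simp: Q'_def mult_nonneg_nonpos less_imp_le)
    finally show False
      using pos[OF b] by simp
  qed
  show ?thesis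
  proof (cases "\<forall>j. b \<bullet> e j \<ge> 0")
    case False
    then have "\<forall>j. (- b) \<bullet> e j \<ge> 0"
      using base_sign[OF b] by auto
    from main[OF roots_minus[OF b] this] obtain \<beta> f i s
      where "base A \<beta> f" "Q \<beta> f" "- b = s *\<^sub>R \<beta> i"
      by blast
    moreover from this(3) have "b = (- s) *\<^sub>R \<beta> i"
      by (metis add.inverse_inverse scaleR_minus_left)
    ultimately show ?thesis by blast
  qed (use main b in blast)
qed

text \<open>A new edge between the two sides would produce a root that either has mixed signs or is
  supported on \<open>j\<close> and nodes of \<open>I\<close>; in the latter case \<open>j\<close>
  needs an old neighbour inside \<open>I\<close>.\<close>

lemma (in simplicial_base) cross_preserves_split:
  assumes split: "\<And>i j. i \<in> I \<Longrightarrow> j \<notin> I \<Longrightarrow> c i j = 0"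
    and m: "m \<in> I" and ij: "i \<in> I" "j \<notin> I"
  shows "cr A (cross A m \<alpha> i) (cross A m \<alpha> j) = 0"
proof (rule ccontr)
  interpret X: simplicial_base A "cross A m \<alpha>" "cross_dual A m \<alpha> e"
    by (rule cross_simplicial_base)
  assume ne: "cr A (cross A m \<alpha> i) (cross A m \<alpha> j) \<noteq> 0"
  have "i \<noteq> j" "j \<noteq> m"
    using ij m by auto
  then have p: "X.c i j > 0"
    using ne X.cr_nonneg[of j i] by simp
  then have "X.c j i > 0"
    by (rule X.c_pos_sym[OF \<open>i \<noteq> j\<close>])
  define t where "t = X.c j i"
  have t: "t > 0"
    unfolding t_def by fact
  have "c m j = 0"
    using split m ij(2) by blast
  then have "c j m = 0"
    using c_zero_sym[OF \<open>j \<noteq> m\<close>] by simp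
  then have "cross A m \<alpha> j = \<alpha> j"
    using \<open>j \<noteq> m\<close> by (simp add: cross_def)
  then have root: "\<alpha> j + t *\<^sub>R cross A m \<alpha> i \<in> roots A"
    using X.cr_root[OF \<open>i \<noteq> j\<close>] by (simp add: t_def)
  show False
  proof (cases "i = m")
    case True
    have "\<alpha> j - t *\<^sub>R \<alpha> m \<in> roots A"
      using root True by (simp add: cross_def)
    from base_nonneg[OF this, of j m] show False
      using t \<open>j \<noteq> m\<close> by (simp add: inner_diff_left base_dual)
  next
    case False
    let ?b = "\<alpha> j + t *\<^sub>R (\<alpha> i + c i m *\<^sub>R \<alpha> m)"
    have b: "?b \<in> roots A"
      using root False by (simp add: cross_def)
    have co: "?b \<bullet> e j = 1" "?b \<bullet> e i = t" "k \<noteq> j \<Longrightarrow> k \<noteq> i \<Longrightarrow> k \<noteq> m \<Longrightarrow> ?b \<bullet> e k = 0" for k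
      using \<open>i \<noteq> j\<close> \<open>j \<noteq> m\<close> False by (auto simp: inner_add_left base_dual)
    obtain k where "k \<noteq> j" "?b \<bullet> e k > 0" "c k j > 0"
      using exists_neighbour_in_support[OF b, of j i] co(1,2) t \<open>i \<noteq> j\<close> by auto
    moreover from this have "k = i \<or> k = m"
      using co(3)[of k] by fastforce
    ultimately show False
      using split[of k j] ij m by auto
  qed
qed

text \<open>Crossings keep each wall normal in the span of one of the two groups of starting
  normals. As every root is a wall normal of some chamber reached, every root lies in one of the two
  spans, and the product decomposition follows.\<close>

lemma (in simplicial_base) disconnected_imp_reducible:
  assumes I: "I \<noteq> {}" "I \<noteq> UNIV"
    and split: "\<And>i j. i \<in> I \<Longrightarrow> j \<notin> I \<Longrightarrow> c i j = 0"
  shows "reducible A"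
proof -
  define Q where "Q = (\<lambda>\<beta> (f :: 4 \<Rightarrow> vec4). \<forall>i\<in>I. \<forall>j\<in>- I.
    \<beta> i \<bullet> e j = 0 \<and> \<beta> j \<bullet> e i = 0 \<and> cr A (\<beta> i) (\<beta> j) = 0 \<and> cr A (\<beta> j) (\<beta> i) = 0)"
  have Q0: "Q \<alpha> e"
    unfolding Q_def
  proof (intro ballI)
    fix i j
    assume ij: "i \<in> I" "j \<in> - I"
    then have "i \<noteq> j" by auto
    then show "\<alpha> i \<bullet> e j = 0 \<and> \<alpha> j \<bullet> e i = 0 \<and> c i j = 0 \<and> c j i = 0"
      using split[of i j] ij c_zero_sym[of i j] by (simp add: base_dual)
  qed
  have step: "Q (cross A m \<beta>) (cross_dual A m \<beta> f)" if \<beta>: "base A \<beta> f" "Q \<beta> f" for \<beta> f m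
  proof -
    interpret B: simplicial_base A \<beta> f
      by unfold_locales (rule arr simplicial \<beta>)+
    interpret X: simplicial_base A "cross A m \<beta>" "cross_dual A m \<beta> f"
      by (rule B.cross_simplicial_base)
    have B0: "B.c i j = 0" "B.c j i = 0" "\<beta> i \<bullet> e j = 0" "\<beta> j \<bullet> e i = 0" if "i \<in> I" "j \<notin> I" for i j
      using \<beta>(2) that unfolding Q_def by auto
    have "X.c i j = 0" if ij: "i \<in> I" "j \<notin> I" for i j
    proof (cases "m \<in> I")
      case True
      show ?thesis
        by (rule B.cross_preserves_split[OF B0(1) True ij])
    next
      case False
      have "X.c j i = 0"
        by (rule B.cross_preserves_split[of "- I"]) (use B0(2) False ij in auto)
      then show ?thesis
        using X.c_zero_sym[of i j] ij by auto
    qed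
    moreover have "X.c j i = 0" if "X.c i j = 0" "i \<in> I" "j \<notin> I" for i j
      using X.c_zero_sym[of i j] that by auto
    moreover have "cross A m \<beta> i \<bullet> e j = 0" "cross A m \<beta> j \<bullet> e i = 0" if ij: "i \<in> I" "j \<notin> I" for i j
      using B0[OF ij] B0[of m j] B0[of i m] ij
      by (cases "m \<in> I"; auto simp: cross_def inner_add_left)+
    ultimately show ?thesis
      unfolding Q_def by auto
  qed
  have key: "(\<forall>j\<in>- I. b \<bullet> e j = 0) \<or> (\<forall>i\<in>I. b \<bullet> e i = 0)" if b: "b \<in> roots A" for b
  proof -
    obtain \<beta> f i s where \<beta>: "Q \<beta> f" "b = s *\<^sub>R \<beta> i"
      using every_root_is_wall[of Q, OF Q0 step b] by blast
    show ?thesis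
      using \<beta> unfolding Q_def by (cases "i \<in> I") auto
  qed
  \<comment> \<open>\<open>V J\<close> is the span of the rays \<open>e i\<close> with
    \<open>i\<close> outside \<open>J\<close>.\<close>
  define V where "V J = {x. \<forall>j\<in>J. \<alpha> j \<bullet> x = 0}" for J
  have sub: "subspace (V J)" for J
    by (auto simp: V_def subspace_def inner_add_right)
  have eV: "e i \<in> V J" if "i \<notin> J" for i J
    using that by (auto simp: V_def base_dual)
  have e0: "e i \<noteq> 0" for i
    using base_dual[of i i] by auto
  have perp: "V J \<subseteq> hyp b" if "\<forall>j\<in>- J. b \<bullet> e j = 0" for J b
  proof
    fix x
    assume "x \<in> V J"
    then have "(b \<bullet> e j) * (\<alpha> j \<bullet> x) = 0" for j
      using that by (cases "j \<in> J") (auto simp: V_def)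
    then have "b \<bullet> x = 0"
      unfolding base_inner_expand[of b x] by (intro sum.neutral) blast
    then show "x \<in> hyp b"
      by (simp add: hyp_def)
  qed
  show ?thesis
    unfolding reducible_def
  proof (intro exI conjI)
    show "subspace (V (- I))" "subspace (V I)"
      by (rule sub)+
    obtain i j where "i \<in> I" "j \<notin> I"
      using I by blast
    then show "V (- I) \<noteq> {0}" "V I \<noteq> {0}"
      using eV[of i "- I"] eV[of j I] e0 by auto
    have "x = 0" if "x \<in> V (- I)" "x \<in> V I" for x
    proof -
      have "\<alpha> i \<bullet> x = 0" for i
        using that by (cases "i \<in> I") (auto simp: V_def)
      then show ?thesis
        using base_expand_dual[of x] by simp
    qed
    then show "V (- I) \<inter> V I = {0}"
      using subspace_0[OF sub] by auto
    show "\<forall>z. \<exists>x\<in>V (- I). \<exists>y\<in>V I. z = x + y"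
    proof
      fix z
      let ?p = "\<lambda>J. \<Sum>i\<in>J. (\<alpha> i \<bullet> z) *\<^sub>R e i"
      have "?p I \<in> V (- I)" "?p (- I) \<in> V I"
        using eV by (auto intro!: subspace_sum[OF sub] subspace_scale[OF sub])
      moreover have "z = ?p I + ?p (- I)"
        using base_expand_dual[of z] by (simp add: sum.union_disjoint[symmetric])
      ultimately show "\<exists>x\<in>V (- I). \<exists>y\<in>V I. z = x + y"
        by blast
    qed
    show "\<forall>H\<in>A. V I \<subseteq> H \<or> V (- I) \<subseteq> H"
    proof
      fix H
      assume "H \<in> A"
      then obtain b where b: "b \<in> roots A" "H = hyp b"
        using arrangement_hypE[OF arr] by blast
      show "V I \<subseteq> H \<or> V (- I) \<subseteq> H"
        using key[OF b(1)] perp[of I b] perp[of "- I" b] b(2) by auto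
    qed
  qed
qed

section \<open>Invariance of the crossing coefficients\<close>

lemma exists_fourth:
  fixes i j k :: 4
  assumes "distinct [i, j, k]"
  shows "\<exists>l. distinct [i, j, k, l]"
proof -
  have "card {i, j, k} \<noteq> card (UNIV :: 4 set)"
    using assms by simp
  then obtain l where "l \<notin> {i, j, k}"
    by (metis UNIV_eq_I)
  then show ?thesis
    using assms by auto
qed

locale irreducible_base = light_base +
  assumes irreducible: "\<not> reducible A"
begin

lemma cross_irreducible_base: "irreducible_base A (cross A i \<alpha>) (cross_dual A i \<alpha> e)"
  using cross_light_base irreducible
  by (simp add: irreducible_base_def irreducible_base_axioms_def)

lemma connected:
  assumes "I \<noteq> {}" "I \<noteq> UNIV"
  shows "\<exists>i\<in>I. \<exists>j\<in>- I. c i j > 0"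
proof (rule ccontr)
  assume n: "\<not> ?thesis"
  have "c i j = 0" if "i \<in> I" "j \<notin> I" for i j
    using n that cr_nonneg[of j i] by force
  then show False
    using disconnected_imp_reducible[OF assms] irreducible by blast
qed

lemma triangle_free:
  assumes "distinct [i, j, k]" "c i j > 0" "c j k > 0"
  shows "c i k = 0"
proof -
  obtain l where "distinct [i, j, k, l]"
    using exists_fourth[OF assms(1)] by blast
  then show ?thesis
    using no_triangle[of i j k l] assms cr_nonneg[of k i] by fastforce
qed

text \<open>With four nodes, connectedness continues an edge at one of its ends, and the absence of
  triangles makes the result a path. Statements about paths thereby apply to every edge.\<close>

lemma edge_in_path:
  assumes ij: "i \<noteq> j" and p: "c i j > 0"
  obtains k l where "distinct [i, j, k, l]" "c j k > 0" "c i k = 0"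
        | k l where "distinct [j, i, k, l]" "c i k > 0" "c j k = 0"
proof -
  have "{i, j} \<noteq> UNIV"
  proof
    assume "{i, j} = UNIV"
    then have "card {i, j} = card (UNIV :: 4 set)" by simp
    then show False
      using ij by simp
  qed
  then obtain x k where x: "x = i \<or> x = j" and k: "k \<noteq> i" "k \<noteq> j" "c x k > 0"
    using connected[of "{i, j}"] by auto
  have d: "distinct [i, j, k]" "distinct [j, i, k]"
    using ij k by auto
  from x show thesis
  proof
    assume "x = j"
    moreover obtain l where "distinct [i, j, k, l]"
      using exists_fourth[OF d(1)] by blast
    moreover have "c i k = 0"
      using triangle_free[OF d(1) p] k \<open>x = j\<close> by simp
    ultimately show thesis
      using that(1) k by blast
  next
    assume "x = i"
    moreover obtain l where "distinct [j, i, k, l]"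
      using exists_fourth[OF d(2)] by blast
    moreover have "c j k = 0"
      using triangle_free[OF d(2) c_pos_sym[OF ij p]] k \<open>x = i\<close> by simp
    ultimately show thesis
      using that(2) k by blast
  qed
qed

lemma edge_product:
  assumes ij: "i \<noteq> j" and p: "c i j > 0"
  shows "c i j * c j i = 1"
proof (cases rule: edge_in_path[OF assms])
  case (1 k l)
  then show ?thesis
    using path_edge[of i j k l] p by blast
next
  case (2 k l)
  then show ?thesis
    using path_edge[of j i k l] c_pos_sym[OF assms] by (simp add: mult.commute)
qed

text \<open>Among the six roots only the edge root on \<open>i\<close>, \<open>j\<close> and the
  full root involve both nodes, and both have the same ratio because of the edge product.\<close>

lemma path_root_coeffs:
  assumes d: "distinct [i, j, k, l]" and adj: "c i j > 0" "c j k > 0" "c i k = 0"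
    and b: "b \<in> roots A" "b \<bullet> e l = 0" "b \<bullet> e i > 0" "b \<bullet> e j > 0"
  shows "b \<bullet> e i = (b \<bullet> e j) * c j i"
    and "b \<bullet> e k > 0 \<Longrightarrow> b \<bullet> e k = (b \<bullet> e j) * c j k"
proof -
  note d' = distinct_fourD[OF d]
  obtain s r where sr: "b = s *\<^sub>R r"
    and "r \<in> set [\<alpha> i, \<alpha> j, \<alpha> k, \<alpha> i + c i j *\<^sub>R \<alpha> j, \<alpha> k + c k j *\<^sub>R \<alpha> j,
        \<alpha> j + c j i *\<^sub>R \<alpha> i + c j k *\<^sub>R \<alpha> k]"
    using path_all_roots[OF d adj b(1,2)] by blast
  then have r: "r = \<alpha> i \<or> r = \<alpha> j \<or> r = \<alpha> k \<or> r = \<alpha> i + c i j *\<^sub>R \<alpha> j \<or> r = \<alpha> k + c k j *\<^sub>R \<alpha> j \<or>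
        r = \<alpha> j + c j i *\<^sub>R \<alpha> i + c j k *\<^sub>R \<alpha> k"
    by simp
  have e1: "c i j * c j i = 1"
    by (rule edge_product[OF d'(1) adj(1)])
  have co: "b \<bullet> e y = s * (r \<bullet> e y)" for y
    by (simp add: sr)
  note ev = inner_add_left base_dual d'
  show "b \<bullet> e i = (b \<bullet> e j) * c j i"
    using r co[of i] co[of j] co[of k] b(3,4) e1 by (elim disjE) (simp_all add: ev mult.assoc)
  show "b \<bullet> e k = (b \<bullet> e j) * c j k" if "b \<bullet> e k > 0"
    using r co[of i] co[of j] co[of k] b(3,4) that by (elim disjE) (simp_all add: ev)
qed

lemma edge_root_coeffs:
  assumes ij: "i \<noteq> j" and b: "b \<in> roots A" "b \<bullet> e i > 0" "b \<bullet> e j > 0"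
    and z: "\<And>k. k \<noteq> i \<Longrightarrow> k \<noteq> j \<Longrightarrow> b \<bullet> e k = 0"
  shows "b \<bullet> e i = (b \<bullet> e j) * c j i"
proof -
  have "c j i > 0"
    using exists_neighbour_in_support[OF b(1,2) ij[symmetric] b(3)] z by force
  then have p: "c i j > 0"
    by (rule c_pos_sym[OF ij[symmetric]])
  show ?thesis
  proof (cases rule: edge_in_path[OF ij p])
    case (1 k l)
    then show ?thesis
      using path_root_coeffs(1)[OF 1(1) p 1(2,3) b(1) _ b(2,3)] z[of l] by auto
  next
    case (2 k l)
    have "b \<bullet> e j = (b \<bullet> e i) * c i j"
      using path_root_coeffs(1)[OF 2(1) \<open>c j i > 0\<close> 2(2,3) b(1) _ b(3,2)] z[of l] 2(1)
      by auto
    then show ?thesis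
      using edge_product[OF ij p] by (simp add: mult.assoc)
  qed
qed

text \<open>The numbers \<open>c i j\<close> play the role of the negatives of the off-diagonal Cartan integers.\<close>

lemma cross_preserves_c:
  assumes jk: "j \<noteq> k"
  shows "cr A (cross A i \<alpha> j) (cross A i \<alpha> k) = c j k"
proof -
  define \<beta> f where "\<beta> = cross A i \<alpha>" and "f = cross_dual A i \<alpha> e"
  interpret X: irreducible_base A \<beta> f
    unfolding \<beta>_def f_def by (rule cross_irreducible_base)
  have \<beta>i: "\<beta> i = - \<alpha> i" and \<beta>: "x \<noteq> i \<Longrightarrow> \<beta> x = \<alpha> x + c x i *\<^sub>R \<alpha> i" for x
    by (auto simp: \<beta>_def cross_def)
  have kj: "k \<noteq> j"
    using jk by simp
  note ev = inner_add_left inner_diff_left base_dual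
  consider "j = i" | "k = i" | "j \<noteq> i" "k \<noteq> i" by blast
  then have "X.c j k = c j k"
  proof cases
    case 1
    have k: "k \<noteq> i"
      using 1 jk by simp
    show ?thesis
    proof (cases "c i k = 0")
      case True
      then have "c k i = 0"
        using c_zero_sym[of i k] k by simp
      show ?thesis
      proof (rule X.cr_eqI[OF kj])
        show "\<beta> j + c j k *\<^sub>R \<beta> k \<in> roots A"
          using 1 True \<beta>i roots_minus[OF base_root] by simp
        fix t :: real
        assume t: "t > 0" "\<beta> j + t *\<^sub>R \<beta> k \<in> roots A"
        then have "- \<alpha> i + t *\<^sub>R \<alpha> k \<in> roots A"
          using 1 \<beta>i \<beta>[OF k] \<open>c k i = 0\<close> by simp
        from base_nonneg[OF this, of k i] show "t \<le> c j k"
          using t(1) k by (auto simp: ev)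
      qed
    next
      case False
      then have p: "c i k > 0"
        using cr_nonneg[OF k] by simp
      have e1: "c i k * c k i = 1"
        using edge_product[OF k[symmetric] p] .
      show ?thesis
      proof (rule X.cr_eqI[OF kj])
        \<comment> \<open>The parts along \<open>\<alpha> i\<close> cancel since the edge product is
          1.\<close>
        have "\<beta> j + c j k *\<^sub>R \<beta> k = c i k *\<^sub>R \<alpha> k"
          using 1 \<beta>i \<beta>[OF k] e1 by (simp add: scaleR_add_right)
        then show "\<beta> j + c j k *\<^sub>R \<beta> k \<in> roots A"
          using roots_scale[OF base_root False] by simp
        fix t :: real
        assume t: "t > 0" "\<beta> j + t *\<^sub>R \<beta> k \<in> roots A"
        let ?b = "\<beta> j + t *\<^sub>R \<beta> k"
        have co: "?b \<bullet> e i = t * c k i - 1" "?b \<bullet> e k = t" "\<And>x. x \<noteq> i \<Longrightarrow> x \<noteq> k \<Longrightarrow> ?b \<bullet> e x = 0"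
          using 1 k \<beta>i \<beta>[OF k] by (auto simp: ev)
        \<comment> \<open>Otherwise the ratio of the two coordinates would require
          \<open>t * c k i - 1 = t * c k i\<close>.\<close>
        have "\<not> t * c k i - 1 > 0"
          using edge_root_coeffs[OF k[symmetric] t(2)] co t(1) by auto
        then have "t * c k i \<le> c i k * c k i"
          using e1 by simp
        moreover have "c k i > 0"
          by (rule c_pos_sym[OF k[symmetric] p])
        ultimately show "t \<le> c j k"
          using 1 by simp
      qed
    qed
  next
    case 2
    have j: "j \<noteq> i"
      using 2 jk by simp
    show ?thesis
    proof (rule X.cr_eqI[OF kj])
      show "\<beta> j + c j k *\<^sub>R \<beta> k \<in> roots A"
        using 2 \<beta>i \<beta>[OF j] base_root by simp
      fix t :: real
      assume "\<beta> j + t *\<^sub>R \<beta> k \<in> roots A"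
      then have "\<alpha> j + (c j i - t) *\<^sub>R \<alpha> i \<in> roots A"
        using 2 \<beta>i \<beta>[OF j] by (simp add: scaleR_diff_left algebra_simps)
      from edge_coeff_nonneg[OF j[symmetric] this] show "t \<le> c j k"
        using 2 by simp
    qed
  next
    case 3
    have "distinct [i, j, k]"
      using 3 jk by auto
    then obtain l where d: "distinct [i, j, k, l]"
      using exists_fourth by blast
    note d' = distinct_fourD[OF d]
    have co: "(\<beta> j + t *\<^sub>R \<beta> k) \<bullet> e j = 1" "(\<beta> j + t *\<^sub>R \<beta> k) \<bullet> e k = t"
        "(\<beta> j + t *\<^sub>R \<beta> k) \<bullet> e i = c j i + t * c k i" "(\<beta> j + t *\<^sub>R \<beta> k) \<bullet> e l = 0" for t
      using d' \<beta>[OF 3(1)] \<beta>[OF 3(2)] by (simp_all add: ev)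
    have nn: "c j i \<ge> 0" "c k i \<ge> 0" "c j k \<ge> 0"
      using cr_nonneg d' by blast+
    have nbr: "m = i \<or> m = j \<or> m = k" if "(\<beta> j + t *\<^sub>R \<beta> k) \<bullet> e m > 0" for m t
      using that co(4)[of t] distinct_four_exhaust[OF d, of m] by auto
    show ?thesis
    proof (rule X.cr_eqI[OF kj])
      \<comment> \<open>The four cases exhaust all possibilities because the coefficients are
        nonnegative: no edge between \<open>j\<close> and \<open>k\<close>, no edge at
        \<open>i\<close>, or a path continued by \<open>i\<close> at one of the two ends.\<close>
      have r0: "\<beta> j + c j k *\<^sub>R \<beta> k \<in> roots A" if "c j k = 0"
        using that X.base_root by simp
      have r1: "\<beta> j + c j k *\<^sub>R \<beta> k \<in> roots A" if "c j i = 0" "c k i = 0"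
        using that \<beta>[OF 3(1)] \<beta>[OF 3(2)] cr_root[OF kj] by simp
      have r2: "\<beta> j + c j k *\<^sub>R \<beta> k \<in> roots A" if p: "c j i > 0" "c j k > 0"
      proof -
        have ij: "c i j > 0"
          by (rule c_pos_sym[OF d'(7) p(1)])
        have ik: "c i k = 0"
          using triangle_free[of i j k] ij p(2) d by auto
        then have "c k i = 0"
          using c_zero_sym[OF d'(2)] by simp
        then show ?thesis
          using path_root[OF d ij p(2) ik] \<beta>[OF 3(1)] \<beta>[OF 3(2)] by (simp add: add.commute add.left_commute)
      qed
      have r3: "\<beta> j + c j k *\<^sub>R \<beta> k \<in> roots A" if p: "c k i > 0" "c j k > 0"
      proof -
        have ik: "c i k > 0"
          by (rule c_pos_sym[OF d'(8) p(1)])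
        have kj: "c k j > 0"
          by (rule c_pos_sym[OF d'(4) p(2)])
        have ij: "c i j = 0"
          using triangle_free[of i k j] ik kj d by auto
        then have ji: "c j i = 0"
          using c_zero_sym[OF d'(1)] by simp
        have d2: "distinct [j, k, i, l]"
          using d by auto
        have "c j k *\<^sub>R (\<alpha> k + c k j *\<^sub>R \<alpha> j + c k i *\<^sub>R \<alpha> i) \<in> roots A"
          using path_root[OF d2 p(2,1) ji] p(2) by (intro roots_scale) auto
        moreover have "c j k * c k j = 1"
          by (rule edge_product[OF d'(4) p(2)])
        ultimately show ?thesis
          using ji \<beta>[OF 3(1)] \<beta>[OF 3(2)]
          by (simp add: scaleR_add_right add.commute add.left_commute)
      qed
      show "\<beta> j + c j k *\<^sub>R \<beta> k \<in> roots A"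
        using r0 r1 r2 r3 nn by (metis order.not_eq_order_implies_strict)
      fix t :: real
      assume t: "t > 0" "\<beta> j + t *\<^sub>R \<beta> k \<in> roots A"
      let ?b = "\<beta> j + t *\<^sub>R \<beta> k"
      have ij: "c i j > 0 \<longleftrightarrow> c j i > 0" and ik: "c i k > 0 \<longleftrightarrow> c k i > 0" and jk: "c j k > 0 \<longleftrightarrow> c k j > 0"
        using c_pos_sym d' by blast+
      \<comment> \<open>\<open>mk\<close> and \<open>mj\<close> are nodes of the support adjacent to
        \<open>k\<close> and \<open>j\<close>. Without an edge between \<open>j\<close> and
        \<open>k\<close>, both are \<open>i\<close>.\<close>
      obtain mk where mk: "mk \<noteq> k" "?b \<bullet> e mk > 0" "c mk k > 0"
        using exists_neighbour_in_support[OF t(2), of k j] co t(1) d' by auto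
      obtain mj where mj: "mj \<noteq> j" "?b \<bullet> e mj > 0" "c mj j > 0"
        using exists_neighbour_in_support[OF t(2), of j k] co t(1) d' by auto
      show "t \<le> c j k"
      proof (cases "c j k > 0")
        case False
        have "c i k > 0"
          using nbr[OF mk(2)] mk(1,3) False by auto
        moreover have "c i j > 0"
          using nbr[OF mj(2)] mj(1,3) False jk by auto
        ultimately have p: "c k i > 0" "c j i > 0" "c i k > 0" "c i j > 0"
          using ij ik by simp_all
        have d2: "distinct [j, i, k, l]"
          using d by auto
        \<comment> \<open>The ratio on the path through \<open>i\<close> expresses 1 as an edge
          product, already equal to 1, plus a positive multiple of \<open>t\<close>.\<close>
        have "?b \<bullet> e j = (?b \<bullet> e i) * c i j"
          using path_root_coeffs(1)[OF d2 p(2,3) _ t(2)] co t(1) p False nn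
          by (simp add: add_pos_pos)
        then have "1 = c j i * c i j + t * c k i * c i j"
          unfolding co by (simp add: algebra_simps)
        moreover have "c j i * c i j = 1"
          by (rule edge_product[OF d'(7) p(2)])
        moreover have "t * c k i * c i j > 0"
          using t(1) p by simp
        ultimately show ?thesis by linarith
      next
        case True
        show ?thesis
        proof (cases "?b \<bullet> e i > 0")
          case False
          then have "?b \<bullet> e i = 0"
            using base_nonneg[OF t(2), of j i] co(1)[of t] by simp
          then have "?b \<bullet> e x = 0" if "x \<noteq> k" "x \<noteq> j" for x
            using distinct_four_exhaust[OF d, of x] that co(4)[of t] by auto
          then have "?b \<bullet> e k = (?b \<bullet> e j) * c j k"
            by (intro edge_root_coeffs[OF kj t(2)]) (simp_all only: co t(1) zero_less_one)
          then show ?thesis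
            by (simp add: co)
        next
          case bi: True
          have "c j i > 0 \<or> c k i > 0"
          proof (rule ccontr)
            assume "\<not> ?thesis"
            then have "c j i = 0" "c k i = 0"
              using nn by linarith+
            then show False
              using bi co(3)[of t] by simp
          qed
          then show ?thesis
          proof
            assume p: "c j i > 0"
            have "c i k = 0"
              using triangle_free[of i j k] ij p True d by auto
            then have "?b \<bullet> e k = (?b \<bullet> e j) * c j k"
              using path_root_coeffs(2)[OF d _ True _ t(2)] co t(1) p ij bi by simp
            then show ?thesis
              by (simp add: co)
          next
            assume p: "c k i > 0"
            have "c j i = 0"
              using triangle_free[of j k i] p True d by auto
            moreover have d2: "distinct [j, k, i, l]"
              using d by auto
            ultimately have "?b \<bullet> e j = (?b \<bullet> e k) * c k j"
              using path_root_coeffs(1)[OF d2 True p _ t(2)] co t(1) by simp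
            then have "1 = t * c k j"
              by (simp add: co)
            moreover have "c j k * c k j = 1"
              by (rule edge_product[OF d'(4) True])
            ultimately have "t * c k j = c j k * c k j" by simp
            then show ?thesis
              using True jk by simp
          qed
        qed
      qed
    qed
  qed
  then show ?thesis
    by (simp add: \<beta>_def)
qed

end

section \<open>The shape of the diagram\<close>

lemma sum_four:
  fixes h :: "4 \<Rightarrow> 'a::comm_monoid_add"
  assumes "distinct [i, j, k, l]"
  shows "sum h UNIV = h i + h j + h k + h l"
proof -
  have "UNIV = {i, j, k, l}"
    using distinct_four_exhaust[OF assms] by blast
  then have "sum h UNIV = sum h {i, j, k, l}"
    by simp
  also have "\<dots> = h i + h j + h k + h l"
    using assms by (simp add: add.assoc)
  finally show ?thesis .
qed

context irreducible_base
begin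

text \<open>The connected triangle-free graphs on four nodes: start from a path \<open>i\<close>,
  \<open>j\<close>, \<open>k\<close> and attach \<open>l\<close> to the middle, to one end or to
  both ends.\<close>

lemma shape_cases:
  obtains (path) i j k l where "distinct [i, j, k, l]"
      "c i j > 0" "c j k > 0" "c k l > 0" "c i k = 0" "c i l = 0" "c j l = 0"
    | (star) i j k l where "distinct [i, j, k, l]"
      "c j i > 0" "c j k > 0" "c j l > 0" "c i k = 0" "c i l = 0" "c k l = 0"
    | (cycle) i j k l where "distinct [i, j, k, l]"
      "c i j > 0" "c j k > 0" "c k l > 0" "c l i > 0" "c i k = 0" "c j l = 0"
proof -
  have "{1 :: 4} \<noteq> UNIV"
  proof
    assume "{1 :: 4} = UNIV"
    then have "card {1 :: 4} = card (UNIV :: 4 set)" by simp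
    then show False by simp
  qed
  from connected[OF insert_not_empty this] obtain x y where "x \<in> {1}" "y \<in> - {1}" "c x y > 0"
    by blast
  then have "x \<noteq> y" "c x y > 0"
    by auto
  then obtain i j k l where d: "distinct [i, j, k, l]" and p: "c i j > 0" "c j k > 0" "c i k = 0"
    using edge_in_path[of x y] c_pos_sym[of x y] by metis
  note d' = distinct_fourD[OF d]
  have nn: "c x y = 0 \<or> c x y > 0" if "x \<noteq> y" for x y
    using cr_nonneg[of y x] that by auto
  have "\<exists>x\<in>{i, j, k}. \<exists>y\<in>- {i, j, k}. c x y > 0"
    using d' by (intro connected) auto
  then obtain x where x: "x = i \<or> x = j \<or> x = k" "c x l > 0"
    using distinct_four_exhaust[OF d] by auto
  show thesis
  proof (cases "c j l > 0")
    case True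
    have "c i l = 0"
      using triangle_free[of i j l] p(1) True d' by simp
    moreover have "c k l = 0"
      using triangle_free[of k j l] c_pos_sym[OF d'(4) p(2)] True d' by simp
    ultimately show ?thesis
      using star[OF d c_pos_sym[OF d'(1) p(1)] p(2) True p(3)] by blast
  next
    case False
    then have jl: "c j l = 0"
      using nn[OF d'(5)] by blast
    show ?thesis
    proof (cases "c k l > 0")
      case kl: True
      show ?thesis
      proof (cases "c i l > 0")
        case True
        then show ?thesis
          using cycle[OF d p(1,2) kl c_pos_sym[OF d'(3) True] p(3) jl] by blast
      next
        case False
        then have "c i l = 0"
          using nn[OF d'(3)] by blast
        then show ?thesis
          using path[OF d p(1,2) kl p(3) _ jl] by blast
      qed
    next
      case kl: False
      then have kl0: "c l k = 0"
        using nn[OF d'(6)] c_zero_sym[OF d'(6)] by auto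
      have il: "c i l > 0"
        using x kl False by auto
      have "distinct [l, i, j, k]"
        using d by auto
      moreover have "c l j = 0"
        using jl c_zero_sym[OF d'(5)] by simp
      ultimately show ?thesis
        using path[of l i j k] c_pos_sym[OF d'(3) il] p kl0 by blast
    qed
  qed
qed

text \<open>With weights \<open>y\<close> as below the sum of \<open>y m * (\<beta> m \<bullet> x)\<close> never decreases along a gallery
  towards \<open>- x\<close>, so it cannot become negative: the Coxeter diagram is not of indefinite or
  affine type.\<close>

lemma no_subharmonic_weights:
  assumes y: "\<And>m. y m > 0" and sub: "\<And>m. (\<Sum>n\<in>UNIV - {m}. c n m * y n) \<ge> 2 * y m"
  shows False
proof -
  define x where "x = (\<Sum>j\<in>UNIV. e j)"
  have bx: "b \<bullet> x = (\<Sum>j\<in>UNIV. b \<bullet> e j)" for b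
    by (simp add: x_def inner_sum_right)
  note gen = sum_rays_generic[folded x_def]
  define Q where "Q = (\<lambda>\<beta> f. irreducible_base A \<beta> f \<and> (\<forall>a b. a \<noteq> b \<longrightarrow> cr A (\<beta> a) (\<beta> b) = c a b) \<and>
      (\<Sum>m\<in>UNIV. y m * (\<beta> m \<bullet> x)) > 0)"
  have "\<exists>\<beta> f. base A \<beta> f \<and> Q \<beta> f \<and> (\<forall>i. \<beta> i \<bullet> x < 0)"
  proof (rule gallery[OF arr simplicial gen _ base])
    show "Q \<alpha> e"
      unfolding Q_def using irreducible_base_axioms y
      by (auto intro!: sum_pos mult_pos_pos simp: bx base_dual)
    fix \<beta> f m
    assume \<beta>: "base A \<beta> f" "Q \<beta> f" "\<beta> m \<bullet> x > 0"
    interpret B: irreducible_base A \<beta> f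
      using \<beta>(2) by (simp add: Q_def)
    have Bc: "B.c a b = c a b" if "a \<noteq> b" for a b
      using \<beta>(2) that by (simp add: Q_def)
    have sp: "sum h UNIV = h m + sum h (UNIV - {m})" for h :: "4 \<Rightarrow> real"
      by (rule sum.remove) auto
    \<comment> \<open>The summand of \<open>m\<close> changes sign and costs \<open>2 * y m\<close>,
      the others gain \<open>c n m * y n\<close>, each times the positive
      \<open>\<beta> m \<bullet> x\<close>.\<close>
    have "(\<Sum>n\<in>UNIV - {m}. y n * (cross A m \<beta> n \<bullet> x)) =
        (\<Sum>n\<in>UNIV - {m}. y n * (\<beta> n \<bullet> x) + c n m * y n * (\<beta> m \<bullet> x))"
      by (rule sum.cong) (auto simp: cross_def inner_add_left Bc algebra_simps)
    also have "\<dots> = (\<Sum>n\<in>UNIV - {m}. y n * (\<beta> n \<bullet> x)) + (\<Sum>n\<in>UNIV - {m}. c n m * y n) * (\<beta> m \<bullet> x)"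
      by (simp add: sum.distrib sum_distrib_right)
    finally have "(\<Sum>n\<in>UNIV. y n * (cross A m \<beta> n \<bullet> x)) =
        (\<Sum>n\<in>UNIV. y n * (\<beta> n \<bullet> x)) + ((\<Sum>n\<in>UNIV - {m}. c n m * y n) - 2 * y m) * (\<beta> m \<bullet> x)"
      by (simp add: sp cross_def algebra_simps)
    also have "\<dots> > 0"
      using \<beta>(2,3) sub[of m] by (intro add_pos_nonneg) (auto simp: Q_def)
    finally have "(\<Sum>n\<in>UNIV. y n * (cross A m \<beta> n \<bullet> x)) > 0" .
    then show "Q (cross A m \<beta>) (cross_dual A m \<beta> f)"
      using B.cross_irreducible_base B.cross_preserves_c Bc by (simp add: Q_def)
  qed
  then obtain \<beta> f where \<beta>: "Q \<beta> f" "\<forall>i. \<beta> i \<bullet> x < 0"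
    by blast
  have "(\<Sum>m\<in>UNIV. y m * (\<beta> m \<bullet> x)) \<le> 0"
    using y \<beta>(2) by (intro sum_nonpos) (auto simp: mult_nonneg_nonpos less_imp_le)
  with \<beta>(1) show False
    by (simp add: Q_def)
qed

text \<open>The product of the coefficients in one direction around the cycle is invariant under
  rescaling and may differ from 1. Its fourth root \<open>t\<close> is distributed evenly: at every
  node one neighbour contributes \<open>t\<close> times the weight of the node and the other
  \<open>1 / t\<close> times it, and \<open>t + 1 / t\<close> is at least 2.\<close>

lemma no_cycle:
  assumes d: "distinct [i, j, k, l]"
    and adj: "c i j > 0" "c j k > 0" "c k l > 0" "c l i > 0" "c i k = 0" "c j l = 0"
  shows False
proof -
  note d' = distinct_fourD[OF d]
  have adj': "c j i > 0" "c k j > 0" "c l k > 0" "c i l > 0" "c k i = 0" "c l j = 0"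
    using c_pos_sym[OF d'(1) adj(1)] c_pos_sym[OF d'(4) adj(2)] c_pos_sym[OF d'(6) adj(3)]
      c_pos_sym[OF d'(9) adj(4)] c_zero_sym[OF d'(2)] c_zero_sym[OF d'(5)] adj(5,6) by simp_all
  have pr: "c i j = 1 / c j i" "c j k = 1 / c k j" "c k l = 1 / c l k" "c l i = 1 / c i l"
    using edge_product[OF d'(1) adj(1)] edge_product[OF d'(4) adj(2)] edge_product[OF d'(6) adj(3)]
      edge_product[OF d'(9) adj(4)] adj' by (simp_all add: field_simps)
  define g where "g = c i l * c l k * c k j * c j i"
  define t where "t = sqrt (sqrt g)"
  have g: "g > 0"
    using adj' by (simp add: g_def)
  then have t: "t > 0"
    by (simp add: t_def)
  have "t ^ 4 = (t ^ 2) ^ 2"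
    by simp
  also have "\<dots> = g"
    using g by (simp add: t_def)
  finally have t4: "t * t * t * t = c i l * c l k * c k j * c j i"
    by (simp add: g_def power4_eq_xxxx)
  define yj where "yj = t / c j i"
  define yk where "yk = t * yj / c k j"
  define yl where "yl = t * yk / c l k"
  define y where "y m = (if m = i then 1 else if m = j then yj else if m = k then yk else yl)" for m
  have yv: "y i = 1" "y j = yj" "y k = yk" "y l = yl"
    using d' by (auto simp: y_def)
  have yp: "yj > 0" "yk > 0" "yl > 0"
    using t adj' by (auto simp: yj_def yk_def yl_def)
  have fw: "c j i * yj = t" "c k j * yk = t * yj" "c l k * yl = t * yk"
    using adj' by (auto simp: yj_def yk_def yl_def)
  have "t * yl * (c l k * c k j * c j i) = t * t * t * t"
    using adj' by (simp add: yl_def yk_def yj_def)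
  also have "\<dots> = c i l * (c l k * c k j * c j i)"
    using t4 by (simp add: mult.assoc)
  finally have fw4: "c i l = t * yl"
    using adj' by simp
  \<comment> \<open>Converts a forward relation into a backward one, since the two coefficients of
    an edge are inverse to each other.\<close>
  have bk: "z / q = w / t" if "q * w = t * z" "q > 0" for q w z
    using that t by (simp add: field_simps)
  have bw: "c i j = yj / t" "c j k * yj = yk / t" "c k l * yk = yl / t" "c l i * yl = 1 / t"
    using bk[of "c j i" yj 1] bk[of "c k j" yk yj] bk[of "c l k" yl yk] bk[of "c i l" 1 yl]
      pr fw fw4 adj' by simp_all
  have "0 \<le> (t - 1)\<^sup>2"
    by simp
  then have "2 * t \<le> t * t + 1"
    by (simp add: power2_eq_square algebra_simps)
  then have t2: "2 \<le> t + 1 / t"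
    using t by (simp add: field_simps)
  have t2': "2 * z \<le> t * z + z / t" if "z > 0" for z
    using mult_right_mono[OF t2, of z] that by (simp add: algebra_simps)
  show False
  proof (rule no_subharmonic_weights[of y])
    show "y m > 0" for m
      using yp by (simp add: y_def)
    fix m
    have "(\<Sum>n\<in>UNIV - {m}. c n m * y n) = (\<Sum>n\<in>UNIV. if n = m then 0 else c n m * y n)"
      by (rule sum.mono_neutral_cong_left) auto
    also have "\<dots> = (if i = m then 0 else c i m * y i) + (if j = m then 0 else c j m * y j) +
        (if k = m then 0 else c k m * y k) + (if l = m then 0 else c l m * y l)"
      by (rule sum_four[OF d])
    also have "\<dots> \<ge> 2 * y m"
    proof -
      consider "m = i" | "m = j" | "m = k" | "m = l"
        using distinct_four_exhaust[OF d] by blast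
      then show ?thesis
      proof cases
        case 1
        then show ?thesis
          using t2 by (simp add: d' yv adj adj' fw bw)
      next
        case 2
        then show ?thesis
          using t2'[OF yp(1)] by (simp add: d' yv adj adj' fw bw)
      next
        case 3
        then show ?thesis
          using t2'[OF yp(2)] by (simp add: d' yv adj adj' fw bw)
      next
        case 4
        then show ?thesis
          using t2'[OF yp(3)] by (simp add: d' yv adj adj' fw fw4 bw)
      qed
    qed
    finally show "2 * y m \<le> (\<Sum>n\<in>UNIV - {m}. c n m * y n)" .
  qed
qed

end

section \<open>The hyperplanes of the two trees\<close>

lemma base_scale:
  assumes base: "base A \<alpha> e" and s: "\<And>i. s i > 0"
  shows "base A (\<lambda>i. s i *\<^sub>R \<alpha> i) (\<lambda>i. (1 / s i) *\<^sub>R e i)"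
  unfolding base_def
proof (intro conjI allI ballI)
  show "s i *\<^sub>R \<alpha> i \<in> roots A" for i
    using base s[of i] by (intro roots_scale) (auto simp: base_def)
  show "s i *\<^sub>R \<alpha> i \<bullet> (1 / s j) *\<^sub>R e j = (if i = j then 1 else 0)" for i j
    using base s[of i] by (auto simp: base_def)
  fix b
  assume "b \<in> roots A"
  then have "(\<forall>i. b \<bullet> e i \<ge> 0) \<or> (\<forall>i. b \<bullet> e i \<le> 0)"
    using base by (simp add: base_def)
  moreover have "b \<bullet> (1 / s i) *\<^sub>R e i \<ge> 0 \<longleftrightarrow> b \<bullet> e i \<ge> 0" "b \<bullet> (1 / s i) *\<^sub>R e i \<le> 0 \<longleftrightarrow> b \<bullet> e i \<le> 0" for i
    using s[of i] by (auto simp: zero_le_divide_iff divide_le_0_iff)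
  ultimately show "(\<forall>i. b \<bullet> (1 / s i) *\<^sub>R e i \<ge> 0) \<or> (\<forall>i. b \<bullet> (1 / s i) *\<^sub>R e i \<le> 0)"
    by simp
qed

lemma (in simplicial_base) cr_scale:
  assumes s: "\<And>i. s i > 0" and "x \<noteq> y"
  shows "cr A (s x *\<^sub>R \<alpha> x) (s y *\<^sub>R \<alpha> y) = c x y * s x / s y"
proof -
  interpret B: simplicial_base A "\<lambda>i. s i *\<^sub>R \<alpha> i" "\<lambda>i. (1 / s i) *\<^sub>R e i"
    by unfold_locales (rule arr simplicial base_scale[OF base s])+
  have yx: "y \<noteq> x"
    using assms by simp
  show ?thesis
  proof (rule B.cr_eqI[OF yx])
    have "s x *\<^sub>R (\<alpha> x + c x y *\<^sub>R \<alpha> y) \<in> roots A"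
      by (rule roots_scale[OF cr_root[OF yx]]) (use s[of x] in simp)
    moreover have "s x *\<^sub>R \<alpha> x + (c x y * s x / s y) *\<^sub>R s y *\<^sub>R \<alpha> y = s x *\<^sub>R (\<alpha> x + c x y *\<^sub>R \<alpha> y)"
      using s[of y] by (simp add: scaleR_add_right mult.commute)
    ultimately show "s x *\<^sub>R \<alpha> x + (c x y * s x / s y) *\<^sub>R s y *\<^sub>R \<alpha> y \<in> roots A"
      by (simp only:)
    fix t
    assume t: "s x *\<^sub>R \<alpha> x + t *\<^sub>R s y *\<^sub>R \<alpha> y \<in> roots A"
    have "(1 / s x) *\<^sub>R (s x *\<^sub>R \<alpha> x + t *\<^sub>R s y *\<^sub>R \<alpha> y) \<in> roots A"
      by (rule roots_scale[OF t]) (use s[of x] in simp)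
    moreover have "(1 / s x) *\<^sub>R (s x *\<^sub>R \<alpha> x + t *\<^sub>R s y *\<^sub>R \<alpha> y) = \<alpha> x + (t * s y / s x) *\<^sub>R \<alpha> y"
      using s[of x] by (simp add: scaleR_add_right)
    ultimately have "\<alpha> x + (t * s y / s x) *\<^sub>R \<alpha> y \<in> roots A"
      by (simp only:)
    then have "t * s y / s x \<le> c x y"
      by (rule cr_max[OF yx])
    then show "t \<le> c x y * s x / s y"
      using s[of x] s[of y] by (simp add: field_simps)
  qed
qed

lemma (in irreducible_base) rescale:
  assumes s: "\<And>i. s i > 0"
  shows "irreducible_base A (\<lambda>i. s i *\<^sub>R \<alpha> i) (\<lambda>i. (1 / s i) *\<^sub>R e i)"
  by unfold_locales (rule arr simplicial light irreducible base_scale[OF base s])+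

text \<open>\<open>chain A g i j k l a\<^sub>1 a\<^sub>2 a\<^sub>3 a\<^sub>4\<close>: the vectors \<open>a\<^sub>1, \<dots>, a\<^sub>4\<close> are the wall normals of some
  chamber, normalised such that crossing a wall acts on them by the matrix \<open>g\<close>.\<close>

definition chain ::
  "vec4 set set \<Rightarrow> (4 \<Rightarrow> 4 \<Rightarrow> real) \<Rightarrow> 4 \<Rightarrow> 4 \<Rightarrow> 4 \<Rightarrow> 4 \<Rightarrow> vec4 \<Rightarrow> vec4 \<Rightarrow> vec4 \<Rightarrow> vec4 \<Rightarrow> bool" where
  "chain A g i j k l a1 a2 a3 a4 \<longleftrightarrow> (\<exists>\<beta> f. irreducible_base A \<beta> f \<and>
     (\<forall>x y. x \<noteq> y \<longrightarrow> cr A (\<beta> x) (\<beta> y) = g x y) \<and> \<beta> i = a1 \<and> \<beta> j = a2 \<and> \<beta> k = a3 \<and> \<beta> l = a4)"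

definition cone4 :: "vec4 \<Rightarrow> vec4 \<Rightarrow> vec4 \<Rightarrow> vec4 \<Rightarrow> vec4 set" where
  "cone4 a1 a2 a3 a4 = {w1 *\<^sub>R a1 + w2 *\<^sub>R a2 + w3 *\<^sub>R a3 + w4 *\<^sub>R a4 | w1 w2 w3 w4.
     w1 \<ge> 0 \<and> w2 \<ge> 0 \<and> w3 \<ge> 0 \<and> w4 \<ge> 0}"

lemma (in simplicial_base) cone4_iff:
  assumes d: "distinct [i, j, k, l]"
  shows "b \<in> cone4 (\<alpha> i) (\<alpha> j) (\<alpha> k) (\<alpha> l) \<longleftrightarrow> (\<forall>x. b \<bullet> e x \<ge> 0)"
proof
  assume "b \<in> cone4 (\<alpha> i) (\<alpha> j) (\<alpha> k) (\<alpha> l)"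
  then obtain w1 w2 w3 w4 where b: "b = w1 *\<^sub>R \<alpha> i + w2 *\<^sub>R \<alpha> j + w3 *\<^sub>R \<alpha> k + w4 *\<^sub>R \<alpha> l"
    and w: "w1 \<ge> 0" "w2 \<ge> 0" "w3 \<ge> 0" "w4 \<ge> 0"
    unfolding cone4_def by blast
  show "\<forall>x. b \<bullet> e x \<ge> 0"
    using w by (auto simp: b inner_add_left base_dual)
next
  assume n: "\<forall>x. b \<bullet> e x \<ge> 0"
  have "b = (b \<bullet> e i) *\<^sub>R \<alpha> i + (b \<bullet> e j) *\<^sub>R \<alpha> j + (b \<bullet> e k) *\<^sub>R \<alpha> k + (b \<bullet> e l) *\<^sub>R \<alpha> l"
    using base_expand[of b] sum_four[OF d, of "\<lambda>i. (b \<bullet> e i) *\<^sub>R \<alpha> i"] by simp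
  then show "b \<in> cone4 (\<alpha> i) (\<alpha> j) (\<alpha> k) (\<alpha> l)"
    unfolding cone4_def using n by blast
qed

text \<open>The set \<open>W\<close> collects the normals of the walls crossed so far. Every root of \<open>K\<close> that is not
  parallel to one of them is still positive.\<close>

definition walk :: "vec4 set set \<Rightarrow> (4 \<Rightarrow> 4 \<Rightarrow> real) \<Rightarrow> 4 \<Rightarrow> 4 \<Rightarrow> 4 \<Rightarrow> 4 \<Rightarrow> vec4 set \<Rightarrow> vec4 set \<Rightarrow>
    vec4 \<Rightarrow> vec4 \<Rightarrow> vec4 \<Rightarrow> vec4 \<Rightarrow> bool" where
  "walk A g i j k l K W a1 a2 a3 a4 \<longleftrightarrow> chain A g i j k l a1 a2 a3 a4 \<and> W \<subseteq> roots A \<and>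
     (\<forall>b\<in>roots A \<inter> K. hyp b \<in> hyp ` W \<or> b \<in> cone4 a1 a2 a3 a4)"

text \<open>Roots that were positive and are not parallel to the crossed normal stay positive by
  \<open>cross_dual_nonneg\<close>. The new normals enter through equations, so that each concrete
  step is a simplification of vectors.\<close>

lemma walk_step:
  assumes d: "distinct [i, j, k, l]" and walk: "walk A g i j k l K W a1 a2 a3 a4"
    and m: "m \<in> {i, j, k, l}"
    and a: "a = (if m = i then a1 else if m = j then a2 else if m = k then a3 else a4)"
    and p: "p = (if m = i then - a1 else a1 + g i m *\<^sub>R a)"
    and q: "q = (if m = j then - a2 else a2 + g j m *\<^sub>R a)"
    and r: "r = (if m = k then - a3 else a3 + g k m *\<^sub>R a)"
    and s: "s = (if m = l then - a4 else a4 + g l m *\<^sub>R a)"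
  shows "walk A g i j k l K (insert a W) p q r s"
proof -
  have ch: "chain A g i j k l a1 a2 a3 a4"
    using walk by (simp add: walk_def)
  obtain \<beta> f where B: "irreducible_base A \<beta> f" and g: "\<And>x y. x \<noteq> y \<Longrightarrow> cr A (\<beta> x) (\<beta> y) = g x y"
    and \<beta>: "\<beta> i = a1" "\<beta> j = a2" "\<beta> k = a3" "\<beta> l = a4"
    using ch unfolding chain_def by blast
  interpret B: irreducible_base A \<beta> f
    by (rule B)
  interpret X: irreducible_base A "cross A m \<beta>" "cross_dual A m \<beta> f"
    by (rule B.cross_irreducible_base)
  have am: "\<beta> m = a"
    using m d \<beta> by (auto simp: a)
  have cr: "cross A m \<beta> i = p" "cross A m \<beta> j = q" "cross A m \<beta> k = r" "cross A m \<beta> l = s"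
    using \<beta> g am by (auto simp: cross_def p q r s)
  have "chain A g i j k l p q r s"
    unfolding chain_def using X.irreducible_base_axioms B.cross_preserves_c g cr
    by (intro exI[of _ "cross A m \<beta>"] exI[of _ "cross_dual A m \<beta> f"]) simp
  moreover have "a \<in> roots A"
    using B.base_root[of m] am by simp
  moreover have "hyp b = hyp a \<or> b \<in> cone4 p q r s" if b: "b \<in> roots A" "b \<in> cone4 a1 a2 a3 a4" for b
  proof (cases "\<forall>x. x \<noteq> m \<longrightarrow> b \<bullet> f x = 0")
    case True
    then have eq: "b = (b \<bullet> f m) *\<^sub>R a"
      using B.base_parallelI[of m b] am by simp
    then have "b \<bullet> f m \<noteq> 0"
      using roots_nonzero[OF b(1)] by auto
    then show ?thesis
      using hyp_scale[of "b \<bullet> f m" a] eq by simp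
  next
    case False
    have nn: "\<forall>x. b \<bullet> f x \<ge> 0"
      using b(2) B.cone4_iff[OF d, of b] \<beta> by simp
    with False obtain x where "x \<noteq> m" "b \<bullet> f x > 0"
      by (metis order_less_le)
    then have "b \<bullet> cross_dual A m \<beta> f m \<ge> 0"
      by (rule B.cross_dual_nonneg[OF b(1)])
    then have "b \<bullet> cross_dual A m \<beta> f y \<ge> 0" for y
      using nn by (cases "y = m") (auto simp: B.cross_dual_simps(2))
    then show ?thesis
      using X.cone4_iff[OF d, of b] cr by simp
  qed
  ultimately show ?thesis
    using walk unfolding walk_def by blast
qed

lemma chain_sign:
  assumes d: "distinct [i, j, k, l]" and ch: "chain A g i j k l a1 a2 a3 a4" and b: "b \<in> roots A"
  shows "b \<in> cone4 a1 a2 a3 a4 \<or> - b \<in> cone4 a1 a2 a3 a4"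
    and "\<not> (b \<in> cone4 a1 a2 a3 a4 \<and> - b \<in> cone4 a1 a2 a3 a4)"
proof -
  obtain \<beta> f where B: "irreducible_base A \<beta> f"
    and \<beta>: "\<beta> i = a1" "\<beta> j = a2" "\<beta> k = a3" "\<beta> l = a4"
    using ch unfolding chain_def by blast
  interpret B: irreducible_base A \<beta> f
    by (rule B)
  have iff: "x \<in> cone4 a1 a2 a3 a4 \<longleftrightarrow> (\<forall>y. x \<bullet> f y \<ge> 0)" for x
    using B.cone4_iff[OF d, of x] \<beta> by simp
  show "b \<in> cone4 a1 a2 a3 a4 \<or> - b \<in> cone4 a1 a2 a3 a4"
    using B.base_sign[OF b] by (auto simp: iff)
  show "\<not> (b \<in> cone4 a1 a2 a3 a4 \<and> - b \<in> cone4 a1 a2 a3 a4)"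
  proof
    assume "b \<in> cone4 a1 a2 a3 a4 \<and> - b \<in> cone4 a1 a2 a3 a4"
    then have "b \<bullet> f y = 0 \<bullet> f y" for y
      by (auto simp: iff intro!: order_antisym)
    then have "b = 0"
      by (rule B.base_eqI)
    then show False
      using roots_nonzero[OF b] by simp
  qed
qed

lemma chain_independent:
  assumes d: "distinct [i, j, k, l]" and ch: "chain A g i j k l a1 a2 a3 a4"
    and y: "a1 \<bullet> y = 0" "a2 \<bullet> y = 0" "a3 \<bullet> y = 0" "a4 \<bullet> y = 0"
  shows "y = 0"
proof -
  obtain \<beta> f where B: "irreducible_base A \<beta> f"
    and \<beta>: "\<beta> i = a1" "\<beta> j = a2" "\<beta> k = a3" "\<beta> l = a4"
    using ch unfolding chain_def by blast
  interpret B: irreducible_base A \<beta> f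
    by (rule B)
  show ?thesis
    using B.base_expand_dual[of y] sum_four[OF d, of "\<lambda>i. (\<beta> i \<bullet> y) *\<^sub>R f i"] y \<beta> by simp
qed

lemma cone4_uminus: "b \<in> cone4 (- a1) (- a2) (- a3) (- a4) \<Longrightarrow> - b \<in> cone4 a1 a2 a3 a4"
proof -
  assume "b \<in> cone4 (- a1) (- a2) (- a3) (- a4)"
  then obtain w1 w2 w3 w4 where "b = w1 *\<^sub>R (- a1) + w2 *\<^sub>R (- a2) + w3 *\<^sub>R (- a3) + w4 *\<^sub>R (- a4)"
    and w: "w1 \<ge> 0" "w2 \<ge> 0" "w3 \<ge> 0" "w4 \<ge> 0"
    unfolding cone4_def by blast
  then have "- b = w1 *\<^sub>R a1 + w2 *\<^sub>R a2 + w3 *\<^sub>R a3 + w4 *\<^sub>R a4"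
    by simp
  with w show ?thesis
    unfolding cone4_def by blast
qed

lemma cone4_rev: "b \<in> cone4 a1 a2 a3 a4 \<Longrightarrow> b \<in> cone4 a4 a3 a2 a1"
proof -
  assume "b \<in> cone4 a1 a2 a3 a4"
  then obtain w1 w2 w3 w4 where "b = w1 *\<^sub>R a1 + w2 *\<^sub>R a2 + w3 *\<^sub>R a3 + w4 *\<^sub>R a4"
    and w: "w1 \<ge> 0" "w2 \<ge> 0" "w3 \<ge> 0" "w4 \<ge> 0"
    unfolding cone4_def by blast
  then have "b = w4 *\<^sub>R a4 + w3 *\<^sub>R a3 + w2 *\<^sub>R a2 + w1 *\<^sub>R a1"
    by simp
  with w show ?thesis
    unfolding cone4_def by blast
qed

text \<open>A root positive at the start cannot be positive at the opposite chamber, so its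
  hyperplane was crossed; and each hyperplane has a normal that is positive at the start.\<close>

lemma walk_to_opposite:
  assumes arr: "arrangement A" and d: "distinct [i, j, k, l]" and ch: "chain A g i j k l a1 a2 a3 a4"
    and walk: "walk A g i j k l (cone4 a1 a2 a3 a4) W p q r s"
    and opp: "\<And>b. b \<in> cone4 p q r s \<Longrightarrow> - b \<in> cone4 a1 a2 a3 a4"
  shows "A = hyp ` W"
proof
  show "hyp ` W \<subseteq> A"
    using walk by (auto simp: walk_def roots_def)
  have pos: "hyp b \<in> hyp ` W" if "b \<in> roots A" "b \<in> cone4 a1 a2 a3 a4" for b
    using walk that opp[of b] chain_sign(2)[OF d ch that(1)] unfolding walk_def by blast
  show "A \<subseteq> hyp ` W"
  proof
    fix H
    assume "H \<in> A"
    then obtain b where b: "b \<in> roots A" "H = hyp b"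
      using arrangement_hypE[OF arr] by blast
    show "H \<in> hyp ` W"
      using chain_sign(1)[OF d ch b(1)] pos[OF b(1)] pos[OF roots_minus[OF b(1)]] b(2)
      by (auto simp: hyp_minus)
  qed
qed

text \<open>One walks to the opposite chamber along a reduced word of the longest element of the Weyl
  group of type $A_4$ and $D_4$, respectively; each hyperplane has to be crossed on the way.\<close>

lemma path_hyperplanes:
  assumes arr: "arrangement A" and dist: "distinct [i, j, k, l]" and ch: "chain A g i j k l a b c d"
    and G: "g i j = 1" "g i k = 0" "g i l = 0" "g j i = 1" "g j k = 1" "g j l = 0"
      "g k i = 0" "g k j = 1" "g k l = 1" "g l i = 0" "g l j = 0" "g l k = 1"
  shows "A = hyp ` {d, c + d, b + c + d, a + b + c + d,
    c, b + c, a + b + c, b, a + b, a}"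
proof -
  let ?K = "cone4 a b c d"
  have "i \<noteq> j" "i \<noteq> k" "i \<noteq> l" "j \<noteq> k" "j \<noteq> l" "k \<noteq> l"
    using dist by auto
  note ev = this this[symmetric] G scaleR_2 algebra_simps
  \<comment> \<open>The word is \<open>i\<close>, \<open>j i\<close>, \<open>k j i\<close>,
    \<open>l k j i\<close>: each block completes the passage to the opposite for one more node of
    the path.\<close>
  define W0 where "W0 = ({} :: vec4 set)"
  have S0: "walk A g i j k l ?K W0 a b c d"
    using ch by (simp add: walk_def W0_def)
  define W1 where "W1 = insert a W0"
  have S1: "walk A g i j k l ?K W1 (- a) (a + b) c d"
    unfolding W1_def by (rule walk_step[OF dist S0, of i]) (simp_all add: ev)
  define W2 where "W2 = insert (a + b) W1"
  have S2: "walk A g i j k l ?K W2 b (- (a + b)) (a + b + c) d"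
    unfolding W2_def by (rule walk_step[OF dist S1, of j]) (simp_all add: ev)
  define W3 where "W3 = insert b W2"
  have S3: "walk A g i j k l ?K W3 (- b) (- a) (a + b + c) d"
    unfolding W3_def by (rule walk_step[OF dist S2, of i]) (simp_all add: ev)
  define W4 where "W4 = insert (a + b + c) W3"
  have S4: "walk A g i j k l ?K W4 (- b) (b + c) (- (a + b + c)) (a + b + c + d)"
    unfolding W4_def by (rule walk_step[OF dist S3, of k]) (simp_all add: ev)
  define W5 where "W5 = insert (b + c) W4"
  have S5: "walk A g i j k l ?K W5 c (- (b + c)) (- a) (a + b + c + d)"
    unfolding W5_def by (rule walk_step[OF dist S4, of j]) (simp_all add: ev)
  define W6 where "W6 = insert c W5"
  have S6: "walk A g i j k l ?K W6 (- c) (- b) (- a) (a + b + c + d)"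
    unfolding W6_def by (rule walk_step[OF dist S5, of i]) (simp_all add: ev)
  define W7 where "W7 = insert (a + b + c + d) W6"
  have S7: "walk A g i j k l ?K W7 (- c) (- b) (b + c + d) (- (a + b + c + d))"
    unfolding W7_def by (rule walk_step[OF dist S6, of l]) (simp_all add: ev)
  define W8 where "W8 = insert (b + c + d) W7"
  have S8: "walk A g i j k l ?K W8 (- c) (c + d) (- (b + c + d)) (- a)"
    unfolding W8_def by (rule walk_step[OF dist S7, of k]) (simp_all add: ev)
  define W9 where "W9 = insert (c + d) W8"
  have S9: "walk A g i j k l ?K W9 d (- (c + d)) (- b) (- a)"
    unfolding W9_def by (rule walk_step[OF dist S8, of j]) (simp_all add: ev)
  define W10 where "W10 = insert d W9"
  have S10: "walk A g i j k l ?K W10 (- d) (- c) (- b) (- a)"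
    unfolding W10_def by (rule walk_step[OF dist S9, of i]) (simp_all add: ev)
  \<comment> \<open>In type $A_4$ the longest element reverses the diagram, so the final normals
    appear in reverse order, which the cone ignores.\<close>
  have "A = hyp ` W10"
    by (rule walk_to_opposite[OF arr dist ch S10]) (rule cone4_rev[OF cone4_uminus])
  then show ?thesis
    unfolding W10_def W9_def W8_def W7_def W6_def W5_def W4_def W3_def W2_def W1_def W0_def .
qed

lemma star_hyperplanes:
  assumes arr: "arrangement A" and dist: "distinct [i, j, k, l]" and ch: "chain A g i j k l a b c d"
    and G: "g i j = 1" "g i k = 0" "g i l = 0" "g j i = 1" "g j k = 1" "g j l = 1"
      "g k i = 0" "g k j = 1" "g k l = 0" "g l i = 0" "g l j = 1" "g l k = 0"
  shows "A = hyp ` {d, c, a, a + b + c + d,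
    a + b + c, a + b + d, b + c + d, a + 2 *\<^sub>R b + c + d, b + d, b + c, a + b, b}"
proof -
  let ?K = "cone4 a b c d"
  have "i \<noteq> j" "i \<noteq> k" "i \<noteq> l" "j \<noteq> k" "j \<noteq> l" "k \<noteq> l"
    using dist by auto
  note ev = this this[symmetric] G scaleR_2 algebra_simps
  \<comment> \<open>The word is \<open>j i k l\<close> repeated three times: a Coxeter element of
    $D_4$ has order 6, and its third power is the longest element.\<close>
  define W0 where "W0 = ({} :: vec4 set)"
  have S0: "walk A g i j k l ?K W0 a b c d"
    using ch by (simp add: walk_def W0_def)
  define W1 where "W1 = insert b W0"
  have S1: "walk A g i j k l ?K W1 (a + b) (- b) (b + c) (b + d)"
    unfolding W1_def by (rule walk_step[OF dist S0, of j]) (simp_all add: ev)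
  define W2 where "W2 = insert (a + b) W1"
  have S2: "walk A g i j k l ?K W2 (- (a + b)) a (b + c) (b + d)"
    unfolding W2_def by (rule walk_step[OF dist S1, of i]) (simp_all add: ev)
  define W3 where "W3 = insert (b + c) W2"
  have S3: "walk A g i j k l ?K W3 (- (a + b)) (a + b + c) (- (b + c)) (b + d)"
    unfolding W3_def by (rule walk_step[OF dist S2, of k]) (simp_all add: ev)
  define W4 where "W4 = insert (b + d) W3"
  have S4: "walk A g i j k l ?K W4 (- (a + b)) (a + 2 *\<^sub>R b + c + d) (- (b + c)) (- (b + d))"
    unfolding W4_def by (rule walk_step[OF dist S3, of l]) (simp_all add: ev)
  define W5 where "W5 = insert (a + 2 *\<^sub>R b + c + d) W4"
  have S5: "walk A g i j k l ?K W5 (b + c + d) (- (a + 2 *\<^sub>R b + c + d)) (a + b + d) (a + b + c)"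
    unfolding W5_def by (rule walk_step[OF dist S4, of j]) (simp_all add: ev)
  define W6 where "W6 = insert (b + c + d) W5"
  have S6: "walk A g i j k l ?K W6 (- (b + c + d)) (- (a + b)) (a + b + d) (a + b + c)"
    unfolding W6_def by (rule walk_step[OF dist S5, of i]) (simp_all add: ev)
  define W7 where "W7 = insert (a + b + d) W6"
  have S7: "walk A g i j k l ?K W7 (- (b + c + d)) d (- (a + b + d)) (a + b + c)"
    unfolding W7_def by (rule walk_step[OF dist S6, of k]) (simp_all add: ev)
  define W8 where "W8 = insert (a + b + c) W7"
  have S8: "walk A g i j k l ?K W8 (- (b + c + d)) (a + b + c + d) (- (a + b + d)) (- (a + b + c))"
    unfolding W8_def by (rule walk_step[OF dist S7, of l]) (simp_all add: ev)
  define W9 where "W9 = insert (a + b + c + d) W8"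
  have S9: "walk A g i j k l ?K W9 a (- (a + b + c + d)) c d"
    unfolding W9_def by (rule walk_step[OF dist S8, of j]) (simp_all add: ev)
  define W10 where "W10 = insert a W9"
  have S10: "walk A g i j k l ?K W10 (- a) (- (b + c + d)) c d"
    unfolding W10_def by (rule walk_step[OF dist S9, of i]) (simp_all add: ev)
  define W11 where "W11 = insert c W10"
  have S11: "walk A g i j k l ?K W11 (- a) (- (b + d)) (- c) d"
    unfolding W11_def by (rule walk_step[OF dist S10, of k]) (simp_all add: ev)
  define W12 where "W12 = insert d W11"
  have S12: "walk A g i j k l ?K W12 (- a) (- b) (- c) (- d)"
    unfolding W12_def by (rule walk_step[OF dist S11, of l]) (simp_all add: ev)
  have "A = hyp ` W12"
    by (rule walk_to_opposite[OF arr dist ch S12]) (rule cone4_uminus)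
  then show ?thesis
    unfolding W12_def W11_def W10_def W9_def W8_def W7_def W6_def W5_def W4_def W3_def W2_def W1_def W0_def .
qed

section \<open>From the diagrams to explicit root lists\<close>

lemma four_distinct: "distinct [1, 2, 3, 4 :: 4]"
  by simp

text \<open>The positive roots of type $A_4$ with simple roots \<open>a\<close>, \<open>b\<close>,
  \<open>c\<close>, \<open>d\<close> in this order along the path.\<close>

definition path_roots :: "vec4 \<Rightarrow> vec4 \<Rightarrow> vec4 \<Rightarrow> vec4 \<Rightarrow> vec4 set" where
  "path_roots a b c d = {d, c + d, b + c + d, a + b + c + d, c, b + c, a + b + c, b, a + b, a}"

text \<open>The positive roots of type $D_4$ with \<open>b\<close> as central node; the one with
  coefficient 2 is the highest root.\<close>

definition star_roots :: "vec4 \<Rightarrow> vec4 \<Rightarrow> vec4 \<Rightarrow> vec4 \<Rightarrow> vec4 set" where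
  "star_roots a b c d = {d, c, a, a + b + c + d, a + b + c, a + b + d, b + c + d,
     a + 2 *\<^sub>R b + c + d, b + d, b + c, a + b, b}"

definition independent4 :: "vec4 \<Rightarrow> vec4 \<Rightarrow> vec4 \<Rightarrow> vec4 \<Rightarrow> bool" where
  "independent4 a b c d \<longleftrightarrow> (\<forall>y. a \<bullet> y = 0 \<longrightarrow> b \<bullet> y = 0 \<longrightarrow> c \<bullet> y = 0 \<longrightarrow> d \<bullet> y = 0 \<longrightarrow> y = 0)"

text \<open>All nonzero coefficients become 1 if \<open>s y = c x y * s x\<close> along the edges.
  On a tree this is solved outwards from one node, and the edge products make both directions
  agree.\<close>

lemma (in irreducible_base) classification:
  "\<exists>a b c d. independent4 a b c d \<and> (A = hyp ` path_roots a b c d \<or> A = hyp ` star_roots a b c d)"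
proof -
  have main: "\<exists>a b c d. independent4 a b c d \<and>
      (A = hyp ` path_roots a b c d \<or> A = hyp ` star_roots a b c d)"
    if d: "distinct [i, j, k, l]"
      and s: "\<And>x. s x > 0"
      and g: "\<And>x y. x \<noteq> y \<Longrightarrow> c x y * s x / s y = g x y"
      and G: "g i j = 1" "g j i = 1" "g j k = 1" "g k j = 1" "g i k = 0" "g k i = 0" "g i l = 0" "g l i = 0"
        "(g k l = 1 \<and> g l k = 1 \<and> g j l = 0 \<and> g l j = 0) \<or> (g k l = 0 \<and> g l k = 0 \<and> g j l = 1 \<and> g l j = 1)"
    for i j k l s g
  proof -
    have ch: "chain A g i j k l (s i *\<^sub>R \<alpha> i) (s j *\<^sub>R \<alpha> j) (s k *\<^sub>R \<alpha> k) (s l *\<^sub>R \<alpha> l)"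
      unfolding chain_def
    proof (intro exI conjI)
      show "irreducible_base A (\<lambda>i. s i *\<^sub>R \<alpha> i) (\<lambda>i. (1 / s i) *\<^sub>R e i)"
        by (rule rescale[OF s])
      show "\<forall>x y. x \<noteq> y \<longrightarrow> cr A (s x *\<^sub>R \<alpha> x) (s y *\<^sub>R \<alpha> y) = g x y"
        using cr_scale[of s, OF s] g by simp
    qed (rule refl)+
    have "independent4 (s i *\<^sub>R \<alpha> i) (s j *\<^sub>R \<alpha> j) (s k *\<^sub>R \<alpha> k) (s l *\<^sub>R \<alpha> l)"
      unfolding independent4_def using chain_independent[OF d ch] by blast
    moreover have "A = hyp ` path_roots (s i *\<^sub>R \<alpha> i) (s j *\<^sub>R \<alpha> j) (s k *\<^sub>R \<alpha> k) (s l *\<^sub>R \<alpha> l) \<or>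
        A = hyp ` star_roots (s i *\<^sub>R \<alpha> i) (s j *\<^sub>R \<alpha> j) (s k *\<^sub>R \<alpha> k) (s l *\<^sub>R \<alpha> l)"
      using G(9)
    proof
      assume "g k l = 1 \<and> g l k = 1 \<and> g j l = 0 \<and> g l j = 0"
      then show ?thesis
        unfolding path_roots_def
        by (intro disjI1 path_hyperplanes[OF arr d ch]) (simp_all only: G)
    next
      assume "g k l = 0 \<and> g l k = 0 \<and> g j l = 1 \<and> g l j = 1"
      then show ?thesis
        unfolding star_roots_def
        by (intro disjI2 star_hyperplanes[OF arr d ch]) (simp_all only: G)
    qed
    ultimately show ?thesis by blast
  qed
  show ?thesis
  proof (cases rule: shape_cases)
    case (path i j k l)
    note d' = distinct_fourD[OF path(1)]
    have z: "c k i = 0" "c l i = 0" "c l j = 0"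
      using c_zero_sym[OF d'(2)] c_zero_sym[OF d'(3)] c_zero_sym[OF d'(5)] path by simp_all
    have e: "c j i * c i j = 1" "c k j * c j k = 1" "c l k * c k l = 1"
      using edge_product[OF d'(1) path(2)] edge_product[OF d'(4) path(3)] edge_product[OF d'(6) path(4)]
      by (simp_all add: mult.commute)
    define s where "s x = (if x = i then 1 else if x = j then c i j else if x = k then c i j * c j k
      else c i j * c j k * c k l)" for x
    have sv: "s i = 1" "s j = c i j" "s k = c i j * c j k" "s l = c i j * c j k * c k l"
      using d' by (simp_all add: s_def)
    show ?thesis
    proof (rule main[OF path(1), of s "\<lambda>x y. c x y * s x / s y"])
      show "s x > 0" for x
        using path by (simp add: s_def)
    qed (use path z e in \<open>simp_all add: sv\<close>)
  next
    case (star i j k l)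
    note d' = distinct_fourD[OF star(1)]
    have z: "c k i = 0" "c l i = 0" "c l k = 0"
      using c_zero_sym[OF d'(2)] c_zero_sym[OF d'(3)] c_zero_sym[OF d'(6)] star by simp_all
    have e: "c i j * c j i = 1" "c k j * c j k = 1" "c l j * c j l = 1"
      using edge_product[OF d'(7) star(2)] edge_product[OF d'(4) star(3)] edge_product[OF d'(5) star(4)]
      by (simp_all add: mult.commute)
    define s where "s x = (if x = i then c j i else if x = j then 1 else if x = k then c j k
      else c j l)" for x
    have sv: "s i = c j i" "s j = 1" "s k = c j k" "s l = c j l"
      using d' by (simp_all add: s_def)
    show ?thesis
    proof (rule main[OF star(1), of s "\<lambda>x y. c x y * s x / s y"])
      show "s x > 0" for x
        using star by (simp add: s_def)
    qed (use star z e in \<open>simp_all add: sv\<close>)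
  next
    case (cycle i j k l)
    then show ?thesis
      using no_cycle by blast
  qed
qed

theorem irreducible_simplicial_classification:
  assumes arr: "arrangement A" and simp: "simplicial A" and irr: "\<not> reducible A"
    and light: "max_vertex_weight A \<le> 6"
  shows "\<exists>a b c d. independent4 a b c d \<and> (A = hyp ` path_roots a b c d \<or> A = hyp ` star_roots a b c d)"
proof -
  define n where "n H = (SOME a. a \<in> roots A \<and> hyp a = H)" for H
  have n: "n H \<in> roots A \<and> hyp (n H) = H" if H: "H \<in> A" for H
  proof -
    obtain a where "a \<in> roots A" "H = hyp a"
      using arrangement_hypE[OF arr H] .
    then have "\<exists>a. a \<in> roots A \<and> hyp a = H"
      by blast
    then show ?thesis
      unfolding n_def by (rule someI_ex)
  qed
  have fin: "finite (n ` A)"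
    using arr by (simp add: arrangement_def)
  have n0: "0 \<notin> n ` A"
  proof
    assume "0 \<in> n ` A"
    then obtain H where "H \<in> A" "n H = 0"
      by (metis imageE)
    then show False
      using n[of H] roots_nonzero[of 0 A] by simp
  qed
  from avoid_hyperplanes[OF fin n0 open_UNIV UNIV_not_empty] obtain x
    where x: "\<forall>a\<in>n ` A. a \<bullet> x \<noteq> 0"
    by (rule bexE)
  have gen: "a \<bullet> x \<noteq> 0" if a: "a \<in> roots A" for a
  proof -
    have H: "hyp a \<in> A"
      using a by (simp add: roots_def)
    define m where "m = n (hyp a)"
    have m: "hyp m = hyp a" "m \<noteq> 0" "m \<bullet> x \<noteq> 0"
      using n[OF H] roots_nonzero[of m A] bspec[OF x imageI[OF H]] by (simp_all add: m_def)
    obtain s where "s \<noteq> 0" "a = s *\<^sub>R m"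
      using hyp_eqD[OF m(1,2) roots_nonzero[OF a]] .
    with m(3) show ?thesis
      by simp
  qed
  obtain \<alpha> e where b: "base A \<alpha> e"
    using chamber_base[OF arr simp gen] by blast
  interpret irreducible_base A \<alpha> e
    by unfold_locales (rule arr simp b light irr)+
  show ?thesis
    by (rule classification)
qed

section \<open>Transport along linear isomorphisms\<close>

locale linear_iso =
  fixes T :: "vec4 \<Rightarrow> vec4"
  assumes lin: "linear T" and inj: "inj T"
begin

lemma surj: "surj T"
  by (rule linear_injective_imp_surjective[OF lin inj]) simp

lemma T_eq_iff: "T x = T y \<longleftrightarrow> x = y"
  using inj by (auto dest: injD)

lemma T_0: "T x = 0 \<longleftrightarrow> x = 0"
  using T_eq_iff[of x 0] linear_0[OF lin] by simp

lemma image_mem: "T x \<in> T ` H \<longleftrightarrow> x \<in> H"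
  using inj by (simp add: inj_image_mem_iff)

lemma image_subset: "T ` X \<subseteq> T ` Y \<longleftrightarrow> X \<subseteq> Y"
  using inj by (simp add: inj_image_subset_iff)

lemma image_psubset: "T ` X \<subset> T ` Y \<longleftrightarrow> X \<subset> Y"
  by (simp add: less_le_not_le image_subset)

lemma inj_image: "inj_on ((`) T) S"
  using inj by (auto simp: inj_on_def inj_image_eq_iff)

lemma dim_image: "dim (T ` X) = dim X"
  by (rule dim_image_eq[OF lin inj_on_subset[OF inj subset_UNIV]])

lemma sameside_image: "sameside (T ` H) (T x) (T y) \<longleftrightarrow> sameside H x y"
proof -
  have "closed_segment (T x) (T y) \<inter> T ` H = T ` (closed_segment x y \<inter> H)"
    by (simp add: closed_segment_linear_image[OF lin] image_Int[OF inj])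
  then show ?thesis
    by (simp add: sameside_def image_mem)
qed

lemma samecell_image: "samecell ((`) T ` B) (T x) (T y) \<longleftrightarrow> samecell B x y"
  using sameside_image[of _ x y] sameside_image[of _ x "- y"]
  by (simp add: samecell_def linear_neg[OF lin])

lemma cells_image: "cells ((`) T ` B) = (`) T ` cells B"
proof -
  have cell: "{z. z \<noteq> 0 \<and> samecell ((`) T ` B) (T x) z} = T ` {y. y \<noteq> 0 \<and> samecell B x y}" for x
  proof (intro set_eqI iffI)
    fix z
    assume z: "z \<in> {z. z \<noteq> 0 \<and> samecell ((`) T ` B) (T x) z}"
    obtain y where "z = T y"
      using surj by auto
    then show "z \<in> T ` {y. y \<noteq> 0 \<and> samecell B x y}"
      using z by (simp add: T_0 samecell_image image_mem)
  next
    fix z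
    assume "z \<in> T ` {y. y \<noteq> 0 \<and> samecell B x y}"
    then show "z \<in> {z. z \<noteq> 0 \<and> samecell ((`) T ` B) (T x) z}"
      by (auto simp: T_0 samecell_image)
  qed
  show ?thesis
  proof (intro set_eqI iffI)
    fix C
    assume "C \<in> cells ((`) T ` B)"
    then obtain w where w: "w \<noteq> 0" "C = {z. z \<noteq> 0 \<and> samecell ((`) T ` B) w z}"
      unfolding cells_def by blast
    obtain x where "w = T x"
      using surj by auto
    then have "x \<noteq> 0" "C = T ` {y. y \<noteq> 0 \<and> samecell B x y}"
      using w cell T_0 by auto
    then show "C \<in> (`) T ` cells B"
      unfolding cells_def by blast
  next
    fix C
    assume "C \<in> (`) T ` cells B"
    then obtain x where "x \<noteq> 0" "C = T ` {y. y \<noteq> 0 \<and> samecell B x y}"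
      unfolding cells_def by blast
    then have "T x \<noteq> 0" "C = {z. z \<noteq> 0 \<and> samecell ((`) T ` B) (T x) z}"
      using cell T_0 by auto
    then show "C \<in> cells ((`) T ` B)"
      unfolding cells_def by blast
  qed
qed

text \<open>Taking preimages under \<open>T\<close> is the isomorphism of cell posets; a linear
  bijection commutes with closure.\<close>

lemma arr_iso_image: "arr_iso ((`) T ` B) B"
proof -
  have vi: "T -` T ` C = C" for C
    by (rule inj_vimage_image_eq[OF inj])
  have "bij_betw ((-`) T) (cells ((`) T ` B)) (cells B)"
    unfolding cells_image by (rule bij_betw_byWitness[where f' = "(`) T"]) (auto simp: vi)
  moreover have "C \<subseteq> closure D \<longleftrightarrow> T -` C \<subseteq> closure (T -` D)"
    if CD: "C \<in> cells ((`) T ` B)" "D \<in> cells ((`) T ` B)" for C D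
  proof -
    obtain C' D' where "C = T ` C'" "D = T ` D'"
      using CD unfolding cells_image by blast
    then show ?thesis
      by (simp only: vi closure_injective_linear_image[OF lin inj, symmetric] image_subset)
  qed
  ultimately show ?thesis
    unfolding arr_iso_def by blast
qed

lemma int_lattice_image: "int_lattice ((`) T ` B) = (`) T ` int_lattice B"
proof -
  have I: "\<Inter>((`) T ` B') = T ` \<Inter>B'" for B'
  proof (cases "B' = {}")
    \<comment> \<open>The empty intersection is the whole space, so surjectivity is what preserves
      it.\<close>
    case True
    then show ?thesis
      using surj by simp
  next
    case False
    then obtain j where "j \<in> B'" by blast
    then have "T ` (\<Inter>x\<in>B'. x) = (\<Inter>x\<in>B'. T ` x)"
      by (intro image_INT[OF inj]) auto
    then show ?thesis
      by simp
  qed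
  have "int_lattice ((`) T ` B) = Inter ` Pow ((`) T ` B)"
    by (auto simp: int_lattice_def)
  also have "Pow ((`) T ` B) = (`) ((`) T) ` Pow B"
    by (simp add: image_Pow_surj)
  also have "Inter ` \<dots> = (`) T ` (Inter ` Pow B)"
    by (simp add: image_image I)
  also have "Inter ` Pow B = int_lattice B"
    by (auto simp: int_lattice_def)
  finally show ?thesis .
qed

lemma weight_image: "weight ((`) T ` B) (T ` X) = weight B X"
proof -
  have "{H \<in> (`) T ` B. T ` X \<subseteq> H} = (`) T ` {H \<in> B. X \<subseteq> H}"
    by (auto simp: image_subset)
  then show ?thesis
    unfolding weight_def by (simp add: card_image[OF inj_image])
qed

lemma h_num_image: "h_num ((`) T ` B) i = h_num B i"
proof -
  have "{X \<in> lines ((`) T ` B). weight ((`) T ` B) X = i} = (`) T ` {X \<in> lines B. weight B X = i}"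
    by (auto simp: lines_def int_lattice_image weight_image dim_image)
  then show ?thesis
    unfolding h_num_def by (simp add: card_image[OF inj_image])
qed

lemma grunbaum_shephard_image: "grunbaum_shephard ((`) T ` B) \<longleftrightarrow> grunbaum_shephard B"
  by (simp add: grunbaum_shephard_def h_num_image card_image[OF inj_image])

lemma mob_aux_image: "mob_aux n ((`) T ` B) (T ` X) = mob_aux n B X"
proof (induction n arbitrary: X)
  case 0
  have "T ` X = UNIV \<longleftrightarrow> X = UNIV"
    using inj_image_eq_iff[OF inj, of X UNIV] surj by simp
  then show ?case by simp
next
  case (Suc n)
  have U: "T ` X = UNIV \<longleftrightarrow> X = UNIV"
    using inj_image_eq_iff[OF inj, of X UNIV] surj by simp
  have "{Y \<in> int_lattice ((`) T ` B). T ` X \<subset> Y} = (`) T ` {Y \<in> int_lattice B. X \<subset> Y}"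
    unfolding int_lattice_image image_psubset[of X, symmetric] by blast
  then have "(\<Sum>Y\<in>{Y \<in> int_lattice ((`) T ` B). T ` X \<subset> Y}. mob_aux n ((`) T ` B) Y) =
      (\<Sum>Y\<in>{Y \<in> int_lattice B. X \<subset> Y}. mob_aux n B Y)"
    by (simp only: sum.reindex[OF inj_image] o_def Suc.IH)
  then show ?case
    by (simp add: U)
qed

lemma char_poly_image: "char_poly ((`) T ` B) = char_poly B"
  unfolding char_poly_def int_lattice_image
  by (simp add: sum.reindex[OF inj_image] mobius_def mob_aux_image dim_image)

end

text \<open>\<open>T\<close> is built so that each functional \<open>b_n\<close> composed with
  \<open>T\<close> is \<open>a_n\<close>. Hyperplanes whose normals have equal coordinates in the
  two bases then correspond.\<close>

lemma linear_iso_of_bases: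
  assumes "independent4 a1 a2 a3 a4" "independent4 b1 b2 b3 b4"
  shows "\<exists>T. linear_iso T \<and> (\<forall>w1 w2 w3 w4.
    T ` hyp (w1 *\<^sub>R a1 + w2 *\<^sub>R a2 + w3 *\<^sub>R a3 + w4 *\<^sub>R a4) =
      hyp (w1 *\<^sub>R b1 + w2 *\<^sub>R b2 + w3 *\<^sub>R b3 + w4 *\<^sub>R b4))"
proof -
  let ?t = "\<lambda>u1 u2 u3 u4 (n :: 4). if n = 1 then u1 else if n = 2 then u2 else if n = 3 then u3 else u4"
  have d: "(2 :: 4) \<noteq> 1" "(3 :: 4) \<noteq> 1" "(3 :: 4) \<noteq> 2" "(4 :: 4) \<noteq> 1" "(4 :: 4) \<noteq> 2" "(4 :: 4) \<noteq> 3"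
    using four_distinct by auto
  have "y = 0" if "\<And>i. ?t b1 b2 b3 b4 i \<bullet> y = 0" for y
    using assms(2) that[of 1] that[of 2] that[of 3] that[of 4] d unfolding independent4_def by simp
  then obtain e where e: "\<And>i j. ?t b1 b2 b3 b4 i \<bullet> e j = (if i = j then 1 else 0)"
    using dual_basis_exists[of "?t b1 b2 b3 b4"] by blast
  define T where "T z = (a1 \<bullet> z) *\<^sub>R e 1 + (a2 \<bullet> z) *\<^sub>R e 2 + (a3 \<bullet> z) *\<^sub>R e 3 + (a4 \<bullet> z) *\<^sub>R e 4" for z
  have bT: "b1 \<bullet> T z = a1 \<bullet> z" "b2 \<bullet> T z = a2 \<bullet> z" "b3 \<bullet> T z = a3 \<bullet> z" "b4 \<bullet> T z = a4 \<bullet> z" for z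
    using e[of 1 1] e[of 1 2] e[of 1 3] e[of 1 4] e[of 2 1] e[of 2 2] e[of 2 3] e[of 2 4]
      e[of 3 1] e[of 3 2] e[of 3 3] e[of 3 4] e[of 4 1] e[of 4 2] e[of 4 3] e[of 4 4] d
    by (simp_all add: T_def inner_add_right)
  have lin: "linear T"
    by (rule linearI) (simp_all add: T_def inner_add_right algebra_simps)
  have "z = 0" if "T z = 0" for z
    using bT[of z] assms(1) that unfolding independent4_def by simp
  then have inj: "inj T"
    using linear_injective_0[OF lin] by blast
  interpret T: linear_iso T
    by (rule linear_iso.intro[OF lin inj])
  have "T ` hyp (w1 *\<^sub>R a1 + w2 *\<^sub>R a2 + w3 *\<^sub>R a3 + w4 *\<^sub>R a4) =
      hyp (w1 *\<^sub>R b1 + w2 *\<^sub>R b2 + w3 *\<^sub>R b3 + w4 *\<^sub>R b4)" for w1 w2 w3 w4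
  proof (rule set_eqI)
    fix z
    obtain y where "z = T y"
      using T.surj by auto
    then show "z \<in> T ` hyp (w1 *\<^sub>R a1 + w2 *\<^sub>R a2 + w3 *\<^sub>R a3 + w4 *\<^sub>R a4) \<longleftrightarrow>
        z \<in> hyp (w1 *\<^sub>R b1 + w2 *\<^sub>R b2 + w3 *\<^sub>R b3 + w4 *\<^sub>R b4)"
      by (simp add: T.image_mem) (simp add: hyp_def inner_add_left bT)
  qed
  with T.linear_iso_axioms show ?thesis
    by blast
qed

lemma path_roots_image:
  assumes "independent4 a1 a2 a3 a4" "independent4 b1 b2 b3 b4"
  shows "\<exists>T. linear_iso T \<and> hyp ` path_roots b1 b2 b3 b4 = (`) T ` hyp ` path_roots a1 a2 a3 a4"
proof -
  obtain T where T: "linear_iso T" and im: "\<And>w1 w2 w3 w4.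
    T ` hyp (w1 *\<^sub>R a1 + w2 *\<^sub>R a2 + w3 *\<^sub>R a3 + w4 *\<^sub>R a4) =
      hyp (w1 *\<^sub>R b1 + w2 *\<^sub>R b2 + w3 *\<^sub>R b3 + w4 *\<^sub>R b4)"
    using linear_iso_of_bases[OF assms] by blast
  have "hyp ` path_roots b1 b2 b3 b4 = (`) T ` hyp ` path_roots a1 a2 a3 a4"
    using im[of 1 0 0 0] im[of 1 1 0 0] im[of 0 1 0 0] im[of 1 1 1 0] im[of 0 1 1 0] im[of 0 0 1 0]
      im[of 1 1 1 1] im[of 0 1 1 1] im[of 0 0 1 1] im[of 0 0 0 1]
    by (simp add: path_roots_def)
  with T show ?thesis by blast
qed

lemma star_roots_image:
  assumes "independent4 a1 a2 a3 a4" "independent4 b1 b2 b3 b4"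
  shows "\<exists>T. linear_iso T \<and> hyp ` star_roots b1 b2 b3 b4 = (`) T ` hyp ` star_roots a1 a2 a3 a4"
proof -
  obtain T where T: "linear_iso T" and im: "\<And>w1 w2 w3 w4.
    T ` hyp (w1 *\<^sub>R a1 + w2 *\<^sub>R a2 + w3 *\<^sub>R a3 + w4 *\<^sub>R a4) =
      hyp (w1 *\<^sub>R b1 + w2 *\<^sub>R b2 + w3 *\<^sub>R b3 + w4 *\<^sub>R b4)"
    using linear_iso_of_bases[OF assms] by blast
  have "hyp ` star_roots b1 b2 b3 b4 = (`) T ` hyp ` star_roots a1 a2 a3 a4"
    using im[of 0 1 0 0] im[of 1 1 0 0] im[of 0 1 1 0] im[of 0 1 0 1] im[of 1 2 1 1] im[of 0 1 1 1]
      im[of 1 1 0 1] im[of 1 1 1 0] im[of 1 1 1 1] im[of 1 0 0 0] im[of 0 0 1 0] im[of 0 0 0 1]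
    by (simp add: star_roots_def)
  with T show ?thesis by blast
qed

section \<open>Moebius function and characteristic polynomial\<close>

lemma dim_Int_hyp:
  assumes X: "subspace X" and a: "a \<noteq> 0" and n: "\<not> X \<subseteq> hyp a"
  shows "dim (X \<inter> hyp a) + 1 = dim X"
proof -
  obtain x where x: "x \<in> X" "a \<bullet> x \<noteq> 0"
    using n by (auto simp: hyp_def)
  have "z \<in> {x + y |x y. x \<in> X \<and> y \<in> hyp a}" for z
  proof -
    let ?c = "(a \<bullet> z) / (a \<bullet> x)"
    have "?c *\<^sub>R x \<in> X"
      using X x(1) by (rule subspace_scale)
    moreover have "z - ?c *\<^sub>R x \<in> hyp a"
      using x(2) by (simp add: hyp_def inner_diff_right)
    moreover have "z = ?c *\<^sub>R x + (z - ?c *\<^sub>R x)"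
      by simp
    ultimately show ?thesis by blast
  qed
  then have "{x + y |x y. x \<in> X \<and> y \<in> hyp a} = UNIV"
    by blast
  moreover have "subspace (hyp a)"
    by (simp add: hyp_def subspace_hyperplane)
  ultimately have "dim (UNIV :: vec4 set) + dim (X \<inter> hyp a) = dim X + dim (hyp a)"
    using dim_sums_Int[OF X, of "hyp a"] by simp
  moreover have "dim (hyp a) = 3"
    using dim_hyperplane[OF a] by (simp add: hyp_def)
  ultimately show ?thesis
    by simp
qed

section \<open>Flats and their Moebius values\<close>

locale linear_arrangement =
  fixes A :: "vec4 set set"
  assumes arr: "arrangement A"
begin

lemma finA: "finite A"
  using arr by (simp add: arrangement_def)

lemma hypE:
  assumes "H \<in> A"
  obtains a where "a \<noteq> 0" "H = hyp a"
  using arrangement_hypE[OF arr assms] roots_nonzero by metis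

lemma hyperplane_dim: "H \<in> A \<Longrightarrow> dim H = 3" and hyperplane_subspace: "H \<in> A \<Longrightarrow> subspace H"
proof -
  assume "H \<in> A"
  then obtain a where "a \<noteq> 0" "H = hyp a"
    by (rule hypE)
  then show "dim H = 3" "subspace H"
    using dim_hyperplane[of a] by (simp_all add: hyp_def subspace_hyperplane)
qed

lemma flat_subspace: "X \<in> int_lattice A \<Longrightarrow> subspace X"
  unfolding int_lattice_def using hyperplane_subspace by (auto intro!: subspace_Inter)

lemma flat_eqI:
  assumes "X \<in> int_lattice A" "Y \<in> int_lattice A" "X \<subseteq> Y" "dim Y \<le> dim X"
  shows "X = Y"
  using subspace_dim_equal[OF flat_subspace[OF assms(1)] flat_subspace[OF assms(2)] assms(3,4)] .

lemma finite_lattice: "finite (int_lattice A)"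
  by (rule finite_int_lattice[OF finA])

text \<open>A further hyperplane is either redundant or lowers the dimension by exactly one. Hence a
  flat is the intersection of as many hyperplanes as its codimension: lines come from pairs,
  vertices from triples.\<close>

lemma minimal_intersection:
  assumes "finite B" "B \<subseteq> A"
  shows "\<exists>C\<subseteq>B. card C + dim (\<Inter>B) = 4 \<and> \<Inter>C = \<Inter>B"
  using assms
proof (induction B rule: finite_induct)
  case empty
  then show ?case by simp
next
  case (insert H B)
  then obtain C where C: "C \<subseteq> B" "card C + dim (\<Inter>B) = 4" "\<Inter>C = \<Inter>B"
    by auto
  show ?case
  proof (cases "\<Inter>B \<subseteq> H")
    case True
    then have "\<Inter>(insert H B) = \<Inter>B"
      by auto
    then show ?thesis
      using C by (intro exI[of _ C]) auto
  next
    case False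
    have HA: "H \<in> A"
      using insert.prems by auto
    obtain a where a: "a \<noteq> 0" "H = hyp a"
      using hypE[OF HA] .
    have "\<Inter>B \<in> int_lattice A"
      using insert.prems by (auto simp: int_lattice_def)
    then have "dim (\<Inter>B \<inter> H) + 1 = dim (\<Inter>B)"
      using dim_Int_hyp[OF flat_subspace a(1)] False a(2) by blast
    moreover have "\<Inter>(insert H B) = \<Inter>B \<inter> H"
      by auto
    moreover have "H \<notin> C"
      using False C(3) by auto
    then have "card (insert H C) = card C + 1"
      using finite_subset[OF C(1) insert.hyps(1)] by simp
    ultimately have "card (insert H C) + dim (\<Inter>(insert H B)) = 4"
      using C(2) by simp
    moreover have "\<Inter>(insert H C) = \<Inter>(insert H B)" "insert H C \<subseteq> insert H B"
      using C by auto
    ultimately show ?thesis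
      by blast
  qed
qed

lemma flat_minimal:
  assumes "X \<in> int_lattice A"
  obtains C where "C \<subseteq> A" "card C + dim X = 4" "X = \<Inter>C"
proof -
  obtain B where B: "B \<subseteq> A" "X = \<Inter>B"
    using assms by (auto simp: int_lattice_def)
  obtain C where "C \<subseteq> B" "card C + dim (\<Inter>B) = 4" "\<Inter>C = \<Inter>B"
    using minimal_intersection[OF finite_subset[OF B(1) finA] B(1)] by blast
  then show thesis
    using B that[of C] by auto
qed

lemma UNIV_flat: "UNIV \<in> int_lattice A"
  unfolding int_lattice_def by (rule CollectI, rule exI[of _ "{}"]) simp

lemma zero_flat: "{0} \<in> int_lattice A"
  using arr unfolding int_lattice_def arrangement_def by (intro CollectI exI[of _ A]) simp

lemma hyperplane_flat: "H \<in> A \<Longrightarrow> H \<in> int_lattice A"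
  unfolding int_lattice_def by (rule CollectI, rule exI[of _ "{H}"]) simp

lemma Int_flat: "X \<in> int_lattice A \<Longrightarrow> Y \<in> int_lattice A \<Longrightarrow> X \<inter> Y \<in> int_lattice A"
proof -
  assume "X \<in> int_lattice A" "Y \<in> int_lattice A"
  then obtain B C where "B \<subseteq> A" "X = \<Inter>B" "C \<subseteq> A" "Y = \<Inter>C"
    by (auto simp: int_lattice_def)
  then have "X \<inter> Y = \<Inter>(B \<union> C)" "B \<union> C \<subseteq> A"
    by auto
  then show ?thesis
    unfolding int_lattice_def by blast
qed

lemma flat_dim4: "{X \<in> int_lattice A. dim X = 4} = {UNIV}"
proof (intro set_eqI iffI)
  fix X
  assume X: "X \<in> {X \<in> int_lattice A. dim X = 4}"
  then have "X = UNIV"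
    by (intro flat_eqI) (auto simp: UNIV_flat)
  then show "X \<in> {UNIV}" by simp
qed (use UNIV_flat in auto)

lemma flat_dim3: "{X \<in> int_lattice A. dim X = 3} = A"
proof (intro set_eqI iffI)
  fix X
  assume X: "X \<in> {X \<in> int_lattice A. dim X = 3}"
  then obtain C where C: "C \<subseteq> A" "card C + dim X = 4" "X = \<Inter>C"
    using flat_minimal by blast
  then have "card C = 1"
    using X by simp
  then obtain H where "C = {H}"
    by (auto simp: card_1_singleton_iff)
  then show "X \<in> A"
    using C by simp
qed (use hyperplane_flat hyperplane_dim in auto)

lemma flat_dim0: "{X \<in> int_lattice A. dim X = 0} = {{0}}"
proof (intro set_eqI iffI)
  fix X
  assume X: "X \<in> {X \<in> int_lattice A. dim X = 0}"
  then have "X \<subseteq> {0}" "0 \<in> X"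
    using dim_eq_0[of X] subspace_0[OF flat_subspace[of X]] by auto
  then show "X \<in> {{0}}" by auto
qed (use zero_flat in auto)

lemma line_dim:
  assumes "H \<in> A" "K \<in> A" "H \<noteq> K"
  shows "dim (H \<inter> K) = 2"
proof -
  have n: "\<not> H \<subseteq> K"
    using flat_eqI[OF hyperplane_flat hyperplane_flat] assms hyperplane_dim by auto
  obtain a where a: "a \<noteq> 0" "K = hyp a"
    using hypE[OF assms(2)] .
  then show ?thesis
    using dim_Int_hyp[OF hyperplane_subspace[OF assms(1)] a(1)] n hyperplane_dim[OF assms(1)] by auto
qed

lemma lines_eq: "lines A = {H \<inter> K | H K. H \<in> A \<and> K \<in> A \<and> H \<noteq> K}"
proof (intro set_eqI iffI)
  fix X
  assume X: "X \<in> lines A"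
  then obtain C where C: "C \<subseteq> A" "card C + dim X = 4" "X = \<Inter>C"
    using flat_minimal[of X] by (auto simp: lines_def)
  then have "card C = 2"
    using X by (simp add: lines_def)
  then obtain H K where "C = {H, K}" "H \<noteq> K"
    by (auto simp: card_2_iff)
  then show "X \<in> {H \<inter> K | H K. H \<in> A \<and> K \<in> A \<and> H \<noteq> K}"
    using C by auto
next
  fix X
  assume "X \<in> {H \<inter> K | H K. H \<in> A \<and> K \<in> A \<and> H \<noteq> K}"
  then show "X \<in> lines A"
    using line_dim Int_flat hyperplane_flat by (auto simp: lines_def)
qed

lemma vertices_eq:
  "vertices A = {X. dim X = 1 \<and> (\<exists>H K M. H \<in> A \<and> K \<in> A \<and> M \<in> A \<and> H \<noteq> K \<and> H \<noteq> M \<and> K \<noteq> M \<and> X = H \<inter> K \<inter> M)}"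
proof (intro set_eqI iffI)
  fix X
  assume X: "X \<in> vertices A"
  then obtain C where C: "C \<subseteq> A" "card C + dim X = 4" "X = \<Inter>C"
    using flat_minimal[of X] by (auto simp: vertices_def)
  then have "card C = 3"
    using X by (simp add: vertices_def)
  then obtain H K M where "C = {H, K, M}" "H \<noteq> K" "H \<noteq> M" "K \<noteq> M"
    by (auto simp: card_3_iff)
  then show "X \<in> {X. dim X = 1 \<and> (\<exists>H K M. H \<in> A \<and> K \<in> A \<and> M \<in> A \<and> H \<noteq> K \<and> H \<noteq> M \<and> K \<noteq> M \<and> X = H \<inter> K \<inter> M)}"
    using C X by (auto simp: vertices_def)
next
  fix X
  assume "X \<in> {X. dim X = 1 \<and> (\<exists>H K M. H \<in> A \<and> K \<in> A \<and> M \<in> A \<and> H \<noteq> K \<and> H \<noteq> M \<and> K \<noteq> M \<and> X = H \<inter> K \<inter> M)}"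
  then show "X \<in> vertices A"
    using Int_flat hyperplane_flat by (auto simp: vertices_def)
qed

lemma dim_le_4: "dim (X :: vec4 set) \<le> 4"
  using dim_subset_UNIV[of X] by simp

lemma sum_by_dim:
  fixes h :: "vec4 set \<Rightarrow> 'b::comm_monoid_add"
  assumes "S \<subseteq> int_lattice A"
  shows "sum h S = sum h {X \<in> S. dim X = 0} + sum h {X \<in> S. dim X = 1} + sum h {X \<in> S. dim X = 2} +
    sum h {X \<in> S. dim X = 3} + sum h {X \<in> S. dim X = 4}"
proof -
  have "finite S"
    using finite_subset[OF assms finite_lattice] .
  moreover have "dim ` S \<subseteq> {0, 1, 2, 3, 4}"
  proof
    fix d
    assume "d \<in> dim ` S"
    then have "d \<le> 4"
      using dim_le_4 by auto
    then show "d \<in> {0, 1, 2, 3, 4}"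
      by auto
  qed
  ultimately have "sum h S = (\<Sum>d\<in>{0, 1, 2, 3, 4}. sum h {X \<in> S. dim X = d})"
    by (subst sum.group) auto
  then show ?thesis
    by (simp add: add.assoc)
qed

abbreviation above :: "vec4 set \<Rightarrow> vec4 set set" where
  "above X \<equiv> {Y \<in> int_lattice A. X \<subset> Y}"

lemma above_dim:
  assumes "X \<in> int_lattice A"
  shows "{Y \<in> above X. dim Y = d} = (if dim X < d then {Y \<in> int_lattice A. dim Y = d \<and> X \<subseteq> Y} else {})"
proof (cases "dim X < d")
  case True
  then show ?thesis by auto
next
  case False
  have "dim Y \<noteq> d" if "Y \<in> int_lattice A" "X \<subset> Y" for Y
    using flat_eqI[OF assms that(1)] that(2) False by (metis linorder_le_less_linear psubset_eq not_less)
  with False show ?thesis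
    by auto
qed

lemma sum_above:
  fixes h :: "vec4 set \<Rightarrow> 'b::comm_monoid_add"
  assumes "X \<in> int_lattice A"
  defines "s \<equiv> \<lambda>d. if dim X < d then sum h {Y \<in> int_lattice A. dim Y = d \<and> X \<subseteq> Y} else 0"
  shows "sum h (above X) = s 1 + s 2 + s 3 + s 4"
proof -
  have "sum h {Y \<in> above X. dim Y = d} = s d" for d
    unfolding above_dim[OF assms(1)] s_def by simp
  then have "sum h (above X) = s 0 + s 1 + s 2 + s 3 + s 4"
    by (subst sum_by_dim) (simp_all only: subset_iff mem_Collect_eq, blast)
  then show ?thesis
    by (simp add: s_def)
qed

lemma weight_eq: "weight A X = card {Y \<in> int_lattice A. dim Y = 3 \<and> X \<subseteq> Y}"
proof -
  have "{Y \<in> int_lattice A. dim Y = 3 \<and> X \<subseteq> Y} = {Y \<in> {X \<in> int_lattice A. dim X = 3}. X \<subseteq> Y}"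
    by auto
  then show ?thesis
    by (simp only: flat_dim3 weight_def)
qed

lemma above4: "{Y \<in> int_lattice A. dim Y = 4 \<and> X \<subseteq> Y} = {UNIV}"
proof -
  have "{Y \<in> int_lattice A. dim Y = 4 \<and> X \<subseteq> Y} = {Y \<in> {X \<in> int_lattice A. dim X = 4}. X \<subseteq> Y}"
    by auto
  then show ?thesis
    by (simp only: flat_dim4) auto
qed

lemma not_UNIV: "dim X < 4 \<Longrightarrow> (X :: vec4 set) \<noteq> UNIV"
  by auto

lemma mob_UNIV: "mob_aux n A UNIV = 1"
  by (cases n) auto

text \<open>One unit of fuel per codimension suffices, because the recursion only visits flats of
  larger dimension; any further fuel leaves the value unchanged.\<close>

lemma mob_dim3:
  assumes "X \<in> int_lattice A" "dim X = 3"
  shows "mob_aux (Suc n) A X = - 1"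
  using not_UNIV[of X] by (simp add: sum_above[OF assms(1)] assms(2) above4 mob_UNIV)

lemma mob_dim2:
  assumes "X \<in> int_lattice A" "dim X = 2"
  shows "mob_aux (Suc (Suc n)) A X = real (weight A X) - 1"
proof -
  have "sum (mob_aux (Suc n) A) {Y \<in> int_lattice A. dim Y = 3 \<and> X \<subseteq> Y} = - real (weight A X)"
    by (simp add: weight_eq mob_dim3 del: mob_aux.simps)
  then show ?thesis
    using not_UNIV[of X]
    by (subst mob_aux.simps(2))
      (simp add: sum_above[OF assms(1)] assms(2) above4 mob_UNIV del: mob_aux.simps)
qed

text \<open>The Moebius value of a one-dimensional flat, in terms of the weights of the flat and of
  the lines containing it.\<close>

definition vmob :: "vec4 set \<Rightarrow> real" where
  "vmob X = real (weight A X) - 1 - (\<Sum>Y\<in>{Y \<in> lines A. X \<subseteq> Y}. real (weight A Y) - 1)"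

lemma mob_dim1:
  assumes "X \<in> int_lattice A" "dim X = 1"
  shows "mob_aux (Suc (Suc (Suc n))) A X = vmob X"
proof -
  have "sum (mob_aux (Suc (Suc n)) A) {Y \<in> int_lattice A. dim Y = 3 \<and> X \<subseteq> Y} = - real (weight A X)"
    by (simp add: weight_eq mob_dim3 del: mob_aux.simps)
  moreover have "sum (mob_aux (Suc (Suc n)) A) {Y \<in> int_lattice A. dim Y = 2 \<and> X \<subseteq> Y} =
      (\<Sum>Y\<in>{Y \<in> lines A. X \<subseteq> Y}. real (weight A Y) - 1)"
    by (rule sum.cong) (auto simp: lines_def mob_dim2 simp del: mob_aux.simps)
  ultimately show ?thesis
    using not_UNIV[of X]
    by (subst mob_aux.simps(2))
      (simp add: sum_above[OF assms(1)] assms(2) above4 mob_UNIV vmob_def del: mob_aux.simps)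
qed

lemma char_poly_eq:
  fixes n a b :: real
  defines "n \<equiv> real (card A)" and "a \<equiv> \<Sum>Y\<in>lines A. real (weight A Y) - 1"
    and "b \<equiv> \<Sum>Y\<in>vertices A. vmob Y"
  shows "char_poly A = [:n - 1 - a - b, b, a, - n, 1:]"
proof -
  have s1: "sum (mob_aux k A) {X \<in> int_lattice A. dim X = 1} = b" if "k = Suc (Suc (Suc m))" for k m
    unfolding b_def vertices_def that by (rule sum.cong) (auto simp: mob_dim1 simp del: mob_aux.simps)
  have s2: "sum (mob_aux k A) {X \<in> int_lattice A. dim X = 2} = a" if "k = Suc (Suc m)" for k m
    unfolding a_def lines_def that by (rule sum.cong) (auto simp: mob_dim2 simp del: mob_aux.simps)
  have s3: "sum (mob_aux k A) {X \<in> int_lattice A. dim X = 3} = - n" if "k = Suc m" for k m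
  proof -
    have "sum (mob_aux k A) {X \<in> int_lattice A. dim X = 3} = (\<Sum>X\<in>{X \<in> int_lattice A. dim X = 3}. - 1)"
      unfolding that by (rule sum.cong) (auto simp: mob_dim3 simp del: mob_aux.simps)
    also have "\<dots> = - n"
      unfolding flat_dim3 by (simp add: n_def)
    finally show ?thesis .
  qed
  have s4: "sum (mob_aux k A) {X \<in> int_lattice A. dim X = 4} = 1" for k
    by (simp add: flat_dim4 mob_UNIV)
  have ab: "{Y \<in> int_lattice A. dim Y = d \<and> {0} \<subseteq> Y} = {Y \<in> int_lattice A. dim Y = d}" for d
    using subspace_0[OF flat_subspace] by auto
  \<comment> \<open>The value at the zero flat is forced by the vanishing of the sum of all Moebius
    values.\<close>
  have m0: "mob_aux 4 A {0} = n - 1 - a - b"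
  proof -
    have k: "(4 :: nat) = Suc 3" "(3 :: nat) = Suc (Suc (Suc 0))" "(3 :: nat) = Suc (Suc 1)" "(3 :: nat) = Suc 2"
      by simp_all
    have "mob_aux 4 A {0} = - sum (mob_aux 3 A) (above {0})"
      unfolding k(1) using not_UNIV[of "{0}"] by (subst mob_aux.simps(2)) simp
    also have "sum (mob_aux 3 A) (above {0}) = b + a + - n + 1"
      unfolding sum_above[OF zero_flat] ab s1[OF k(2)] s2[OF k(3)] s3[OF k(4)] s4 by simp
    finally show ?thesis by simp
  qed
  have mon: "(\<Sum>X\<in>{X \<in> int_lattice A. dim X = d}. monom (mobius A X) (dim X)) =
      monom (sum (mob_aux 4 A) {X \<in> int_lattice A. dim X = d}) d" for d
    by (simp add: mobius_def monom_sum)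
  have "char_poly A = monom (n - 1 - a - b) 0 + monom b 1 + monom a 2 + monom (- n) 3 + monom 1 4"
  proof -
    have k: "(4 :: nat) = Suc (Suc (Suc 1))" "(4 :: nat) = Suc (Suc 2)" "(4 :: nat) = Suc 3"
      by simp_all
    have s0: "sum (mob_aux 4 A) {X \<in> int_lattice A. dim X = 0} = n - 1 - a - b"
      unfolding flat_dim0 by (simp add: m0 del: mob_aux.simps)
    show ?thesis
      unfolding char_poly_def sum_by_dim[OF subset_refl] mon s0 s1[OF k(1)] s2[OF k(2)] s3[OF k(3)] s4 ..
  qed
  also have "\<dots> = [:n - 1 - a - b, b, a, - n, 1:]"
    by (simp add: monom_altdef numeral_eq_Suc)
  finally show ?thesis .
qed

end

section \<open>Arrangements with integral normals\<close>

type_synonym ivec = "int \<times> int \<times> int \<times> int"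

text \<open>Polymorphic, since the minors are evaluated over the integers but reasoned about over
  the reals.\<close>

fun det3 :: "'a::comm_ring \<times> 'a \<times> 'a \<Rightarrow> 'a \<times> 'a \<times> 'a \<Rightarrow> 'a \<times> 'a \<times> 'a \<Rightarrow> 'a" where
  "det3 (a, b, c) (d, e, f) (g, h, i) = a * (e * i - f * h) - b * (d * i - f * g) + c * (d * h - e * g)"

text \<open>The generalised cross product: the signed maximal minors of three vectors. It is
  orthogonal to all three and vanishes exactly when they are dependent.\<close>

fun cross4 :: "ivec \<Rightarrow> ivec \<Rightarrow> ivec \<Rightarrow> ivec" where
  "cross4 (a1, a2, a3, a4) (b1, b2, b3, b4) (c1, c2, c3, c4) =
    (det3 (a2, a3, a4) (b2, b3, b4) (c2, c3, c4), - det3 (a1, a3, a4) (b1, b3, b4) (c1, c3, c4),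
     det3 (a1, a2, a4) (b1, b2, b4) (c1, c2, c4), - det3 (a1, a2, a3) (b1, b2, b3) (c1, c2, c3))"

fun dot :: "ivec \<Rightarrow> ivec \<Rightarrow> int" where
  "dot (a1, a2, a3, a4) (b1, b2, b3, b4) = a1 * b1 + a2 * b2 + a3 * b3 + a4 * b4"

fun parallel :: "ivec \<Rightarrow> ivec \<Rightarrow> bool" where
  "parallel (a1, a2, a3, a4) (b1, b2, b3, b4) \<longleftrightarrow> a1 * b2 = a2 * b1 \<and> a1 * b3 = a3 * b1 \<and>
    a1 * b4 = a4 * b1 \<and> a2 * b3 = a3 * b2 \<and> a2 * b4 = a4 * b2 \<and> a3 * b4 = a4 * b3"

fun pairs :: "'a list \<Rightarrow> ('a \<times> 'a) list" where
  "pairs [] = []"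
| "pairs (x # xs) = map (Pair x) xs @ pairs xs"

fun triples :: "'a list \<Rightarrow> ('a \<times> 'a \<times> 'a) list" where
  "triples [] = []"
| "triples (x # xs) = map (Pair x) (pairs xs) @ triples xs"

text \<open>A flat of the arrangement is encoded by the list of all roots that vanish on it.\<close>

definition line_list :: "ivec list \<Rightarrow> ivec list list" where
  "line_list L = remdups (map (\<lambda>(u, v). filter (\<lambda>w. cross4 u v w = (0, 0, 0, 0)) L) (pairs L))"

definition vertex_list :: "ivec list \<Rightarrow> ivec list list" where
  "vertex_list L = remdups (map (\<lambda>n. filter (\<lambda>w. dot w n = 0) L)
     (filter (\<lambda>n. n \<noteq> (0, 0, 0, 0)) (map (\<lambda>(u, v, w). cross4 u v w) (triples L))))"

definition line_sum :: "ivec list list \<Rightarrow> int" where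
  "line_sum ls = sum_list (map (\<lambda>I. int (length I) - 1) ls)"

text \<open>The sign is opposite to \<open>vmob\<close>, so that the negative of this number is the
  linear coefficient of the characteristic polynomial.\<close>

definition vertex_sum :: "ivec list list \<Rightarrow> ivec list list \<Rightarrow> int" where
  "vertex_sum ls vs = sum_list (map (\<lambda>J. 1 - int (length J) + line_sum (filter (\<lambda>I. set I \<subseteq> set J) ls)) vs)"


definition rvec :: "real \<Rightarrow> real \<Rightarrow> real \<Rightarrow> real \<Rightarrow> vec4" where
  "rvec a b c d = (\<chi> i. if i = 1 then a else if i = 2 then b else if i = 3 then c else d)"

lemma rvec_nth: "rvec a b c d $ 1 = a" "rvec a b c d $ 2 = b" "rvec a b c d $ 3 = c" "rvec a b c d $ 4 = d"
  by (simp_all add: rvec_def)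

lemma vec4_eq_iff: "x = y \<longleftrightarrow> x $ 1 = y $ 1 \<and> x $ 2 = y $ 2 \<and> x $ 3 = y $ 3 \<and> x $ 4 = (y :: vec4) $ 4"
  by (simp add: vec_eq_iff forall_4)

lemma rvec_inner: "rvec a b c d \<bullet> x = a * x $ 1 + b * x $ 2 + c * x $ 3 + d * x $ 4"
  by (simp add: inner_vec_def sum_4 rvec_nth)

fun V :: "ivec \<Rightarrow> vec4" where
  "V (a, b, c, d) = rvec (of_int a) (of_int b) (of_int c) (of_int d)"

lemma V_inner_V: "V u \<bullet> V v = of_int (dot u v)"
  by (cases u; cases v) (simp add: rvec_inner rvec_nth)

lemma hyp_V: "hyp (V (a, b, c, d)) = {x. a * x $ 1 + b * x $ 2 + c * x $ 3 + d * x $ 4 = 0}"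
  by (simp add: hyp_def rvec_inner)

section \<open>Rank conditions by minors\<close>

text \<open>A common solution is proportional to the vector of signed minors. Stated without
  division, as it is not known which minor is nonzero.\<close>

lemma cramer:
  fixes a1 a2 a3 a4 :: real
  assumes "a1 * x1 + a2 * x2 + a3 * x3 + a4 * x4 = 0" "b1 * x1 + b2 * x2 + b3 * x3 + b4 * x4 = 0"
    "c1 * x1 + c2 * x2 + c3 * x3 + c4 * x4 = 0"
  shows "det3 (a2, a3, a4) (b2, b3, b4) (c2, c3, c4) * x2 = - det3 (a1, a3, a4) (b1, b3, b4) (c1, c3, c4) * x1"
    and "det3 (a2, a3, a4) (b2, b3, b4) (c2, c3, c4) * x3 = det3 (a1, a2, a4) (b1, b2, b4) (c1, c2, c4) * x1"
    and "det3 (a2, a3, a4) (b2, b3, b4) (c2, c3, c4) * x4 = - det3 (a1, a2, a3) (b1, b2, b3) (c1, c2, c3) * x1"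
    and "- det3 (a1, a3, a4) (b1, b3, b4) (c1, c3, c4) * x3 = det3 (a1, a2, a4) (b1, b2, b4) (c1, c2, c4) * x2"
    and "det3 (a1, a3, a4) (b1, b3, b4) (c1, c3, c4) * x4 = det3 (a1, a2, a3) (b1, b2, b3) (c1, c2, c3) * x2"
    and "det3 (a1, a2, a4) (b1, b2, b4) (c1, c2, c4) * x4 = - det3 (a1, a2, a3) (b1, b2, b3) (c1, c2, c3) * x3"
  unfolding det3.simps using assms by algebra+

text \<open>If the three vectors are dependent, each 2 by 2 minor of the first two annihilates the
  third functional at a common zero of the first two; one nonzero minor then suffices.\<close>

lemma minor_times_inner:
  fixes a1 a2 a3 a4 :: real
  assumes "a1 * x1 + a2 * x2 + a3 * x3 + a4 * x4 = 0" "b1 * x1 + b2 * x2 + b3 * x3 + b4 * x4 = 0"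
    and "det3 (a2, a3, a4) (b2, b3, b4) (c2, c3, c4) = 0" "det3 (a1, a3, a4) (b1, b3, b4) (c1, c3, c4) = 0"
      "det3 (a1, a2, a4) (b1, b2, b4) (c1, c2, c4) = 0" "det3 (a1, a2, a3) (b1, b2, b3) (c1, c2, c3) = 0"
  shows "(a1 * b2 - a2 * b1) * (c1 * x1 + c2 * x2 + c3 * x3 + c4 * x4) = 0"
    "(a1 * b3 - a3 * b1) * (c1 * x1 + c2 * x2 + c3 * x3 + c4 * x4) = 0"
    "(a1 * b4 - a4 * b1) * (c1 * x1 + c2 * x2 + c3 * x3 + c4 * x4) = 0"
    "(a2 * b3 - a3 * b2) * (c1 * x1 + c2 * x2 + c3 * x3 + c4 * x4) = 0"
    "(a2 * b4 - a4 * b2) * (c1 * x1 + c2 * x2 + c3 * x3 + c4 * x4) = 0"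
    "(a3 * b4 - a4 * b3) * (c1 * x1 + c2 * x2 + c3 * x3 + c4 * x4) = 0"
  using assms unfolding det3.simps by algebra+

lemma det3_of_int: "det3 (of_int a, of_int b, of_int c) (of_int d, of_int e, of_int f) (of_int g, of_int h, of_int i) =
    (of_int (det3 (a, b, c) (d, e, f) (g, h, i)) :: real)"
  by simp

lemma Int_hyp_subset_iff:
  assumes np: "\<not> parallel u v"
  shows "hyp (V u) \<inter> hyp (V v) \<subseteq> hyp (V w) \<longleftrightarrow> cross4 u v w = (0, 0, 0, 0)"
proof -
  obtain a1 a2 a3 a4 where u: "u = (a1, a2, a3, a4)" by (cases u)
  obtain b1 b2 b3 b4 where v: "v = (b1, b2, b3, b4)" by (cases v)
  obtain c1 c2 c3 c4 where w: "w = (c1, c2, c3, c4)" by (cases w)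
  let ?r = "real_of_int"
  note uvw = u v w
  have m: "rvec p q r s \<in> hyp (V (a, b, c, d)) \<longleftrightarrow> a * p + b * q + c * r + d * s = 0" for p q r s a b c d
    by (simp only: hyp_V mem_Collect_eq rvec_nth)
  show ?thesis
  proof
    assume sub: "hyp (V u) \<inter> hyp (V v) \<subseteq> hyp (V w)"
    have z: "?r c1 * p + ?r c2 * q + ?r c3 * r + ?r c4 * s = 0"
      if "?r a1 * p + ?r a2 * q + ?r a3 * r + ?r a4 * s = 0" "?r b1 * p + ?r b2 * q + ?r b3 * r + ?r b4 * s = 0"
      for p q r s
      using subsetD[OF sub, of "rvec p q r s"] that by (simp only: uvw m Int_iff simp_thms)
    \<comment> \<open>The test point is the cross product of the two vectors in three of the
      coordinates, with 0 in the fourth; it lies on both hyperplanes, and the third functional takes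
      the minor as its value there.\<close>
    have "?r (det3 (a2, a3, a4) (b2, b3, b4) (c2, c3, c4)) = 0"
      using z[of 0 "?r a3 * ?r b4 - ?r a4 * ?r b3" "?r a4 * ?r b2 - ?r a2 * ?r b4" "?r a2 * ?r b3 - ?r a3 * ?r b2"]
      by (simp add: algebra_simps)
    moreover have "?r (det3 (a1, a3, a4) (b1, b3, b4) (c1, c3, c4)) = 0"
      using z[of "?r a3 * ?r b4 - ?r a4 * ?r b3" 0 "?r a4 * ?r b1 - ?r a1 * ?r b4" "?r a1 * ?r b3 - ?r a3 * ?r b1"]
      by (simp add: algebra_simps)
    moreover have "?r (det3 (a1, a2, a4) (b1, b2, b4) (c1, c2, c4)) = 0"
      using z[of "?r a2 * ?r b4 - ?r a4 * ?r b2" "?r a4 * ?r b1 - ?r a1 * ?r b4" 0 "?r a1 * ?r b2 - ?r a2 * ?r b1"]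
      by (simp add: algebra_simps)
    moreover have "?r (det3 (a1, a2, a3) (b1, b2, b3) (c1, c2, c3)) = 0"
      using z[of "?r a2 * ?r b3 - ?r a3 * ?r b2" "?r a3 * ?r b1 - ?r a1 * ?r b3" "?r a1 * ?r b2 - ?r a2 * ?r b1" 0]
      by (simp add: algebra_simps)
    ultimately show "cross4 u v w = (0, 0, 0, 0)"
      unfolding uvw cross4.simps of_int_eq_0_iff by (simp del: det3.simps)
  next
    assume "cross4 u v w = (0, 0, 0, 0)"
    then have D: "?r (det3 (a2, a3, a4) (b2, b3, b4) (c2, c3, c4)) = 0" "?r (det3 (a1, a3, a4) (b1, b3, b4) (c1, c3, c4)) = 0"
      "?r (det3 (a1, a2, a4) (b1, b2, b4) (c1, c2, c4)) = 0" "?r (det3 (a1, a2, a3) (b1, b2, b3) (c1, c2, c3)) = 0"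
      unfolding uvw cross4.simps of_int_eq_0_iff by (simp_all del: det3.simps)
    show "hyp (V u) \<inter> hyp (V v) \<subseteq> hyp (V w)"
    proof
      fix x
      assume "x \<in> hyp (V u) \<inter> hyp (V v)"
      then have x: "?r a1 * x $ 1 + ?r a2 * x $ 2 + ?r a3 * x $ 3 + ?r a4 * x $ 4 = 0"
          "?r b1 * x $ 1 + ?r b2 * x $ 2 + ?r b3 * x $ 3 + ?r b4 * x $ 4 = 0"
        by (simp_all only: uvw hyp_V Int_iff mem_Collect_eq)
      let ?w = "?r c1 * x $ 1 + ?r c2 * x $ 2 + ?r c3 * x $ 3 + ?r c4 * x $ 4"
      note M = minor_times_inner[OF x D[folded det3_of_int]]
      have "?r (a1 * b2) \<noteq> ?r (a2 * b1) \<or> ?r (a1 * b3) \<noteq> ?r (a3 * b1) \<or> ?r (a1 * b4) \<noteq> ?r (a4 * b1) \<or>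
          ?r (a2 * b3) \<noteq> ?r (a3 * b2) \<or> ?r (a2 * b4) \<noteq> ?r (a4 * b2) \<or> ?r (a3 * b4) \<noteq> ?r (a4 * b3)"
        using np unfolding uvw parallel.simps of_int_eq_iff by blast
      then have "?w = 0"
        unfolding of_int_mult using M by (metis eq_iff_diff_eq_0 mult_eq_0_iff)
      then show "x \<in> hyp (V w)"
        by (simp only: uvw hyp_V mem_Collect_eq)
    qed
  qed
qed

lemma triple_Int_hyp:
  assumes n: "cross4 u v w \<noteq> (0, 0, 0, 0)"
  shows "hyp (V u) \<inter> hyp (V v) \<inter> hyp (V w) = span {V (cross4 u v w)}"
proof -
  obtain a1 a2 a3 a4 where u: "u = (a1, a2, a3, a4)" by (cases u)
  obtain b1 b2 b3 b4 where v: "v = (b1, b2, b3, b4)" by (cases v)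
  obtain c1 c2 c3 c4 where w: "w = (c1, c2, c3, c4)" by (cases w)
  let ?r = "real_of_int"
  note uvw = u v w
  define p q r s where "p = ?r (det3 (a2, a3, a4) (b2, b3, b4) (c2, c3, c4))"
    and "q = - ?r (det3 (a1, a3, a4) (b1, b3, b4) (c1, c3, c4))"
    and "r = ?r (det3 (a1, a2, a4) (b1, b2, b4) (c1, c2, c4))"
    and "s = - ?r (det3 (a1, a2, a3) (b1, b2, b3) (c1, c2, c3))"
  have V: "V (cross4 u v w) = rvec p q r s"
    unfolding uvw p_def q_def r_def s_def cross4.simps V.simps of_int_minus ..
  have nz: "p \<noteq> 0 \<or> q \<noteq> 0 \<or> r \<noteq> 0 \<or> s \<noteq> 0"
    using n unfolding uvw p_def q_def r_def s_def cross4.simps by (simp del: det3.simps)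
  show ?thesis
  proof (intro set_eqI iffI)
    fix x
    assume "x \<in> hyp (V u) \<inter> hyp (V v) \<inter> hyp (V w)"
    then have x: "?r a1 * x $ 1 + ?r a2 * x $ 2 + ?r a3 * x $ 3 + ?r a4 * x $ 4 = 0"
        "?r b1 * x $ 1 + ?r b2 * x $ 2 + ?r b3 * x $ 3 + ?r b4 * x $ 4 = 0"
        "?r c1 * x $ 1 + ?r c2 * x $ 2 + ?r c3 * x $ 3 + ?r c4 * x $ 4 = 0"
      by (simp_all only: uvw hyp_V Int_iff mem_Collect_eq)
    note C = cramer[OF x, unfolded det3_of_int]
    have E: "p * x $ 2 = q * x $ 1" "p * x $ 3 = r * x $ 1" "p * x $ 4 = s * x $ 1"
        "q * x $ 3 = r * x $ 2" "q * x $ 4 = s * x $ 2" "r * x $ 4 = s * x $ 3"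
      using C unfolding p_def q_def r_def s_def by (simp_all del: det3.simps)
    have "\<exists>t. x = t *\<^sub>R rvec p q r s"
      using nz
    proof (elim disjE)
      assume "p \<noteq> 0"
      then show ?thesis
        using E by (intro exI[of _ "x $ 1 / p"]) (simp add: vec4_eq_iff rvec_nth field_simps)
    next
      assume "q \<noteq> 0"
      then show ?thesis
        using E by (intro exI[of _ "x $ 2 / q"]) (simp add: vec4_eq_iff rvec_nth field_simps)
    next
      assume "r \<noteq> 0"
      then show ?thesis
        using E by (intro exI[of _ "x $ 3 / r"]) (simp add: vec4_eq_iff rvec_nth field_simps)
    next
      assume "s \<noteq> 0"
      then show ?thesis
        using E by (intro exI[of _ "x $ 4 / s"]) (simp add: vec4_eq_iff rvec_nth field_simps)
    qed
    then show "x \<in> span {V (cross4 u v w)}"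
      unfolding V span_singleton by blast
  next
    fix x
    assume "x \<in> span {V (cross4 u v w)}"
    then obtain t where t: "x = t *\<^sub>R V (cross4 u v w)"
      by (auto simp: span_singleton)
    have "dot u (cross4 u v w) = 0" "dot v (cross4 u v w) = 0" "dot w (cross4 u v w) = 0"
      unfolding uvw by (simp_all add: algebra_simps)
    then have "V u \<bullet> x = 0" "V v \<bullet> x = 0" "V w \<bullet> x = 0"
      unfolding t by (simp_all add: V_inner_V)
    then show "x \<in> hyp (V u) \<inter> hyp (V v) \<inter> hyp (V w)"
      by (simp add: hyp_def)
  qed
qed

section \<open>Enumeration of pairs and triples\<close>

lemma pairs_mem: "(u, v) \<in> set (pairs L) \<Longrightarrow> u \<in> set L \<and> v \<in> set L"
  by (induction L) auto

lemma pairs_distinct: "distinct L \<Longrightarrow> (u, v) \<in> set (pairs L) \<Longrightarrow> u \<noteq> v"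
  by (induction L) (auto dest: pairs_mem)

lemma pairs_ex: "u \<in> set L \<Longrightarrow> v \<in> set L \<Longrightarrow> u \<noteq> v \<Longrightarrow> (u, v) \<in> set (pairs L) \<or> (v, u) \<in> set (pairs L)"
  by (induction L) auto

lemma triples_mem: "(u, v, w) \<in> set (triples L) \<Longrightarrow> u \<in> set L \<and> v \<in> set L \<and> w \<in> set L"
  by (induction L) (auto dest: pairs_mem)

lemma triples_distinct: "distinct L \<Longrightarrow> (u, v, w) \<in> set (triples L) \<Longrightarrow> u \<noteq> v \<and> u \<noteq> w \<and> v \<noteq> w"
  by (induction L) (auto dest: pairs_mem pairs_distinct triples_mem)

lemma triples_ex:
  "u \<in> set L \<Longrightarrow> v \<in> set L \<Longrightarrow> w \<in> set L \<Longrightarrow> u \<noteq> v \<Longrightarrow> u \<noteq> w \<Longrightarrow> v \<noteq> w \<Longrightarrow>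
    \<exists>u' v' w'. (u', v', w') \<in> set (triples L) \<and> {u', v', w'} = {u, v, w}"
proof (induction L)
  case (Cons x L)
  have pr: "\<exists>u' v' w'. (u', v', w') \<in> set (triples (x # L)) \<and> {u', v', w'} = {x, y, z}"
    if "y \<in> set L" "z \<in> set L" "y \<noteq> z" for y z
    using pairs_ex[OF that]
  proof
    assume "(y, z) \<in> set (pairs L)"
    then show ?thesis
      by (intro exI[of _ x] exI[of _ y] exI[of _ z]) auto
  next
    assume "(z, y) \<in> set (pairs L)"
    then show ?thesis
      by (intro exI[of _ x] exI[of _ z] exI[of _ y]) auto
  qed
  consider "u = x" | "v = x" | "w = x" | "u \<in> set L" "v \<in> set L" "w \<in> set L"
    using Cons.prems by auto
  then show ?case
  proof cases
    case 1
    then show ?thesis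
      using pr[of v w] Cons.prems by auto
  next
    case 2
    then show ?thesis
      using pr[of u w] Cons.prems by (auto simp: insert_commute)
  next
    case 3
    then show ?thesis
      using pr[of u v] Cons.prems by (auto simp: insert_commute)
  next
    case 4
    then show ?thesis
      using Cons.IH Cons.prems(4-6) by auto
  qed
qed simp

lemma set_line_list: "set (line_list L) = (\<lambda>(u, v). filter (\<lambda>w. cross4 u v w = (0, 0, 0, 0)) L) ` set (pairs L)"
  by (simp add: line_list_def)

lemma set_vertex_list: "set (vertex_list L) = (\<lambda>n. filter (\<lambda>w. dot w n = 0) L) `
    {n \<in> (\<lambda>(u, v, w). cross4 u v w) ` set (triples L). n \<noteq> (0, 0, 0, 0)}"
  unfolding vertex_list_def set_remdups set_map set_filter ..

lemma parallel_sym: "parallel u v \<longleftrightarrow> parallel v u"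
  by (cases u; cases v) (auto simp: mult.commute)

lemma hyp_V_eq_imp_parallel:
  assumes "hyp (V u) = hyp (V v)" "V u \<noteq> 0" "V v \<noteq> 0"
  shows "parallel u v"
proof -
  obtain a1 a2 a3 a4 where u: "u = (a1, a2, a3, a4)" by (cases u)
  obtain b1 b2 b3 b4 where v: "v = (b1, b2, b3, b4)" by (cases v)
  obtain s where "V v = s *\<^sub>R V u"
    using hyp_eqD[OF assms] .
  then have "real_of_int b1 = s * of_int a1" "real_of_int b2 = s * of_int a2"
      "real_of_int b3 = s * of_int a3" "real_of_int b4 = s * of_int a4"
    by (simp_all add: u v vec4_eq_iff rvec_nth)
  then have "real_of_int (a1 * b2) = of_int (a2 * b1)" "real_of_int (a1 * b3) = of_int (a3 * b1)"
      "real_of_int (a1 * b4) = of_int (a4 * b1)" "real_of_int (a2 * b3) = of_int (a3 * b2)"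
      "real_of_int (a2 * b4) = of_int (a4 * b2)" "real_of_int (a3 * b4) = of_int (a4 * b3)"
    by simp_all
  then show ?thesis
    unfolding of_int_eq_iff u v by simp
qed

section \<open>Flats encoded by lists of roots\<close>

locale int_arr =
  fixes L :: "ivec list"
  assumes dist: "distinct L" and np: "list_all (\<lambda>(u, v). \<not> parallel u v) (pairs L)"
    and arr_L: "arrangement (hyp ` V ` set L)"
begin

definition B :: "vec4 set set" where
  "B = hyp ` V ` set L"

sublocale linear_arrangement B
  by (rule linear_arrangement.intro) (use arr_L in \<open>simp add: B_def\<close>)

definition idx :: "vec4 set \<Rightarrow> ivec list" where
  "idx X = filter (\<lambda>u. X \<subseteq> hyp (V u)) L"

lemma hyp_in_B: "u \<in> set L \<Longrightarrow> hyp (V u) \<in> B"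
  by (simp add: B_def)

lemma in_B_E:
  assumes "H \<in> B"
  obtains u where "u \<in> set L" "H = hyp (V u)"
  using assms unfolding B_def by blast

lemma not_parallel: "u \<in> set L \<Longrightarrow> v \<in> set L \<Longrightarrow> u \<noteq> v \<Longrightarrow> \<not> parallel u v"
  using pairs_ex[of u L v] np parallel_sym[of u v] by (auto simp: list_all_iff)

lemma V_nonzero: "u \<in> set L \<Longrightarrow> V u \<noteq> 0"
proof
  assume u: "u \<in> set L" "V u = 0"
  then have "hyp (V u) = UNIV"
    by (simp add: hyp_def)
  moreover have "dim (hyp (V u)) = 3"
    by (rule hyperplane_dim[OF hyp_in_B[OF u(1)]])
  ultimately show False by simp
qed

lemma hyp_V_inj: "u \<in> set L \<Longrightarrow> v \<in> set L \<Longrightarrow> hyp (V u) = hyp (V v) \<Longrightarrow> u = v"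
  using hyp_V_eq_imp_parallel[OF _ V_nonzero V_nonzero] not_parallel by blast

lemma inj_hyp_V: "inj_on (\<lambda>u. hyp (V u)) (set L)"
  by (rule inj_onI) (rule hyp_V_inj)

lemma weight_idx: "weight B X = length (idx X)"
proof -
  have "{H \<in> B. X \<subseteq> H} = (\<lambda>u. hyp (V u)) ` set (idx X)"
    by (auto simp: B_def idx_def)
  moreover have "inj_on (\<lambda>u. hyp (V u)) (set (idx X))"
    by (rule inj_on_subset[OF inj_hyp_V]) (simp add: idx_def)
  moreover have "distinct (idx X)"
    using dist by (simp add: idx_def)
  ultimately show ?thesis
    by (simp add: weight_def card_image distinct_card)
qed

lemma flat_idx: "X \<in> int_lattice B \<Longrightarrow> X = (\<Inter>u\<in>set (idx X). hyp (V u))"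
proof -
  assume "X \<in> int_lattice B"
  then obtain C where C: "C \<subseteq> B" "X = \<Inter>C"
    by (auto simp: int_lattice_def)
  have "C \<subseteq> (\<lambda>u. hyp (V u)) ` set (idx X)"
  proof
    fix H
    assume H: "H \<in> C"
    then obtain u where "u \<in> set L" "H = hyp (V u)"
      using C(1) in_B_E by (metis subsetD)
    moreover have "X \<subseteq> H"
      using C(2) H by auto
    ultimately show "H \<in> (\<lambda>u. hyp (V u)) ` set (idx X)"
      by (auto simp: idx_def)
  qed
  then have "(\<Inter>u\<in>set (idx X). hyp (V u)) \<subseteq> X"
    unfolding C(2) by (rule Inter_anti_mono)
  moreover have "X \<subseteq> (\<Inter>u\<in>set (idx X). hyp (V u))"
    by (auto simp: idx_def)
  ultimately show ?thesis
    by (rule equalityI[rotated])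
qed

text \<open>A flat is the intersection of all hyperplanes containing it, so the encoding is faithful
  and reverses inclusion.\<close>

lemma subset_idx:
  assumes "X \<in> int_lattice B" "Y \<in> int_lattice B"
  shows "X \<subseteq> Y \<longleftrightarrow> set (idx Y) \<subseteq> set (idx X)"
proof
  assume "X \<subseteq> Y"
  then show "set (idx Y) \<subseteq> set (idx X)"
    by (auto simp: idx_def)
next
  assume "set (idx Y) \<subseteq> set (idx X)"
  then have "(\<Inter>u\<in>set (idx X). hyp (V u)) \<subseteq> (\<Inter>u\<in>set (idx Y). hyp (V u))"
    by (intro INF_superset_mono) auto
  then show "X \<subseteq> Y"
    using flat_idx[OF assms(1)] flat_idx[OF assms(2)] by simp
qed

lemma idx_inj: "inj_on idx (int_lattice B)"
  by (rule inj_onI) (metis subset_idx order_antisym subset_refl)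

lemma idx_line:
  assumes "u \<in> set L" "v \<in> set L" "u \<noteq> v"
  shows "idx (hyp (V u) \<inter> hyp (V v)) = filter (\<lambda>w. cross4 u v w = (0, 0, 0, 0)) L"
  unfolding idx_def Int_hyp_subset_iff[OF not_parallel[OF assms]] ..

text \<open>The integer computation enumerates precisely the lines. With injectivity of
  \<open>idx\<close>, sums over lines become sums over a computable list.\<close>

lemma idx_lines: "idx ` lines B = set (line_list L)"
proof (intro set_eqI iffI)
  fix I
  assume "I \<in> idx ` lines B"
  then obtain H K where HK: "H \<in> B" "K \<in> B" "H \<noteq> K" "I = idx (H \<inter> K)"
    unfolding lines_eq by blast
  then obtain u v where uv: "u \<in> set L" "v \<in> set L" "H = hyp (V u)" "K = hyp (V v)"
    using in_B_E[OF HK(1)] in_B_E[OF HK(2)] by metis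
  then have "u \<noteq> v"
    using HK by auto
  have "\<exists>p q. (p, q) \<in> set (pairs L) \<and> I = filter (\<lambda>w. cross4 p q w = (0, 0, 0, 0)) L"
    using pairs_ex[OF uv(1,2) \<open>u \<noteq> v\<close>]
  proof
    assume "(u, v) \<in> set (pairs L)"
    moreover have "I = filter (\<lambda>w. cross4 u v w = (0, 0, 0, 0)) L"
      using idx_line[OF uv(1,2) \<open>u \<noteq> v\<close>] HK(4) uv(3,4) by simp
    ultimately show ?thesis by blast
  next
    assume "(v, u) \<in> set (pairs L)"
    moreover have "I = filter (\<lambda>w. cross4 v u w = (0, 0, 0, 0)) L"
      using idx_line[OF uv(2,1) \<open>u \<noteq> v\<close>[symmetric]] HK(4) uv(3,4) by (simp add: Int_commute)
    ultimately show ?thesis by blast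
  qed
  then obtain p q where pq: "(p, q) \<in> set (pairs L)" "I = filter (\<lambda>w. cross4 p q w = (0, 0, 0, 0)) L"
    by blast
  show "I \<in> set (line_list L)"
    unfolding set_line_list by (rule image_eqI[OF _ pq(1)]) (simp add: pq(2))
next
  fix I
  assume "I \<in> set (line_list L)"
  then obtain p where p: "I = (case p of (u, v) \<Rightarrow> filter (\<lambda>w. cross4 u v w = (0, 0, 0, 0)) L)" "p \<in> set (pairs L)"
    unfolding set_line_list by (rule imageE)
  obtain u v where "p = (u, v)" by (rule prod.exhaust)
  with p have uv: "(u, v) \<in> set (pairs L)" "I = filter (\<lambda>w. cross4 u v w = (0, 0, 0, 0)) L"
    by simp_all
  have m: "u \<in> set L" "v \<in> set L" "u \<noteq> v"
    using pairs_mem[OF uv(1)] pairs_distinct[OF dist uv(1)] by auto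
  then have "hyp (V u) \<inter> hyp (V v) \<in> lines B"
    unfolding lines_eq using hyp_in_B[OF m(1)] hyp_in_B[OF m(2)] hyp_V_inj[OF m(1,2)] m(3) by blast
  then show "I \<in> idx ` lines B"
    unfolding uv(2) idx_line[OF m, symmetric] by (rule imageI)
qed

lemma idx_vertices: "idx ` vertices B = set (vertex_list L)"
proof -
  let ?I = "\<lambda>n. filter (\<lambda>w. dot w n = 0) L"
  have idx: "idx (span {V n}) = ?I n" for n
  proof -
    have "span {V n} \<subseteq> hyp (V w) \<longleftrightarrow> dot w n = 0" for w
    proof -
      have "subspace (hyp (V w))"
        by (simp add: hyp_def subspace_hyperplane)
      then have "span {V n} \<subseteq> hyp (V w) \<longleftrightarrow> V n \<in> hyp (V w)"
        using span_minimal[of "{V n}" "hyp (V w)"] span_base[of "V n" "{V n}"] by auto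
      also have "\<dots> \<longleftrightarrow> dot w n = 0"
        by (simp add: hyp_def V_inner_V)
      finally show ?thesis .
    qed
    then show ?thesis
      by (simp add: idx_def)
  qed
  show ?thesis
  proof (intro set_eqI iffI)
    fix I
    assume "I \<in> idx ` vertices B"
    then obtain X H K M where X: "I = idx X" "dim X = 1" "X = H \<inter> K \<inter> M"
      and HKM: "H \<in> B" "K \<in> B" "M \<in> B" "H \<noteq> K" "H \<noteq> M" "K \<noteq> M"
      unfolding vertices_eq by blast
    obtain u v w where uvw: "u \<in> set L" "v \<in> set L" "w \<in> set L" "H = hyp (V u)" "K = hyp (V v)" "M = hyp (V w)"
      using in_B_E[OF HKM(1)] in_B_E[OF HKM(2)] in_B_E[OF HKM(3)] by metis
    then have "u \<noteq> v" "u \<noteq> w" "v \<noteq> w"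
      using HKM by auto
    then obtain u' v' w' where t: "(u', v', w') \<in> set (triples L)" "{u', v', w'} = {u, v, w}"
      using triples_ex[OF uvw(1-3)] by blast
    have "X = (\<Inter>z\<in>{u, v, w}. hyp (V z))"
      using X uvw by auto
    also have "\<dots> = hyp (V u') \<inter> hyp (V v') \<inter> hyp (V w')"
      unfolding t(2)[symmetric] by auto
    finally have X': "X = hyp (V u') \<inter> hyp (V v') \<inter> hyp (V w')" .
    have m: "u' \<in> set L" "v' \<in> set L" "w' \<in> set L" "u' \<noteq> v'"
      using triples_mem[OF t(1)] triples_distinct[OF dist t(1)] by auto
    \<comment> \<open>Dependent normals would make the intersection a line instead of a
      vertex.\<close>
    have nz: "cross4 u' v' w' \<noteq> (0, 0, 0, 0)"
    proof
      assume "cross4 u' v' w' = (0, 0, 0, 0)"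
      then have "X = hyp (V u') \<inter> hyp (V v')"
        using Int_hyp_subset_iff[OF not_parallel[OF m(1,2,4)], of w'] X' by auto
      moreover have "dim (hyp (V u') \<inter> hyp (V v')) = 2"
        using m hyp_V_inj[OF m(1,2)] by (intro line_dim hyp_in_B) blast+
      ultimately show False
        using X(2) by simp
    qed
    have "I = ?I (cross4 u' v' w')"
      using X(1) X' triple_Int_hyp[OF nz] idx by simp
    moreover have "cross4 u' v' w' \<in> (\<lambda>(u, v, w). cross4 u v w) ` set (triples L)"
      by (rule image_eqI[OF _ t(1)]) simp
    ultimately show "I \<in> set (vertex_list L)"
      unfolding set_vertex_list using nz by blast
  next
    fix I
    assume "I \<in> set (vertex_list L)"
    then obtain n where n: "I = ?I n" "n \<in> (\<lambda>(u, v, w). cross4 u v w) ` set (triples L)" "n \<noteq> (0, 0, 0, 0)"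
      unfolding set_vertex_list by blast
    from n(2) obtain p where p: "n = (case p of (u, v, w) \<Rightarrow> cross4 u v w)" "p \<in> set (triples L)"
      by (rule imageE)
    obtain u v w where "p = (u, v, w)" by (rule prod_cases3)
    with p n have t: "(u, v, w) \<in> set (triples L)" and nz: "cross4 u v w \<noteq> (0, 0, 0, 0)"
      and I: "I = ?I (cross4 u v w)"
      by simp_all
    have m: "u \<in> set L" "v \<in> set L" "w \<in> set L" "u \<noteq> v" "u \<noteq> w" "v \<noteq> w"
      using triples_mem[OF t(1)] triples_distinct[OF dist t(1)] by auto
    let ?X = "hyp (V u) \<inter> hyp (V v) \<inter> hyp (V w)"
    have eq: "?X = span {V (cross4 u v w)}"
      by (rule triple_Int_hyp[OF nz])
    have "V (cross4 u v w) \<noteq> 0"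
      using nz by (cases "cross4 u v w") (auto simp: vec4_eq_iff rvec_nth)
    then have "dim ?X = 1"
      by (simp add: eq dim_span)
    then have "?X \<in> vertices B"
      unfolding vertices_eq
      using hyp_in_B[OF m(1)] hyp_in_B[OF m(2)] hyp_in_B[OF m(3)] hyp_V_inj[OF m(1,2)]
        hyp_V_inj[OF m(1,3)] hyp_V_inj[OF m(2,3)] m(4-6) by blast
    moreover have "idx ?X = I"
      unfolding eq I by (rule idx)
    ultimately show "I \<in> idx ` vertices B"
      by (metis imageI)
  qed
qed

lemma lines_flat: "lines B \<subseteq> int_lattice B" and vertices_flat: "vertices B \<subseteq> int_lattice B"
  by (auto simp: lines_def vertices_def)

lemma sum_lines: "sum (\<lambda>X. h (idx X)) {X \<in> lines B. P (idx X)} = sum h {I \<in> set (line_list L). P I}"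
proof -
  have "{I \<in> set (line_list L). P I} = idx ` {X \<in> lines B. P (idx X)}"
    unfolding idx_lines[symmetric] by auto
  moreover have "inj_on idx {X \<in> lines B. P (idx X)}"
    using idx_inj by (rule inj_on_subset) (use lines_flat in auto)
  ultimately show ?thesis
    by (simp add: sum.reindex o_def)
qed

lemma line_sum_eq: "of_int (line_sum (filter P (line_list L))) = (\<Sum>I\<in>{I \<in> set (line_list L). P I}. real (length I) - 1)"
proof -
  have "distinct (filter P (line_list L))"
    by (simp add: line_list_def)
  then have "line_sum (filter P (line_list L)) = (\<Sum>I\<in>set (filter P (line_list L)). int (length I) - 1)"
    unfolding line_sum_def by (rule sum_list_distinct_conv_sum_set)
  then show ?thesis
    by simp
qed

lemma char_poly_B:
  "char_poly B = [:of_int (int (length L) - 1 - line_sum (line_list L) + vertex_sum (line_list L) (vertex_list L)),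
     of_int (- vertex_sum (line_list L) (vertex_list L)), of_int (line_sum (line_list L)), of_int (- int (length L)), 1:]"
proof -
  have card: "card B = length L"
  proof -
    have "B = (\<lambda>u. hyp (V u)) ` set L"
      by (simp add: B_def image_image)
    then show ?thesis
      using dist card_image[OF inj_hyp_V] by (simp add: distinct_card)
  qed
  have a: "(\<Sum>Y\<in>lines B. real (weight B Y) - 1) = of_int (line_sum (line_list L))"
    using sum_lines[of "\<lambda>I. real (length I) - 1" "\<lambda>_. True"] line_sum_eq[of "\<lambda>_. True"]
    by (simp add: weight_idx)
  let ?g = "\<lambda>J. 1 - int (length J) + line_sum (filter (\<lambda>I. set I \<subseteq> set J) (line_list L))"
  have v: "vmob X = - of_int (?g (idx X))" if X: "X \<in> vertices B" for X
  proof -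
    have "{Y \<in> lines B. X \<subseteq> Y} = {Y \<in> lines B. set (idx Y) \<subseteq> set (idx X)}"
      using subset_idx X lines_flat vertices_flat by blast
    then have "(\<Sum>Y\<in>{Y \<in> lines B. X \<subseteq> Y}. real (weight B Y) - 1) =
        of_int (line_sum (filter (\<lambda>I. set I \<subseteq> set (idx X)) (line_list L)))"
      using sum_lines[of "\<lambda>I. real (length I) - 1" "\<lambda>I. set I \<subseteq> set (idx X)"]
        line_sum_eq[of "\<lambda>I. set I \<subseteq> set (idx X)"]
      by (simp add: weight_idx)
    then show ?thesis
      by (simp add: vmob_def weight_idx)
  qed
  have "(\<Sum>Y\<in>vertices B. vmob Y) = - (\<Sum>X\<in>vertices B. of_int (?g (idx X)))"
    unfolding sum_negf[symmetric] by (rule sum.cong[OF refl v])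
  also have "(\<Sum>X\<in>vertices B. of_int (?g (idx X))) = (\<Sum>J\<in>idx ` vertices B. of_int (?g J) :: real)"
    using inj_on_subset[OF idx_inj vertices_flat] by (simp add: sum.reindex)
  also have "\<dots> = of_int (\<Sum>J\<in>set (vertex_list L). ?g J)"
    by (simp add: idx_vertices)
  also have "(\<Sum>J\<in>set (vertex_list L). ?g J) = vertex_sum (line_list L) (vertex_list L)"
    unfolding vertex_sum_def by (rule sum_list_distinct_conv_sum_set[symmetric]) (simp add: vertex_list_def)
  finally have b: "(\<Sum>Y\<in>vertices B. vmob Y) = - of_int (vertex_sum (line_list L) (vertex_list L))" .
  show ?thesis
    unfolding char_poly_eq a b card by simp
qed

lemma h_num_B: "h_num B i = length (filter (\<lambda>I. length I = i) (line_list L))"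
proof -
  have "card {X \<in> lines B. length (idx X) = i} = card {I \<in> set (line_list L). length I = i}"
    using sum_lines[of "\<lambda>_. 1 :: nat" "\<lambda>I. length I = i"] by simp
  also have "{I \<in> set (line_list L). length I = i} = set (filter (\<lambda>I. length I = i) (line_list L))"
    by auto
  also have "card \<dots> = length (filter (\<lambda>I. length I = i) (line_list L))"
    by (rule distinct_card) (simp add: line_list_def)
  finally show ?thesis
    by (simp add: h_num_def weight_idx)
qed

lemma line_weight_le:
  assumes "list_all (\<lambda>I. length I \<le> 3) (line_list L)" "H \<in> B" "K \<in> B" "H \<noteq> K"
  shows "weight B (H \<inter> K) \<le> 3"
proof -
  have "H \<inter> K \<in> lines B"
    unfolding lines_eq using assms(2-4) by blast
  then have "idx (H \<inter> K) \<in> set (line_list L)"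
    using idx_lines by blast
  then show ?thesis
    using assms(1) by (simp add: weight_idx list_all_iff)
qed

lemma grunbaum_shephard_B:
  assumes le: "list_all (\<lambda>I. length I \<le> 3) (line_list L)"
    and lt: "length (filter (\<lambda>I. length I = 3) (line_list L)) < length (filter (\<lambda>I. length I = 2) (line_list L))"
  shows "grunbaum_shephard B"
proof -
  have z: "h_num B i = 0" if "i > 3" for i
  proof -
    have "filter (\<lambda>I. length I = i) (line_list L) = []"
      using le that by (auto simp: filter_empty_conv list_all_iff)
    then show ?thesis
      by (simp add: h_num_B)
  qed
  \<comment> \<open>Only \<open>i = 3\<close> contributes; the bound also holds when the index range
    is empty.\<close>
  have "(\<Sum>i\<in>{3..card B}. h_num B i) \<le> (\<Sum>i\<in>{3..card B}. if i = 3 then h_num B 3 else 0)"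
    by (rule sum_mono) (auto simp: z)
  also have "\<dots> \<le> h_num B 3"
    by (simp add: sum.delta)
  also have "\<dots> < h_num B 2"
    using lt by (simp add: h_num_B)
  finally show ?thesis
    by (simp add: grunbaum_shephard_def)
qed

end

section \<open>The arrangements of type $A_4$ and $D_4$\<close>

text \<open>Listed in the order of \<open>path_roots\<close>, so that both sets unfold to the same
  term. The first entry is the normal of \<open>x_4 = x_5\<close> after eliminating
  \<open>x_5\<close>.\<close>

definition roots_A4 :: "ivec list" where
  "roots_A4 = [(1, 1, 1, 2), (1, 1, 2, 1), (1, 2, 1, 1), (2, 1, 1, 1), (0, 0, 1, -1), (0, 1, 0, -1),
     (1, 0, 0, -1), (0, 1, -1, 0), (1, 0, -1, 0), (1, -1, 0, 0)]"

definition roots_D4 :: "ivec list" where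
  "roots_D4 = [(0, 0, 1, 1), (0, 0, 1, -1), (1, -1, 0, 0), (1, 0, 1, 0), (1, 0, 0, -1), (1, 0, 0, 1),
     (0, 1, 1, 0), (1, 1, 0, 0), (0, 1, 0, 1), (0, 1, 0, -1), (1, 0, -1, 0), (0, 1, -1, 0)]"

lemma V_add: "V (a, b, c, d) + V (a', b', c', d') = V (a + a', b + b', c + c', d + d')"
  by (simp add: vec4_eq_iff rvec_nth)

lemma V_double: "2 *\<^sub>R V (a, b, c, d) = V (2 * a, 2 * b, 2 * c, 2 * d)"
  by (simp add: vec4_eq_iff rvec_nth)

lemma path_roots_A4:
  "path_roots (V (1, -1, 0, 0)) (V (0, 1, -1, 0)) (V (0, 0, 1, -1)) (V (1, 1, 1, 2)) = V ` set roots_A4"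
  by (simp add: path_roots_def roots_A4_def V_add del: V.simps)

lemma star_roots_D4:
  "star_roots (V (1, -1, 0, 0)) (V (0, 1, -1, 0)) (V (0, 0, 1, -1)) (V (0, 0, 1, 1)) = V ` set roots_D4"
  by (simp add: star_roots_def roots_D4_def V_add V_double del: V.simps)

lemma independent_A4: "independent4 (V (1, -1, 0, 0)) (V (0, 1, -1, 0)) (V (0, 0, 1, -1)) (V (1, 1, 1, 2))"
  by (simp add: independent4_def rvec_inner vec4_eq_iff)

lemma independent_D4: "independent4 (V (1, -1, 0, 0)) (V (0, 1, -1, 0)) (V (0, 0, 1, -1)) (V (0, 0, 1, 1))"
  by (simp add: independent4_def rvec_inner vec4_eq_iff)

lemma axis_diff_V:
  "axis 1 1 - axis 2 1 = V (1, -1, 0, 0)"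
  "axis 1 1 - axis 3 1 = V (1, 0, -1, 0)"
  "axis 1 1 - axis 4 1 = V (1, 0, 0, -1)"
  "axis 2 1 - axis 1 1 = - V (1, -1, 0, 0)"
  "axis 2 1 - axis 3 1 = V (0, 1, -1, 0)"
  "axis 2 1 - axis 4 1 = V (0, 1, 0, -1)"
  "axis 3 1 - axis 1 1 = - V (1, 0, -1, 0)"
  "axis 3 1 - axis 2 1 = - V (0, 1, -1, 0)"
  "axis 3 1 - axis 4 1 = V (0, 0, 1, -1)"
  "axis 4 1 - axis 1 1 = - V (1, 0, 0, -1)"
  "axis 4 1 - axis 2 1 = - V (0, 1, 0, -1)"
  "axis 4 1 - axis 3 1 = - V (0, 0, 1, -1)"
  by (simp_all add: vec4_eq_iff rvec_nth axis_def)

lemma axis_ones_V: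
  "axis 1 1 + (\<chi> k. 1) = V (2, 1, 1, 1)"
  "axis 2 1 + (\<chi> k. 1) = V (1, 2, 1, 1)"
  "axis 3 1 + (\<chi> k. 1) = V (1, 1, 2, 1)"
  "axis 4 1 + (\<chi> k. 1) = V (1, 1, 1, 2)"
  by (simp_all add: vec4_eq_iff rvec_nth axis_def)

lemma axis_sum_V:
  "axis 1 1 + axis 2 1 = V (1, 1, 0, 0)"
  "axis 1 1 + axis 3 1 = V (1, 0, 1, 0)"
  "axis 1 1 + axis 4 1 = V (1, 0, 0, 1)"
  "axis 2 1 + axis 1 1 = V (1, 1, 0, 0)"
  "axis 2 1 + axis 3 1 = V (0, 1, 1, 0)"
  "axis 2 1 + axis 4 1 = V (0, 1, 0, 1)"
  "axis 3 1 + axis 1 1 = V (1, 0, 1, 0)"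
  "axis 3 1 + axis 2 1 = V (0, 1, 1, 0)"
  "axis 3 1 + axis 4 1 = V (0, 0, 1, 1)"
  "axis 4 1 + axis 1 1 = V (1, 0, 0, 1)"
  "axis 4 1 + axis 2 1 = V (0, 1, 0, 1)"
  "axis 4 1 + axis 3 1 = V (0, 0, 1, 1)"
  by (simp_all add: vec4_eq_iff rvec_nth axis_def)

lemma ex_four: "(\<exists>i :: 4. Q i) \<longleftrightarrow> Q 1 \<or> Q 2 \<or> Q 3 \<or> Q 4"
  using forall_4[of "\<lambda>i. \<not> Q i"] by blast

lemma ex_distinct_four: "(\<exists>i j :: 4. i \<noteq> j \<and> P i j) \<longleftrightarrow>
    P 1 2 \<or> P 1 3 \<or> P 1 4 \<or> P 2 1 \<or> P 2 3 \<or> P 2 4 \<or> P 3 1 \<or> P 3 2 \<or> P 3 4 \<or> P 4 1 \<or> P 4 2 \<or> P 4 3"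
  by (simp add: ex_four)

lemma arr_A4_eq: "arr_A4 = hyp ` V ` set roots_A4"
proof -
  have "arr_A4 = hyp ` {a. (\<exists>i j. i \<noteq> j \<and> a = axis i 1 - axis j 1) \<or> (\<exists>i. a = axis i 1 + (\<chi> k. 1))}"
    unfolding arr_A4_def setcompr_eq_image by (simp only: hyp_def[abs_def])
  also have "{a. (\<exists>i j :: 4. i \<noteq> j \<and> a = axis i 1 - axis j 1) \<or> (\<exists>i. a = axis i 1 + (\<chi> k. 1))} =
      {V (1, -1, 0, 0), V (1, 0, -1, 0), V (1, 0, 0, -1), - V (1, -1, 0, 0),
       V (0, 1, -1, 0), V (0, 1, 0, -1), - V (1, 0, -1, 0), - V (0, 1, -1, 0),
       V (0, 0, 1, -1), - V (1, 0, 0, -1), - V (0, 1, 0, -1), - V (0, 0, 1, -1),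
       V (2, 1, 1, 1), V (1, 2, 1, 1), V (1, 1, 2, 1), V (1, 1, 1, 2)}"
    unfolding ex_distinct_four unfolding ex_four axis_diff_V axis_ones_V
    by (rule set_eqI) (simp only: mem_Collect_eq insert_iff empty_iff disj_assoc simp_thms)
  also have "hyp ` \<dots> = hyp ` V ` set roots_A4"
    unfolding roots_A4_def by (intro equalityI) (simp_all add: hyp_minus del: V.simps)
  finally show ?thesis .
qed

lemma arr_D4_eq: "arr_D4 = hyp ` V ` set roots_D4"
proof -
  have "arr_D4 = hyp ` {a. \<exists>i j. i \<noteq> j \<and> (a = axis i 1 - axis j 1 \<or> a = axis i 1 + axis j 1)}"
    unfolding arr_D4_def setcompr_eq_image by (simp only: hyp_def[abs_def])
  also have "{a. \<exists>i j :: 4. i \<noteq> j \<and> (a = axis i 1 - axis j 1 \<or> a = axis i 1 + axis j 1)} =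
      {V (1, -1, 0, 0), V (1, 1, 0, 0), V (1, 0, -1, 0), V (1, 0, 1, 0),
       V (1, 0, 0, -1), V (1, 0, 0, 1), - V (1, -1, 0, 0), V (1, 1, 0, 0),
       V (0, 1, -1, 0), V (0, 1, 1, 0), V (0, 1, 0, -1), V (0, 1, 0, 1),
       - V (1, 0, -1, 0), V (1, 0, 1, 0), - V (0, 1, -1, 0), V (0, 1, 1, 0),
       V (0, 0, 1, -1), V (0, 0, 1, 1), - V (1, 0, 0, -1), V (1, 0, 0, 1),
       - V (0, 1, 0, -1), V (0, 1, 0, 1), - V (0, 0, 1, -1), V (0, 0, 1, 1)}"
    unfolding ex_distinct_four axis_diff_V axis_sum_V
    by (rule set_eqI) (simp only: mem_Collect_eq insert_iff empty_iff disj_assoc simp_thms)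
  also have "hyp ` \<dots> = hyp ` V ` set roots_D4"
    unfolding roots_D4_def by (intro equalityI) (simp_all add: hyp_minus del: V.simps)
  finally show ?thesis .
qed

section \<open>Evaluation of the two models\<close>

lemma arrangement_if_independent4:
  assumes "independent4 a b c d" "finite S" "0 \<notin> S" "{a, b, c, d} \<subseteq> S"
  shows "arrangement (hyp ` S)"
  unfolding arrangement_def
proof (intro conjI ballI)
  show "finite (hyp ` S)"
    using assms(2) by simp
  show "lin_hyperplane H" if "H \<in> hyp ` S" for H
  proof -
    obtain a where "H = hyp a" "a \<in> S"
      using \<open>H \<in> hyp ` S\<close> by (rule imageE)
    moreover from this have "a \<noteq> 0"
      using assms(3) by auto
    ultimately show ?thesis
      unfolding lin_hyperplane_def hyp_def by (intro exI[of _ a]) simp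
  qed
  have "x = 0" if "x \<in> \<Inter>(hyp ` S)" for x
  proof -
    have "x \<in> hyp a" "x \<in> hyp b" "x \<in> hyp c" "x \<in> hyp d"
      using that assms(4) by simp_all
    then show ?thesis
      using assms(1) by (simp add: independent4_def hyp_def)
  qed
  moreover have "0 \<in> \<Inter>(hyp ` S)"
    by (simp add: hyp_def)
  ultimately show "\<Inter>(hyp ` S) = {0}"
    by blast
qed

lemma V_eq_0_iff: "V u = 0 \<longleftrightarrow> u = (0, 0, 0, 0)"
  by (cases u) (auto simp: vec4_eq_iff rvec_nth)

lemma int_arrI:
  assumes "distinct L" "list_all (\<lambda>(u, v). \<not> parallel u v) (pairs L)"
    and ind: "independent4 (V p) (V q) (V r) (V s)" and sub: "set [p, q, r, s] \<subseteq> set L"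
    and nz: "(0, 0, 0, 0) \<notin> set L"
  shows "int_arr L"
proof
  have "0 \<notin> V ` set L"
  proof
    assume "0 \<in> V ` set L"
    then obtain u where "V u = 0" "u \<in> set L"
      by (metis imageE)
    then show False
      using V_eq_0_iff nz by simp
  qed
  then show "arrangement (hyp ` V ` set L)"
    using sub by (intro arrangement_if_independent4[OF ind]) simp_all
qed fact+

lemma int_arr_A4: "int_arr roots_A4"
  by (rule int_arrI[OF _ _ independent_A4]; code_simp)

lemma int_arr_D4: "int_arr roots_D4"
  by (rule int_arrI[OF _ _ independent_D4]; code_simp)

text \<open>35 and 50 are the second and third elementary symmetric functions of the exponents 1, 2,
  3, 4 of $A_4$.\<close>

lemma counts_A4:
  "line_sum (line_list roots_A4) = 35" "vertex_sum (line_list roots_A4) (vertex_list roots_A4) = 50"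
  "list_all (\<lambda>I. length I \<le> 3) (line_list roots_A4)"
  "length (filter (\<lambda>I. length I = 3) (line_list roots_A4)) < length (filter (\<lambda>I. length I = 2) (line_list roots_A4))"
  by code_simp+

text \<open>Likewise 50 and 84 belong to the exponents 1, 3, 3, 5 of $D_4$.\<close>

lemma counts_D4:
  "line_sum (line_list roots_D4) = 50" "vertex_sum (line_list roots_D4) (vertex_list roots_D4) = 84"
  "list_all (\<lambda>I. length I \<le> 3) (line_list roots_D4)"
  "length (filter (\<lambda>I. length I = 3) (line_list roots_D4)) < length (filter (\<lambda>I. length I = 2) (line_list roots_D4))"
  by code_simp+

lemma splits_A4: "splits_over_R (char_poly arr_A4)"
proof -
  have "char_poly arr_A4 = [:24, -50, 35, -10, 1:]"
    using int_arr.char_poly_B[OF int_arr_A4] unfolding int_arr.B_def[OF int_arr_A4] counts_A4 arr_A4_eq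
    by (simp add: roots_A4_def)
  also have "\<dots> = smult 1 (\<Prod>r\<leftarrow>[1, 2, 3, 4]. [:- r, 1:])"
    by simp
  finally show ?thesis
    unfolding splits_over_R_def by blast
qed

lemma splits_D4: "splits_over_R (char_poly arr_D4)"
proof -
  have "char_poly arr_D4 = [:45, -84, 50, -12, 1:]"
    using int_arr.char_poly_B[OF int_arr_D4] unfolding int_arr.B_def[OF int_arr_D4] counts_D4 arr_D4_eq
    by (simp add: roots_D4_def)
  also have "\<dots> = smult 1 (\<Prod>r\<leftarrow>[1, 3, 3, 5]. [:- r, 1:])"
    by simp
  finally show ?thesis
    unfolding splits_over_R_def by blast
qed

section \<open>Transport of the properties from the models\<close>

text \<open>Simple lacedness is obtained from the weights of all lines, since two distinct walls
  always meet in a line; chambers need not be transported.\<close>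

lemma (in linear_iso) properties_image:
  assumes L: "int_arr L" and B: "B = hyp ` V ` set L" and "splits_over_R (char_poly B)"
    and le: "list_all (\<lambda>I. length I \<le> 3) (line_list L)"
    and lt: "length (filter (\<lambda>I. length I = 3) (line_list L)) < length (filter (\<lambda>I. length I = 2) (line_list L))"
  shows "arr_iso ((`) T ` B) B \<and> simply_laced ((`) T ` B) \<and> grunbaum_shephard ((`) T ` B) \<and>
    splits_over_R (char_poly ((`) T ` B))"
proof (intro conjI)
  interpret L: int_arr L
    by (rule L)
  have BL: "B = L.B"
    by (simp add: B L.B_def)
  show "arr_iso ((`) T ` B) B"
    by (rule arr_iso_image)
  show "grunbaum_shephard ((`) T ` B)"
    unfolding grunbaum_shephard_image BL by (rule L.grunbaum_shephard_B[OF le lt])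
  show "splits_over_R (char_poly ((`) T ` B))"
    unfolding char_poly_image by fact
  show "simply_laced ((`) T ` B)"
    unfolding simply_laced_def
  proof (intro ballI impI)
    fix C H K
    assume "H \<in> walls ((`) T ` B) C" "K \<in> walls ((`) T ` B) C" and ne: "H \<noteq> K"
    then have "H \<in> (`) T ` B" "K \<in> (`) T ` B"
      by (simp_all add: walls_def)
    then obtain H' K' where HK: "H = T ` H'" "K = T ` K'" "H' \<in> B" "K' \<in> B"
      by blast
    have "weight ((`) T ` B) (H \<inter> K) = weight B (H' \<inter> K')"
      unfolding HK image_Int[OF inj, symmetric] by (rule weight_image)
    also have "\<dots> \<le> 3"
      using HK ne unfolding BL by (intro L.line_weight_le[OF le]) auto
    finally show "card {M \<in> (`) T ` B. H \<inter> K \<subseteq> M} \<le> 3"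
      by (simp add: weight_def)
  qed
qed

theorem theorem3:
  fixes A :: "vec4 set set"
  assumes "arrangement A"
    and "simplicial A"
    and "\<not> reducible A"
    and "max_vertex_weight A = 6"
  shows "(arr_iso A arr_A4 \<or> arr_iso A arr_D4) \<and> simply_laced A \<and>
         grunbaum_shephard A \<and> splits_over_R (char_poly A)"
proof -
  obtain a b c d where ind: "independent4 a b c d"
    and A: "A = hyp ` path_roots a b c d \<or> A = hyp ` star_roots a b c d"
    using irreducible_simplicial_classification[OF assms(1-3)] assms(4) by auto
  from A show ?thesis
  proof
    assume "A = hyp ` path_roots a b c d"
    then obtain T where T: "linear_iso T" "A = (`) T ` arr_A4"
      using path_roots_image[OF independent_A4 ind] unfolding path_roots_A4 arr_A4_eq by blast
    show ?thesis
      using linear_iso.properties_image[OF T(1) int_arr_A4 arr_A4_eq splits_A4 counts_A4(3,4)]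
      unfolding T(2) by blast
  next
    assume "A = hyp ` star_roots a b c d"
    then obtain T where T: "linear_iso T" "A = (`) T ` arr_D4"
      using star_roots_image[OF independent_D4 ind] unfolding star_roots_D4 arr_D4_eq by blast
    show ?thesis
      using linear_iso.properties_image[OF T(1) int_arr_D4 arr_D4_eq splits_D4 counts_D4(3,4)]
      unfolding T(2) by blast
  qed
qed

end
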